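(* Let $0<\lambda<1$ be an irrational number, and let $m$ and $k$ be integers such that $1\leq m\leq k$, $(m,k)=1$. Let $f(n)$ be a multiplicative (complex-valued) arithmetic function and suppose that the associated Dirichlet series $F(s)=\sum_{n\geq 1} f(n)n^{-s}$ is absolutely convergent for $\sigma>1$. Suppose furthermore that: (i) for some positive integer $d$ there are complex numbers $f_j(p)$ ($p$ prime, $1\le j\le d$) such that $\log F(s) = -\sum_p \sum_{j=1}^d\log(1-f_j(p)p^{-s})$ for $\sigma>1$, with $|f_j(p)|\leq 1$ for every prime $p$ and any $j=1,\ldots,d$; (ii) $\sum_{n\leq x} |f(n)|^2\ll x$ for every $x\geq 1$; (iii) there exist positive constants $x_0$ and $A>6$ such that for any $x\geq x_0$ we have $$\sum_{p\leq x} |f(p)|^2 \gg \frac{x}{\log x}$$ and $$\sum_{p\leq x} |f(p)|^2\chi(p) \ll \frac{1}{\phi(q)}\frac{x}{\log^2 x}$$ for every non-principal Dirichlet character $\chi$ mod $q$, with $q\leq (\log x)^A$. Then, for any $\eta>0$, the twisted Dirichlet series $$F(\lambda,m,k,s)=\sum_{\substack{n\geq 1\\ n\equiv m\ (\mathrm{mod}\ k)}} \frac{f(n)e(\lambda n)}{n^{s}}$$ has infinitely many zeros $s=\sigma+it$ with $1<\sigma<1+\eta$.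
   Context: Notation: $s=\sigma+it$ is a complex variable, $e(z)=e^{2\pi i z}$, $p$ denotes primes, $\phi$ is Euler's totient function. In (i) the identity is the logarithmic form of the Euler product $F(s)=\prod_p\prod_{j=1}^d(1-f_j(p)p^{-s})^{-1}$ (principal branch of the logarithm on the right-hand side). The implied constants in (ii) and (iii) are independent of $x$, $q$ and $\chi$. *)

theory Defs
  imports "HOL-Analysis.Analysis" "HOL-Number_Theory.Number_Theory"
begin

definition e2pi :: "complex \<Rightarrow> complex" where
  "e2pi z = exp (2 * of_real pi * \<i> * z)"

definition multiplicative_fun :: "(nat \<Rightarrow> complex) \<Rightarrow> bool" where
  "multiplicative_fun f \<longleftrightarrow>
     f 1 = 1 \<and> (\<forall>a b. 0 < a \<longrightarrow> 0 < b \<longrightarrow> coprime a b \<longrightarrow> f (a * b) = f a * f b)"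

definition dirichlet_series :: "(nat \<Rightarrow> complex) \<Rightarrow> complex \<Rightarrow> complex" where
  "dirichlet_series f s = (\<Sum>\<^sub>\<infinity>n\<in>{1..}. f n / of_nat n powr s)"

definition twisted_series ::
  "(nat \<Rightarrow> complex) \<Rightarrow> real \<Rightarrow> nat \<Rightarrow> nat \<Rightarrow> complex \<Rightarrow> complex" where
  "twisted_series f lam m k s =
     (\<Sum>\<^sub>\<infinity>n\<in>{n. n \<ge> 1 \<and> [n = m] (mod k)}.
        f n * e2pi (of_real lam * of_nat n) / of_nat n powr s)"

text \<open>
  Characters are taken on the natural numbers; by periodicity such a function is the same
  thing as a homomorphism from the units modulo \<open>q\<close> to the nonzero complex numbers, extended
  by zero.  The value 1 at 1 follows from \<open>\<psi> 1 \<noteq> 0\<close> and multiplicativity.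
\<close>

definition dirichlet_character :: "nat \<Rightarrow> (nat \<Rightarrow> complex) \<Rightarrow> bool" where
  "dirichlet_character q \<psi> \<longleftrightarrow>
     q > 0 \<and>
     (\<forall>n. \<psi> (n + q) = \<psi> n) \<and>
     (\<forall>a b. \<psi> (a * b) = \<psi> a * \<psi> b) \<and>
     (\<forall>n. \<psi> n \<noteq> 0 \<longleftrightarrow> coprime n q)"

definition principal_character :: "nat \<Rightarrow> nat \<Rightarrow> complex" where
  "principal_character q n = (if coprime n q then 1 else 0)"

text \<open>
  The logarithmic form of a degree \<open>d\<close> Euler product.  The value \<open>logF s\<close> is some logarithm of
  \<open>F(s)\<close>, not necessarily the principal one; the logarithms in the sum over primes are
  principal.  Since all \<open>fj j p\<close> have modulus at most 1, the sum converges absolutely and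
  locally uniformly for \<open>Re s > 1\<close>, so that \<open>logF\<close> is automatically holomorphic there.
\<close>

definition log_euler_product ::
  "(nat \<Rightarrow> complex) \<Rightarrow> nat \<Rightarrow> (nat \<Rightarrow> nat \<Rightarrow> complex) \<Rightarrow> bool" where
  "log_euler_product f d fj \<longleftrightarrow>
     (\<forall>p. prime p \<longrightarrow> (\<forall>j\<in>{1..d}. norm (fj j p) \<le> 1)) \<and>
     (\<exists>logF. \<forall>s. Re s > 1 \<longrightarrow>
        exp (logF s) = dirichlet_series f s \<and>
        ((\<lambda>p. \<Sum>j=1..d. Ln (1 - fj j p * of_nat p powr (- s))) has_sum (- logF s))
          {p. prime p})"

end

theory Submission
  imports Defs "HOL-Complex_Analysis.Complex_Analysis" "HOL-Real_Asymp.Real_Asymp"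
begin

text \<open>
  Suppose that there are only finitely many zeros in the strip. By Kronecker's theorem every twist of
  the coefficients by a completely multiplicative unimodular function is a limit of vertical shifts,
  so by Hurwitz's theorem all these twists are zero-free in the strip.

  Twist by \<open>\<psi>(p) = h\<^sub>p w\<^bsup>e(p)\<^esup>\<close> with \<open>\<bar>h\<^sub>p\<bar> = 1\<close> and \<open>e(p) = 0\<close> for the primes up to a fixed
  bound \<open>N\<^sub>0\<close>. This gives a function of \<open>w\<close> on the closed unit disc that is nonzero for \<open>\<bar>w\<bar> = 1\<close>;
  deforming \<open>h\<close> to \<open>1\<close> shows that it is zero-free in the whole disc. Now take \<open>e(p) = 1\<close> on a finite
  set \<open>Q\<close> of primes congruent to \<open>m\<close> modulo \<open>k\<close>, and let \<open>e(p) \<rightarrow> \<infinity>\<close> at all other primes above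
  \<open>N\<^sub>0\<close>, which removes them when \<open>\<bar>w\<bar> < 1\<close>. What remains is \<open>a\<^sub>0 + a\<^sub>1 w\<close> plus the contribution of the
  integers with at least two prime factors in \<open>Q\<close>. Here \<open>a\<^sub>0\<close> is bounded independently of \<open>Q\<close>, and \<open>a\<^sub>1\<close>
  can be made at least a constant times \<open>\<Sum>\<^bsub>p\<in>Q\<^esub> \<bar>f(p)\<bar>/p\<close>, which can be chosen as large as desired.

  The remaining contribution is small if \<open>Q\<close> lies in \<open>[q, q\<^sup>t]\<close>, where \<open>q\<close> is a large denominator with
  \<open>\<bar>\<lambda> - A/q\<bar> < 1/q\<^sup>2\<close>: writing \<open>n = p v\<close> with \<open>p \<in> Q\<close> gives a bilinear sum with phases
  \<open>e(\<lambda> p v)\<close>, and both variables have length at least \<open>q\<close>, so that Cauchy--Schwarz saves a power of \<open>q\<close>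
  against losses that are powers of \<open>log q\<close>. Hence the function has a zero near \<open>-a\<^sub>0/a\<^sub>1\<close>, a contradiction.
\<close>

section \<open>Twists and vertical shifts\<close>

text \<open>The phases e(\<lambda> n) couple all prime factors of n, so the series has no Euler
  product and a single prime cannot be split off. What survives is freedom of the twist, hence the
  route through functions on a disc. Two demands conflict there. The linear coefficient is large
  only for \<sigma> close to 1, at a distance that depends on \<open>Q\<close>, whereas the start of
  the deformation, near-constancy of the disc function, can be checked only where the terms beyond
  N0 are small against the value of the series. So the deformation moves the abscissa as well: N0 is
  fixed once at an interior point \<sigma>0 of the strip, before \<open>Q\<close> exists, and
  zero-freeness is carried from \<sigma>0 to \<sigma>. The range [q, q^t] has an exact reason: ln ln
  (q^t) - ln ln q = ln t, so a constant t makes the sum over primes of any prescribed size, while ln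
  (q^t) stays a constant multiple of ln q. Two or more prime factors from \<open>Q\<close> are what
  makes both variables of the bilinear sum long: after one prime p is removed, v still contains
  another one, so v is at least q. Integers divisible by the square of a prime in \<open>Q\<close>
  do not fit this scheme and are bounded in absolute value.\<close>

definition cm_ext :: "(nat \<Rightarrow> 'a::comm_monoid_mult) \<Rightarrow> nat \<Rightarrow> 'a" where
  "cm_ext \<psi> n = prod_mset (image_mset \<psi> (prime_factorization n))"

lemma cm_ext_1 [simp]: "cm_ext \<psi> 1 = 1" "cm_ext \<psi> (Suc 0) = 1"
  by (simp_all add: cm_ext_def)

lemma cm_ext_mult: "a > 0 \<Longrightarrow> b > 0 \<Longrightarrow> cm_ext \<psi> (a * b) = cm_ext \<psi> a * cm_ext \<psi> b"
  by (simp add: cm_ext_def prime_factorization_mult)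

lemma cm_ext_prime: "prime p \<Longrightarrow> cm_ext \<psi> p = \<psi> p"
  by (simp add: cm_ext_def prime_factorization_prime)

lemma cm_ext_distrib: "cm_ext (\<lambda>p. \<phi> p * \<psi> p) n = cm_ext \<phi> n * cm_ext \<psi> n"
  by (simp add: cm_ext_def prod_mset.distrib)

lemma cm_ext_cong: "(\<And>p. prime p \<Longrightarrow> p dvd n \<Longrightarrow> \<phi> p = \<psi> p) \<Longrightarrow> cm_ext \<phi> n = cm_ext \<psi> n"
  unfolding cm_ext_def by (intro arg_cong[where f = prod_mset] image_mset_cong) (auto simp: prime_factors_dvd)

lemma cm_ext_const_1: "cm_ext (\<lambda>_. 1) n = 1"
  by (simp add: cm_ext_def)

lemma norm_cm_ext:
  fixes \<psi> :: "nat \<Rightarrow> complex"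
  shows "norm (cm_ext \<psi> n) = cm_ext (\<lambda>p. norm (\<psi> p)) n"
proof -
  have "norm (prod_mset (image_mset \<psi> M)) = prod_mset (image_mset (\<lambda>p. norm (\<psi> p)) M)" for M
    by (induction M) (auto simp: norm_mult)
  thus ?thesis by (simp add: cm_ext_def)
qed

lemma norm_cm_ext_1:
  fixes \<psi> :: "nat \<Rightarrow> complex"
  assumes "\<And>p. prime p \<Longrightarrow> norm (\<psi> p) = 1"
  shows "norm (cm_ext \<psi> n) = 1"
proof -
  have "norm (cm_ext \<psi> n) = cm_ext (\<lambda>_. 1) n"
    unfolding norm_cm_ext by (rule cm_ext_cong) (use assms in auto)
  thus ?thesis by (simp add: cm_ext_const_1)
qed

text \<open>For the indicator of a set of primes this counts the prime factors in the set with
  multiplicity. It becomes the exponent of \<open>w\<close> when each prime is twisted by a power of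
  \<open>w\<close>.\<close>

definition add_ext :: "(nat \<Rightarrow> nat) \<Rightarrow> nat \<Rightarrow> nat" where
  "add_ext e n = sum_mset (image_mset e (prime_factorization n))"

lemma add_ext_1 [simp]: "add_ext e 1 = 0" "add_ext e (Suc 0) = 0"
  by (simp_all add: add_ext_def)

lemma add_ext_mult: "a > 0 \<Longrightarrow> b > 0 \<Longrightarrow> add_ext e (a * b) = add_ext e a + add_ext e b"
  by (simp add: add_ext_def prime_factorization_mult)

lemma add_ext_prime: "prime p \<Longrightarrow> add_ext e p = e p"
  by (simp add: add_ext_def prime_factorization_prime)

lemma add_ext_cong: "(\<And>p. prime p \<Longrightarrow> p dvd n \<Longrightarrow> e p = e' p) \<Longrightarrow> add_ext e n = add_ext e' n"
  unfolding add_ext_def by (intro arg_cong[where f = sum_mset] image_mset_cong) (auto simp: prime_factors_dvd)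

lemma add_ext_eq_0_iff:
  assumes "n > 0"
  shows "add_ext e n = 0 \<longleftrightarrow> (\<forall>p. prime p \<longrightarrow> p dvd n \<longrightarrow> e p = 0)"
  unfolding add_ext_def using assms by (auto simp: prime_factors_dvd)

lemma add_ext_ge:
  assumes "n > 0" "prime p" "p dvd n"
  shows "e p \<le> add_ext e n"
proof -
  from assms obtain m where m: "n = p * m" by (auto elim: dvdE)
  with assms have "m > 0" by (cases m) auto
  thus ?thesis using assms m by (simp add: add_ext_mult add_ext_prime prime_gt_0_nat)
qed

lemma cm_ext_power:
  fixes w :: "'a :: comm_monoid_mult"
  shows "cm_ext (\<lambda>p. w ^ e p) n = w ^ add_ext e n"
proof -
  have "prod_mset (image_mset (\<lambda>p. w ^ e p) M) = w ^ sum_mset (image_mset e M)" for M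
    by (induction M) (auto simp: power_add)
  thus ?thesis by (simp add: cm_ext_def add_ext_def)
qed

text \<open>A vertical shift is itself a completely multiplicative unimodular twist of the
  coefficients, so a twist has to be approximated by shifts only at the primes.\<close>

lemma cm_ext_powr:
  assumes "n > 0"
  shows "cm_ext (\<lambda>p. of_nat p powr z) n = (of_nat n powr z :: complex)"
  using assms
proof (induction n rule: prime_divisors_induct)
  case zero thus ?case by simp
next
  case (unit x) thus ?case by simp
next
  case (factor p x)
  hence "x > 0" "p > 0" by (auto intro: gr0I)
  moreover have "of_nat (p * x) powr z = (of_nat p powr z * of_nat x powr z :: complex)"
    using powr_times_real[of "of_nat p" "of_nat x" z] by simp
  ultimately show ?case using factor by (simp add: cm_ext_mult cm_ext_prime)
qed

section \<open>Kronecker approximation at the primes\<close>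

lemma independent_ln_primes:
  assumes "finite P" "\<And>p. p \<in> P \<Longrightarrow> prime p"
    and "(\<Sum>p\<in>P. of_int (u p) * ln (real p)) = 0" "p \<in> P"
  shows "u p = (0::int)"
proof -
  \<comment> \<open>\<open>nat\<close> truncates at 0, so \<open>A\<close> and \<open>B\<close>
    collect the positive and the negative exponents. The vanishing combination says
    \<open>A = B\<close>, and unique factorization compares the exponents of
    \<open>p\<close>.\<close>
  define A where "A = (\<Prod>p\<in>P. p ^ nat (u p))"
  define B where "B = (\<Prod>p\<in>P. p ^ nat (- u p))"
  have pos: "real q > 0" if "q \<in> P" for q
    using assms(2)[OF that] prime_gt_0_nat by simp
  have lnA: "ln (real A) = (\<Sum>p\<in>P. real (nat (u p)) * ln (real p))"
    unfolding A_def of_nat_prod of_nat_power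
    by (subst ln_prod) (use pos assms(1) in \<open>auto simp: ln_realpow less_imp_neq\<close>)
  have lnB: "ln (real B) = (\<Sum>p\<in>P. real (nat (- u p)) * ln (real p))"
    unfolding B_def of_nat_prod of_nat_power
    by (subst ln_prod) (use pos assms(1) in \<open>auto simp: ln_realpow less_imp_neq\<close>)
  have "ln (real A) - ln (real B) = (\<Sum>p\<in>P. of_int (u p) * ln (real p))"
    unfolding lnA lnB sum_subtractf[symmetric] left_diff_distrib[symmetric]
    by (intro sum.cong refl arg_cong2[where f = "(*)"]) linarith
  hence "ln (real A) = ln (real B)" using assms by simp
  moreover have "A > 0" "B > 0" unfolding A_def B_def using pos by (auto intro!: prod_pos)
  ultimately have AB: "A = B" by simp
  have "multiplicity p A = nat (u p)"
    unfolding A_def using assms by (subst multiplicity_prod_prime_powers) auto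
  moreover have "multiplicity p B = nat (- u p)"
    unfolding B_def using assms by (subst multiplicity_prod_prime_powers) auto
  ultimately show ?thesis using AB by simp
qed

lemma norm_exp_2pi_diff_le:
  fixes x y :: real and z :: int
  shows "norm (exp (2 * of_real pi * \<i> * of_real x) - exp (2 * of_real pi * \<i> * of_real y))
           \<le> 2 * pi * \<bar>x - y - of_int z\<bar>"
proof -
  have eq: "exp (2 * of_real pi * \<i> * of_real x) = exp (2 * of_real pi * \<i> * complex_of_real (x - of_int z))"
  proof -
    have "exp (2 * of_real pi * \<i> * complex_of_real (x - of_int z)) =
          exp (2 * of_real pi * \<i> * of_real x) * exp (2 * complex_of_int (-z) * of_real pi * \<i>)"
      unfolding exp_add[symmetric] by (simp add: algebra_simps)
    also have "exp (2 * complex_of_int (-z) * of_real pi * \<i>) = 1"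
      using exp_integer_2pi[of "real_of_int (-z)"] by simp
    finally show ?thesis by simp
  qed
  have "exp (2 * of_real pi * \<i> * of_real x) - exp (2 * of_real pi * \<i> * of_real y) =
          exp (2 * of_real pi * \<i> * of_real y) * (exp (\<i> * complex_of_real (2 * pi * (x - y - of_int z))) - 1)"
    unfolding eq by (simp add: algebra_simps exp_diff exp_add)
  also have "norm \<dots> = norm (exp (\<i> * complex_of_real (2 * pi * (x - y - of_int z))) - 1)"
    by (simp add: norm_mult)
  also have "\<dots> = 2 * \<bar>sin (2 * pi * (x - y - of_int z) / 2)\<bar>"
    by (rule dist_exp_i_1)
  also have "\<dots> \<le> 2 * \<bar>2 * pi * (x - y - of_int z) / 2\<bar>"
    by (intro mult_left_mono abs_sin_x_le_abs_x) auto
  also have "\<dots> = 2 * pi * \<bar>x - y - of_int z\<bar>"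
    by (simp add: abs_mult)
  finally show ?thesis .
qed

text \<open>Kronecker's theorem yields a real \<open>t\<close> of unknown size. Simultaneous
  Dirichlet approximation yields an arbitrarily large almost-period of all the frequencies;
  subtracting \<open>t\<close> from it gives a shift that is large and still hits the
  phases.\<close>

lemma kronecker_primes:
  fixes \<psi> :: "nat \<Rightarrow> complex"
  assumes "finite P" and prime: "\<And>p. p \<in> P \<Longrightarrow> prime p"
    and norm: "\<And>p. p \<in> P \<Longrightarrow> norm (\<psi> p) = 1" and "\<epsilon> > 0"
  obtains \<tau> :: real where "\<tau> \<ge> T" "\<And>p. p \<in> P \<Longrightarrow> norm (of_nat p powr (- \<i> * of_real \<tau>) - \<psi> p) < \<epsilon>"
proof -
  define n where "n = card P"
  obtain h where h: "bij_betw h {..<n} P"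
    using ex_bij_betw_nat_finite[OF assms(1)] by (auto simp: n_def atLeast0LessThan)
  define \<theta> where "\<theta> = (\<lambda>i. ln (real (h i)) / (2 * pi))"
  define \<alpha> where "\<alpha> = (\<lambda>i. Arg (\<psi> (h i)) / (2 * pi))"
  \<comment> \<open>The two approximations contribute at most \<open>\<delta>\<close> each, and a
    distance modulo 1 costs a factor \<open>2 * pi\<close> on the circle.\<close>
  define \<delta> where "\<delta> = \<epsilon> / (4 * pi)"
  have \<delta>: "\<delta> > 0" using assms by (simp add: \<delta>_def)
  have hP: "h i \<in> P" if "i < n" for i using h that by (auto simp: bij_betw_def)
  have \<theta>_eq: "\<theta> i = \<theta> j \<Longrightarrow> i = j" if "i < n" "j < n" for i j
  proof -
    assume "\<theta> i = \<theta> j"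
    hence "h i = h j" using prime_gt_0_nat[OF prime[OF hP[OF that(1)]]] prime_gt_0_nat[OF prime[OF hP[OF that(2)]]]
      by (simp add: \<theta>_def)
    thus "i = j" using h that by (auto simp: bij_betw_def inj_on_def)
  qed
  hence inj: "inj_on \<theta> {..<n}" by (auto simp: inj_on_def)
  \<comment> \<open>Independence is needed over the integers only, so the reals are viewed as a
    Z-module.\<close>
  interpret M: Modules.module "(\<lambda>r. (*) (real_of_int r))"
    by (simp add: Modules.module.intro distrib_left mult.commute)
  have "M.independent (\<theta> ` {..<n})"
    unfolding M.independent_explicit_module
  proof (intro allI impI)
    fix t u v assume t: "finite t" "t \<subseteq> \<theta> ` {..<n}" "(\<Sum>v\<in>t. real_of_int (u v) * v) = 0" "v \<in> t"
    define Q where "Q = {i. i < n \<and> \<theta> i \<in> t}"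
    have Qt: "t = \<theta> ` Q" using t(2) by (auto simp: Q_def)
    have injQ: "inj_on \<theta> Q" using inj by (auto simp: inj_on_def Q_def)
    have injh: "inj_on h Q" using h by (auto simp: bij_betw_def inj_on_def Q_def)
    have finQ: "finite Q" by (simp add: Q_def)
    define u' where "u' = (\<lambda>p. u (ln (real p) / (2 * pi)))"
    have "0 = (\<Sum>i\<in>Q. real_of_int (u (\<theta> i)) * \<theta> i)"
      using t(3) unfolding Qt by (subst (asm) sum.reindex[OF injQ]) (simp add: o_def)
    also have "\<dots> = (\<Sum>i\<in>Q. real_of_int (u' (h i)) * ln (real (h i))) / (2 * pi)"
      by (simp add: \<theta>_def u'_def sum_divide_distrib)
    also have "(\<Sum>i\<in>Q. real_of_int (u' (h i)) * ln (real (h i))) = (\<Sum>p\<in>h ` Q. of_int (u' p) * ln (real p))"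
      by (subst sum.reindex[OF injh]) (simp add: o_def)
    finally have 0: "(\<Sum>p\<in>h ` Q. of_int (u' p) * ln (real p)) = 0" by simp
    obtain i where i: "i \<in> Q" "v = \<theta> i" using t(4) Qt by auto
    have "u' (h i) = 0"
      by (rule independent_ln_primes[OF _ _ 0]) (use i finQ prime hP in \<open>auto simp: Q_def\<close>)
    thus "u v = 0" by (simp add: i u'_def \<theta>_def)
  qed
  then obtain t k where t: "\<And>i. i < n \<Longrightarrow> \<bar>t * \<theta> i - of_int (k i) - \<alpha> i\<bar> < \<delta>"
    using Kronecker_thm_1[OF _ inj \<delta>] by metis
  \<comment> \<open>Every positive integer multiple of \<open>R\<close> exceeds \<open>t\<close> by
    at least \<open>T\<close>.\<close>
  define R where "R = \<bar>T\<bar> + \<bar>t\<bar>"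
  obtain N :: nat where N: "N > 0" "1 / real N < \<delta>"
    using \<delta> nat_approx_posE by (metis zero_less_Suc)
  obtain q r where q: "0 < q" "\<And>i. i < n \<Longrightarrow> \<bar>of_int q * (R * \<theta> i) - of_int (r i)\<bar> < 1 / N"
    using Dirichlet_approx_simult[OF N(1), of n "\<lambda>i. R * \<theta> i"] by metis
  \<comment> \<open>The sign is forced by the exponent \<open>- \<i> * \<tau>\<close>: the phase
    \<open>- \<tau> * \<theta> i\<close> is \<open>t * \<theta> i\<close> minus an almost-integer,
    hence close to \<open>\<alpha> i\<close> modulo 1.\<close>
  define \<tau> where "\<tau> = of_int q * R - t"
  show ?thesis
  proof (rule that[of \<tau>])
    have "R * 1 \<le> R * of_int q" using q(1) by (intro mult_left_mono) (auto simp: R_def)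
    thus "\<tau> \<ge> T" by (simp add: \<tau>_def R_def algebra_simps)
  next
    fix p assume p: "p \<in> P"
    then obtain i where i: "i < n" "p = h i" using h by (auto simp: bij_betw_def)
    have p0: "p > 0" using prime[OF p] by (simp add: prime_gt_0_nat)
    have e1: "of_nat p powr (- \<i> * of_real \<tau>) = exp (2 * of_real pi * \<i> * complex_of_real (- \<tau> * \<theta> i))"
      using p0 i by (simp add: powr_def \<theta>_def field_simps flip: Ln_of_nat)
    have e2: "\<psi> p = exp (2 * of_real pi * \<i> * complex_of_real (\<alpha> i))"
    proof -
      have "\<psi> p \<noteq> 0" using norm[OF p] by auto
      hence "\<psi> p = of_real (norm (\<psi> p)) * exp (\<i> * of_real (Arg (\<psi> p)))" by (rule Arg_eq)
      thus ?thesis using norm[OF p] i by (simp add: \<alpha>_def)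
    qed
    have "norm (of_nat p powr (- \<i> * of_real \<tau>) - \<psi> p) \<le> 2 * pi * \<bar>- \<tau> * \<theta> i - \<alpha> i - of_int (k i - r i)\<bar>"
      unfolding e1 e2 by (rule norm_exp_2pi_diff_le)
    also have "\<dots> < 2 * pi * (2 * \<delta>)"
      using t[OF i(1)] q(2)[OF i(1)] N(2)
      by (intro mult_strict_left_mono) (auto simp: \<tau>_def algebra_simps abs_less_iff)
    also have "\<dots> = \<epsilon>" by (simp add: \<delta>_def)
    finally show "norm (of_nat p powr (- \<i> * of_real \<tau>) - \<psi> p) < \<epsilon>" .
  qed
qed

lemma tendsto_cm_ext:
  fixes \<psi> :: "nat \<Rightarrow> complex"
  assumes "\<And>p. prime p \<Longrightarrow> ((\<lambda>i. \<phi> i p) \<longlongrightarrow> \<psi> p) F"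
  shows "((\<lambda>i. cm_ext (\<phi> i) n) \<longlongrightarrow> cm_ext \<psi> n) F"
proof -
  have "((\<lambda>i. prod_mset (image_mset (\<phi> i) M)) \<longlongrightarrow> prod_mset (image_mset \<psi> M)) F"
    if "\<And>p. p \<in># M \<Longrightarrow> prime p" for M
    using that by (induction M) (auto intro!: tendsto_mult assms)
  thus ?thesis unfolding cm_ext_def by (auto intro: in_prime_factors_imp_prime)
qed

text \<open>A diagonal choice: the shift with index \<open>i\<close> serves all primes up to
  \<open>i\<close> with error below \<open>1 / Suc i\<close>. Convergence at primes passes to every
  \<open>n\<close> by multiplicativity. The growth of the shifts is used later to climb above all
  zeros.\<close>

lemma vertical_shifts_approximate:
  fixes \<psi> :: "nat \<Rightarrow> complex"
  assumes "\<And>p. prime p \<Longrightarrow> norm (\<psi> p) = 1"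
  shows "\<exists>\<tau> :: nat \<Rightarrow> real. (\<forall>i. \<tau> i \<ge> real i) \<and>
    (\<forall>n>0. (\<lambda>i. of_nat n powr (- \<i> * of_real (\<tau> i))) \<longlonglongrightarrow> cm_ext \<psi> n)"
proof -
  have "\<exists>\<tau>\<ge>real i. \<forall>p\<in>{p. prime p \<and> p \<le> i}. norm (of_nat p powr (- \<i> * of_real \<tau>) - \<psi> p) < 1 / Suc i" for i
    by (rule kronecker_primes[of "{p. prime p \<and> p \<le> i}" \<psi> "1 / Suc i" "real i"]) (use assms in auto)
  then obtain \<tau> where \<tau>: "\<And>i. \<tau> i \<ge> real i"
    "\<And>i p. prime p \<Longrightarrow> p \<le> i \<Longrightarrow> norm (of_nat p powr (- \<i> * of_real (\<tau> i)) - \<psi> p) < 1 / Suc i"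
    by (metis (mono_tags, lifting) mem_Collect_eq)
  show ?thesis
  proof (intro exI[of _ \<tau>] conjI allI impI \<tau>(1))
    fix n :: nat assume n: "n > 0"
    have "(\<lambda>i. of_nat p powr (- \<i> * of_real (\<tau> i))) \<longlonglongrightarrow> \<psi> p" if p: "prime p" for p
    proof (rule LIM_zero_cancel, rule Lim_null_comparison)
      show "(\<lambda>i. 1 / real (Suc i)) \<longlonglongrightarrow> 0"
        using LIMSEQ_inverse_real_of_nat by (simp add: inverse_eq_divide)
      show "\<forall>\<^sub>F i in sequentially. norm (of_nat p powr (- \<i> * of_real (\<tau> i)) - \<psi> p) \<le> 1 / real (Suc i)"
        using eventually_ge_at_top[of p] by eventually_elim (use \<tau>(2)[OF p] in \<open>auto simp: less_imp_le\<close>)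
    qed
    hence "(\<lambda>i. cm_ext (\<lambda>p. of_nat p powr (- \<i> * of_real (\<tau> i))) n) \<longlonglongrightarrow> cm_ext \<psi> n"
      by (rule tendsto_cm_ext)
    thus "(\<lambda>i. of_nat n powr (- \<i> * of_real (\<tau> i))) \<longlonglongrightarrow> cm_ext \<psi> n"
      using n by (simp add: cm_ext_powr)
  qed
qed

section \<open>Analytic functions given by series\<close>

lemma infsum_diff:
  fixes f g :: "'a \<Rightarrow> 'b :: {topological_ab_group_add, t2_space}"
  assumes "f summable_on A" "g summable_on A"
  shows "infsum (\<lambda>x. f x - g x) A = infsum f A - infsum g A"
  using infsum_add[OF assms(1), of "\<lambda>x. - g x"] assms(2) by (simp add: infsum_uminus summable_on_uminus)

lemma continuous_on_infsum:
  fixes f :: "'a \<Rightarrow> 'b :: topological_space \<Rightarrow> complex"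
  assumes "\<And>n. n \<in> A \<Longrightarrow> continuous_on S (f n)"
    and "\<And>n x. n \<in> A \<Longrightarrow> x \<in> S \<Longrightarrow> norm (f n x) \<le> M n" and "M summable_on A"
  shows "continuous_on S (\<lambda>x. \<Sum>\<^sub>\<infinity>n\<in>A. f n x)"
proof (rule uniform_limit_theorem)
  show "uniform_limit S (\<lambda>X y. \<Sum>x\<in>X. f x y) (\<lambda>x. \<Sum>\<^sub>\<infinity>n\<in>A. f n x) (finite_subsets_at_top A)"
    by (rule Weierstrass_m_test_general) (use assms in auto)
  show "\<forall>\<^sub>F X in finite_subsets_at_top A. continuous_on S (\<lambda>y. \<Sum>x\<in>X. f x y)"
    by (rule eventually_finite_subsets_at_top_weakI) (auto intro!: continuous_on_sum assms(1))
qed auto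

lemma holomorphic_on_infsum:
  fixes f :: "'a \<Rightarrow> complex \<Rightarrow> complex"
  assumes "open S" "\<And>n. n \<in> A \<Longrightarrow> f n holomorphic_on S"
    and "\<And>n x. n \<in> A \<Longrightarrow> x \<in> S \<Longrightarrow> norm (f n x) \<le> M n" and "M summable_on A"
  shows "(\<lambda>x. \<Sum>\<^sub>\<infinity>n\<in>A. f n x) holomorphic_on S"
proof -
  have "(\<lambda>x. \<Sum>\<^sub>\<infinity>n\<in>A. f n x) field_differentiable at z" if zS: "z \<in> S" for z
  proof -
    obtain r where r: "r > 0" "cball z r \<subseteq> S" using assms(1) zS open_contains_cball[of S] by auto
    have "uniform_limit S (\<lambda>X y. \<Sum>x\<in>X. f x y) (\<lambda>x. \<Sum>\<^sub>\<infinity>n\<in>A. f n x) (finite_subsets_at_top A)"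
      by (rule Weierstrass_m_test_general) (use assms in auto)
    hence ul: "uniform_limit (cball z r) (\<lambda>X y. \<Sum>x\<in>X. f x y) (\<lambda>x. \<Sum>\<^sub>\<infinity>n\<in>A. f n x) (finite_subsets_at_top A)"
      using r uniform_limit_on_subset by blast
    have "continuous_on (cball z r) (\<lambda>y. \<Sum>x\<in>X. f x y) \<and> (\<lambda>y. \<Sum>x\<in>X. f x y) holomorphic_on ball z r"
      if "X \<subseteq> A" for X
    proof -
      have "(\<lambda>y. \<Sum>x\<in>X. f x y) holomorphic_on S"
        using that by (auto intro!: holomorphic_on_sum assms(2))
      hence *: "(\<lambda>y. \<Sum>x\<in>X. f x y) holomorphic_on cball z r"
        using r(2) by (rule holomorphic_on_subset)
      show ?thesis
        using holomorphic_on_imp_continuous_on[OF *] holomorphic_on_subset[OF * ball_subset_cball] by blast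
    qed
    hence "\<forall>\<^sub>F X in finite_subsets_at_top A. continuous_on (cball z r) (\<lambda>y. \<Sum>x\<in>X. f x y) \<and>
             (\<lambda>y. \<Sum>x\<in>X. f x y) holomorphic_on ball z r"
      by (intro eventually_finite_subsets_at_top_weakI) blast
    then have "(\<lambda>x. \<Sum>\<^sub>\<infinity>n\<in>A. f n x) holomorphic_on ball z r"
      by (rule holomorphic_uniform_limit[OF _ ul]) simp_all
    thus ?thesis using r(1) by (auto intro: holomorphic_on_imp_differentiable_at)
  qed
  thus ?thesis unfolding holomorphic_on_def by (auto intro: field_differentiable_at_within)
qed

text \<open>Dominated convergence along an arbitrary filter. The bound on \<open>g\<close> is a
  separate hypothesis because deducing it from the limit would need a nontrivial filter.\<close>

lemma tendsto_infsum:
  fixes f :: "'i \<Rightarrow> 'a \<Rightarrow> 'b :: banach" and M :: "'a \<Rightarrow> real"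
  assumes lim: "\<And>n. n \<in> A \<Longrightarrow> ((\<lambda>i. f i n) \<longlongrightarrow> g n) F"
    and bd: "\<And>i n. n \<in> A \<Longrightarrow> norm (f i n) \<le> M n" and M: "M summable_on A"
    and bdg: "\<And>n. n \<in> A \<Longrightarrow> norm (g n) \<le> M n"
  shows "((\<lambda>i. infsum (f i) A) \<longlongrightarrow> infsum g A) F"
proof (rule tendstoI)
  fix \<epsilon> :: real assume \<epsilon>: "\<epsilon> > 0"
  have "((\<lambda>B. sum M B) \<longlongrightarrow> infsum M A) (finite_subsets_at_top A)"
    using M infsum_tendsto by blast
  hence "eventually (\<lambda>B. dist (sum M B) (infsum M A) < \<epsilon> / 4) (finite_subsets_at_top A)"
    using \<epsilon> by (intro tendstoD) auto
  then obtain B where B: "finite B" "B \<subseteq> A" "dist (sum M B) (infsum M A) < \<epsilon> / 4"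
    unfolding eventually_finite_subsets_at_top by auto
  have MD: "M summable_on (A - B)" using M by (rule summable_on_subset) auto
  have AB: "(A - B) \<union> B = A" using B(2) by auto
  have "infsum M ((A - B) \<union> B) = infsum M (A - B) + infsum M B"
    by (rule infsum_Un_disjoint) (use MD B in auto)
  hence "infsum M A = infsum M (A - B) + infsum M B" unfolding AB .
  hence tail: "infsum M (A - B) < \<epsilon> / 4" using B by (auto simp: dist_real_def)
  have "((\<lambda>i. \<Sum>n\<in>B. norm (f i n - g n)) \<longlongrightarrow> (\<Sum>n\<in>B. norm (g n - g n))) F"
    using B by (intro tendsto_sum tendsto_norm tendsto_diff lim tendsto_const) auto
  hence "eventually (\<lambda>i. (\<Sum>n\<in>B. norm (f i n - g n)) < \<epsilon> / 4) F"
    using \<epsilon> by (intro order_tendstoD(2)) auto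
  thus "eventually (\<lambda>i. dist (infsum (f i) A) (infsum g A) < \<epsilon>) F"
  proof eventually_elim
    case (elim i)
    have fs: "f i summable_on A"
      by (rule abs_summable_summable, rule Infinite_Sum.abs_summable_on_comparison_test'[OF M bd])
    have gs: "g summable_on A"
      by (rule abs_summable_summable, rule Infinite_Sum.abs_summable_on_comparison_test'[OF M bdg])
    have le: "norm (f i n - g n) \<le> 2 * M n" if "n \<in> A" for n
      using norm_triangle_ineq4[of "f i n" "g n"] bd[OF that, of i] bdg[OF that] by linarith
    have ds: "(\<lambda>n. norm (f i n - g n)) summable_on A"
      by (rule Infinite_Sum.abs_summable_on_comparison_test'[of "\<lambda>n. 2 * M n"]) (use le M in \<open>auto intro: summable_on_cmult_right\<close>)
    have "dist (infsum (f i) A) (infsum g A) = norm (infsum (\<lambda>n. f i n - g n) A)"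
      using fs gs infsum_add[OF fs, of "\<lambda>n. - g n"] by (simp add: dist_norm infsum_uminus summable_on_uminus)
    also have "\<dots> \<le> infsum (\<lambda>n. norm (f i n - g n)) A"
      by (rule norm_infsum_bound[OF ds])
    also have "\<dots> = infsum (\<lambda>n. norm (f i n - g n)) ((A - B) \<union> B)" unfolding AB ..
    also have "\<dots> = infsum (\<lambda>n. norm (f i n - g n)) (A - B) + infsum (\<lambda>n. norm (f i n - g n)) B"
      by (rule infsum_Un_disjoint) (use ds B in \<open>auto intro: summable_on_subset\<close>)
    also have "infsum (\<lambda>n. norm (f i n - g n)) (A - B) \<le> infsum (\<lambda>n. 2 * M n) (A - B)"
      by (rule infsum_mono) (use ds le MD in \<open>auto intro: summable_on_subset summable_on_cmult_right\<close>)
    also have "\<dots> = 2 * infsum M (A - B)"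
      using MD by (simp add: infsum_cmult_right)
    finally show ?case using tail elim B \<epsilon> by simp
  qed
qed

section \<open>Zero-free functions on a disc\<close>

lemma minimum_modulus_cball:
  fixes f :: "complex \<Rightarrow> complex"
  assumes "continuous_on (cball 0 r) f" "f holomorphic_on ball 0 r" "\<And>w. w \<in> cball 0 r \<Longrightarrow> f w \<noteq> 0"
    and "\<delta> > 0" "\<And>w. norm w = r \<Longrightarrow> norm (f w) \<ge> \<delta>" "r > 0" "w \<in> cball 0 r"
  shows "norm (f w) \<ge> \<delta>"
proof -
  have "norm (1 / f w) \<le> 1 / \<delta>"
  proof (rule maximum_modulus_frontier[of "\<lambda>w. 1 / f w" "cball 0 r"])
    show "(\<lambda>w. 1 / f w) holomorphic_on interior (cball 0 r)"
      using assms by (auto intro!: holomorphic_intros)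
    show "continuous_on (closure (cball 0 r)) (\<lambda>w. 1 / f w)"
      using assms by (auto intro!: continuous_intros)
    show "norm (1 / f z) \<le> 1 / \<delta>" if "z \<in> frontier (cball 0 r)" for z
      using assms that by (auto simp: frontier_cball norm_divide intro!: divide_left_mono mult_pos_pos)
  qed (use assms in auto)
  thus ?thesis using assms by (auto simp: norm_divide field_simps)
qed

text \<open>A substitute for counting zeros by winding numbers. On the boundary the modulus is at
  least some \<open>\<delta>\<close> for all \<open>t\<close> by compactness; for a zero-free
  \<open>G t\<close> the minimum modulus principle carries this bound to the whole disc, and by
  uniform continuity a small change of \<open>t\<close> then cannot create a zero. The bound does
  not deteriorate, so finitely many steps of equal length suffice.\<close>

lemma zero_free_deformation:
  fixes G :: "real \<Rightarrow> complex \<Rightarrow> complex"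
  assumes cont: "continuous_on ({0..1} \<times> cball 0 1) (\<lambda>(t, w). G t w)"
    and hol: "\<And>t. t \<in> {0..1} \<Longrightarrow> G t holomorphic_on ball 0 1"
    and bdry: "\<And>t w. t \<in> {0..1} \<Longrightarrow> norm w = 1 \<Longrightarrow> G t w \<noteq> 0"
    and start: "\<And>w. w \<in> cball 0 1 \<Longrightarrow> G 1 w \<noteq> 0"
  shows "w \<in> cball 0 1 \<Longrightarrow> G 0 w \<noteq> 0"
proof -
  have cmp: "compact ({0..1::real} \<times> sphere (0::complex) 1)" "compact ({0..1::real} \<times> cball (0::complex) 1)"
    by (intro compact_Times; simp)+
  have "continuous_on ({0..1} \<times> sphere 0 1) (\<lambda>x. norm (case x of (t, w) \<Rightarrow> G t w))"
    using cont by (intro continuous_on_norm) (erule continuous_on_subset, auto)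
  moreover have "{0..1::real} \<times> sphere (0::complex) 1 \<noteq> {}"
    by auto
  ultimately obtain x where x: "x \<in> {0..1::real} \<times> sphere (0::complex) 1"
    "\<And>y. y \<in> {0..1::real} \<times> sphere (0::complex) 1 \<Longrightarrow> norm (case x of (t, w) \<Rightarrow> G t w) \<le> norm (case y of (t, w) \<Rightarrow> G t w)"
    using continuous_attains_inf[OF cmp(1)] by metis
  define \<delta> where "\<delta> = norm (case x of (t, w) \<Rightarrow> G t w)"
  have \<delta>: "\<delta> > 0" using x(1) bdry by (auto simp: \<delta>_def)
  have \<delta>_le: "norm (G t w) \<ge> \<delta>" if "t \<in> {0..1}" "norm w = 1" for t w
    using x(2)[of "(t, w)"] that by (auto simp: \<delta>_def)
  have contG: "continuous_on (cball 0 1) (G t)" if "t \<in> {0..1}" for t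
  proof -
    have "continuous_on (cball 0 1) ((\<lambda>(t, w). G t w) \<circ> (\<lambda>w. (t, w)))"
      by (rule continuous_on_compose) (use that in \<open>auto intro!: continuous_intros continuous_on_subset[OF cont]\<close>)
    thus ?thesis by (simp add: o_def)
  qed
  have min: "\<forall>w\<in>cball 0 1. norm (G t w) \<ge> \<delta>" if "t \<in> {0..1}" "\<forall>w\<in>cball 0 1. G t w \<noteq> 0" for t
    using minimum_modulus_cball[OF contG hol _ \<delta> \<delta>_le] that by auto
  have "uniformly_continuous_on ({0..1} \<times> cball 0 1) (\<lambda>(t, w). G t w)"
    by (rule compact_uniformly_continuous[OF cont cmp(2)])
  then obtain d where d: "d > 0" "\<And>t t' w. t \<in> {0..1} \<Longrightarrow> t' \<in> {0..1} \<Longrightarrow> w \<in> cball 0 1 \<Longrightarrow> \<bar>t - t'\<bar> < d \<Longrightarrow>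
      norm (G t w - G t' w) < \<delta>"
    unfolding uniformly_continuous_on_def using \<delta>
    by (force simp: dist_norm norm_Pair)
  have step: "\<forall>w\<in>cball 0 1. norm (G t' w) \<ge> \<delta>"
    if "t \<in> {0..1}" "t' \<in> {0..1}" "\<bar>t - t'\<bar> < d" "\<forall>w\<in>cball 0 1. norm (G t w) \<ge> \<delta>" for t t'
  proof (rule min[OF that(2)], safe)
    fix w assume w: "w \<in> cball 0 1" "G t' w = 0"
    have "norm (G t w) < \<delta>" using d(2)[OF that(1,2) w(1) that(3)] w(2) by simp
    thus False using that(4) w(1) by force
  qed
  \<comment> \<open>The parameter walks from 1 down to 0 in steps of half the continuity radius;
    \<open>max\<close> stops it at 0.\<close>
  have iter: "\<forall>w\<in>cball 0 1. norm (G (max 0 (1 - real n * (d / 2))) w) \<ge> \<delta>" for n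
  proof (induction n)
    case 0 show ?case using min[of 1] start by simp
  next
    case (Suc n)
    show ?case
      by (rule step[OF _ _ _ Suc.IH]) (use d(1) in \<open>auto simp: max_def field_simps\<close>)
  qed
  obtain n :: nat where "real n * (d / 2) > 1" using d(1) reals_Archimedean3[of "d/2"] by (metis half_gt_zero)
  with iter[of n] have "\<forall>w\<in>cball 0 1. norm (G 0 w) \<ge> \<delta>" by (simp add: max_def)
  thus "w \<in> cball 0 1 \<Longrightarrow> G 0 w \<noteq> 0" using \<delta> by force
qed

text \<open>If \<open>norm b * r\<close> were larger, the root \<open>- a / b\<close> would lie in
  the disc and \<open>f\<close> would be at most \<open>\<epsilon>\<close> there, whereas on the
  circle, and so by the minimum modulus principle also inside, \<open>f\<close> is at least
  \<open>norm b * r - norm a - \<epsilon>\<close>, which exceeds \<open>\<epsilon>\<close>.\<close>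

lemma zero_free_near_affine:
  fixes f :: "complex \<Rightarrow> complex"
  assumes "continuous_on (cball 0 r) f" "f holomorphic_on ball 0 r" "\<And>w. w \<in> cball 0 r \<Longrightarrow> f w \<noteq> 0"
    and near: "\<And>w. w \<in> cball 0 r \<Longrightarrow> norm (f w - (a + b * w)) \<le> \<epsilon>" and r: "r > 0"
  shows "norm b * r \<le> norm a + 2 * \<epsilon>"
proof (rule ccontr)
  assume neg: "\<not> ?thesis"
  have "0 \<le> norm (f 0 - (a + b * 0))" by simp
  also have "\<dots> \<le> \<epsilon>" by (rule near) (use r in auto)
  finally have \<epsilon>: "\<epsilon> \<ge> 0" .
  with neg have b: "b \<noteq> 0" using r by auto
  define w0 where "w0 = - a / b"
  have "norm a \<le> norm b * r" using neg \<epsilon> by linarith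
  hence w0: "w0 \<in> cball 0 r" using b by (simp add: w0_def norm_divide field_simps)
  define \<delta> where "\<delta> = norm b * r - norm a - \<epsilon>"
  have "norm (f w0) \<ge> \<delta>"
  proof (rule minimum_modulus_cball[OF assms(1-3) _ _ r w0])
    show "\<delta> > 0" using neg \<epsilon> by (simp add: \<delta>_def)
    fix w :: complex assume w: "norm w = r"
    have "norm (b * w) \<le> norm (f w) + norm a + norm (f w - (a + b * w))"
      using norm_triangle_ineq4[of "f w - a" "f w - (a + b * w)"] norm_triangle_ineq4[of "f w" a] by simp
    also have "norm (f w - (a + b * w)) \<le> \<epsilon>" by (rule near) (use w in auto)
    finally show "norm (f w) \<ge> \<delta>" using w by (simp add: \<delta>_def norm_mult)
  qed auto
  moreover have "norm (f w0) \<le> \<epsilon>" using near[OF w0] b by (simp add: w0_def)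
  ultimately show False using neg \<delta>_def by simp
qed

section \<open>Twists of a Dirichlet series without zeros\<close>

definition twist_sum :: "(nat \<Rightarrow> complex) \<Rightarrow> (nat \<Rightarrow> complex) \<Rightarrow> complex \<Rightarrow> complex" where
  "twist_sum b \<psi> s = (\<Sum>\<^sub>\<infinity>n\<in>{1..}. b n * cm_ext \<psi> n * of_nat n powr (- s))"

lemma norm_nat_powr: "n \<ge> 1 \<Longrightarrow> norm (of_nat n powr s :: complex) = real n powr Re s"
  using norm_powr_real_powr[of "of_nat n" s] by simp

text \<open>Only absolute convergence is recorded: the main application is to coefficients carrying
  a congruence condition and the phase e(\<lambda> n), which are not multiplicative.\<close>

locale dirichlet_coeffs =
  fixes b :: "nat \<Rightarrow> complex"
  assumes summ: "\<And>\<sigma>. \<sigma> > 1 \<Longrightarrow> (\<lambda>n. norm (b n) * real n powr (- \<sigma>)) summable_on {1..}"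
begin

lemma norm_term_le:
  assumes "n \<ge> 1" "norm z \<le> 1" "Re s \<ge> \<sigma>"
  shows "norm (b n * z * of_nat n powr (- s)) \<le> norm (b n) * real n powr (- \<sigma>)"
proof -
  have "norm (b n * z * of_nat n powr (- s)) = norm (b n) * norm z * real n powr (- Re s)"
    using assms by (simp add: norm_mult norm_nat_powr)
  also have "\<dots> \<le> norm (b n) * 1 * real n powr (- \<sigma>)"
    using assms by (intro mult_mono powr_mono) auto
  finally show ?thesis by simp
qed

lemma holomorphic_twist_sum:
  assumes "\<And>p. prime p \<Longrightarrow> norm (\<psi> p) = 1"
  shows "twist_sum b \<psi> holomorphic_on {s. Re s > 1}"
proof -
  have "twist_sum b \<psi> field_differentiable at z" if z: "Re z > 1" for z
  proof -
    define \<sigma> where "\<sigma> = (1 + Re z) / 2"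
    have \<sigma>: "\<sigma> > 1" "Re z > \<sigma>" using z by (auto simp: \<sigma>_def)
    have op: "open {s. Re s > \<sigma>}" by (simp add: open_halfspace_Re_gt)
    have "(\<lambda>s. \<Sum>\<^sub>\<infinity>n\<in>{1..}. b n * cm_ext \<psi> n * of_nat n powr (- s)) holomorphic_on {s. Re s > \<sigma>}"
    proof (rule holomorphic_on_infsum[OF op _ _ summ[OF \<sigma>(1)]])
      show "(\<lambda>s. b n * cm_ext \<psi> n * of_nat n powr (- s)) holomorphic_on {s. Re s > \<sigma>}" if "n \<in> {1..}" for n
        using that by (auto intro!: holomorphic_intros)
      show "norm (b n * cm_ext \<psi> n * of_nat n powr (- s)) \<le> norm (b n) * real n powr (- \<sigma>)"
        if "n \<in> {1..}" "s \<in> {s. Re s > \<sigma>}" for n s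
        using that norm_cm_ext_1[of \<psi> n] assms by (intro norm_term_le) auto
    qed
    thus ?thesis unfolding twist_sum_def using op \<sigma>(2)
      by (auto intro: holomorphic_on_imp_differentiable_at)
  qed
  thus ?thesis unfolding holomorphic_on_def by (auto intro: field_differentiable_at_within)
qed

text \<open>The difference is majorized by a sum that depends on \<open>s\<close> only through the
  lower bound \<open>\<sigma>\<close> for its real part; this majorant tends to 0 by dominated
  convergence, which gives uniformity on the whole half-plane.\<close>

lemma twist_sum_shift_uniform_limit:
  assumes \<phi>: "\<And>p. prime p \<Longrightarrow> norm (\<phi> p) = 1" and \<psi>: "\<And>p. prime p \<Longrightarrow> norm (\<psi> p) = 1"
    and lim: "\<And>n. n > 0 \<Longrightarrow> (\<lambda>i. of_nat n powr (- \<i> * of_real (\<tau> i))) \<longlonglongrightarrow> cm_ext \<psi> n"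
    and \<sigma>: "\<sigma> > 1"
  shows "uniform_limit {s. Re s \<ge> \<sigma>} (\<lambda>i s. twist_sum b \<phi> (s + \<i> * of_real (\<tau> i))) (twist_sum b (\<lambda>p. \<phi> p * \<psi> p)) sequentially"
proof -
  define M where "M = (\<lambda>n. norm (b n) * real n powr (- \<sigma>))"
  define h where "h = (\<lambda>i n. norm (of_nat n powr (- \<i> * of_real (\<tau> i)) - cm_ext \<psi> n))"
  have M: "M summable_on {1..}" unfolding M_def using summ[OF \<sigma>] .
  have h2: "\<bar>h i n\<bar> \<le> 2" if "n \<ge> 1" for i n
    unfolding h_def using norm_triangle_ineq4[of "of_nat n powr (- \<i> * of_real (\<tau> i))" "cm_ext \<psi> n"]
      norm_nat_powr[OF that] norm_cm_ext_1[of \<psi> n, OF \<psi>] that by simp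
  have M0: "M n \<ge> 0" for n by (simp add: M_def)
  have Mh: "norm (M n * h i n) \<le> 2 * M n" if "n \<ge> 1" for i n
    using mult_left_mono[OF h2[OF that, of i] M0[of n]] M0[of n] by (simp add: abs_mult)
  have M2: "(\<lambda>n. 2 * M n) summable_on {1..}"
    using M by (intro summable_on_cmult_right) auto
  have "(\<lambda>i. \<Sum>\<^sub>\<infinity>n\<in>{1..}. M n * h i n) \<longlonglongrightarrow> (\<Sum>\<^sub>\<infinity>n\<in>{1::nat..}. 0)"
  proof (rule tendsto_infsum[OF _ _ M2, where g = "\<lambda>_. 0 :: real"])
    show "(\<lambda>i. M n * h i n) \<longlonglongrightarrow> 0" if "n \<in> {1..}" for n
      unfolding h_def using that
      by (intro tendsto_mult_right_zero tendsto_norm_zero LIM_zero lim) auto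
  qed (use Mh M0 in auto)
  hence lim0: "(\<lambda>i. \<Sum>\<^sub>\<infinity>n\<in>{1..}. M n * h i n) \<longlonglongrightarrow> 0" by simp
  have diff: "norm (twist_sum b \<phi> (s + \<i> * of_real (\<tau> i)) - twist_sum b (\<lambda>p. \<phi> p * \<psi> p) s) \<le> (\<Sum>\<^sub>\<infinity>n\<in>{1..}. M n * h i n)"
    if s: "Re s \<ge> \<sigma>" for i s
  proof -
    define u where "u = (\<lambda>n. b n * cm_ext \<phi> n * of_nat n powr (- (s + \<i> * of_real (\<tau> i))))"
    define v where "v = (\<lambda>n. b n * cm_ext (\<lambda>p. \<phi> p * \<psi> p) n * of_nat n powr (- s))"
    have us: "u summable_on {1..}"
    proof (rule abs_summable_summable, rule Infinite_Sum.abs_summable_on_comparison_test'[OF M])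
      show "norm (u n) \<le> M n" if "n \<in> {1..}" for n
        unfolding u_def M_def by (rule norm_term_le) (use that s norm_cm_ext_1[of \<phi>, OF \<phi>] in auto)
    qed
    have \<phi>\<psi>: "norm (cm_ext (\<lambda>p. \<phi> p * \<psi> p) n) = 1" for n
      by (rule norm_cm_ext_1) (simp add: norm_mult \<phi> \<psi>)
    have vs: "v summable_on {1..}"
    proof (rule abs_summable_summable, rule Infinite_Sum.abs_summable_on_comparison_test'[OF M])
      show "norm (v n) \<le> M n" if "n \<in> {1..}" for n
        unfolding v_def M_def by (rule norm_term_le) (use that s \<phi>\<psi> in auto)
    qed
    have le: "norm (u n - v n) \<le> M n * h i n" if n: "n \<in> {1..}" for n
    proof -
      have "u n - v n = b n * cm_ext \<phi> n * of_nat n powr (- s) * (of_nat n powr (- \<i> * of_real (\<tau> i)) - cm_ext \<psi> n)"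
        unfolding u_def v_def cm_ext_distrib by (simp add: powr_diff algebra_simps powr_minus_divide powr_add)
      also have "norm \<dots> = norm (b n * cm_ext \<phi> n * of_nat n powr (- s)) * h i n"
        by (simp add: norm_mult h_def)
      also have "\<dots> \<le> M n * h i n"
        unfolding M_def by (intro mult_right_mono norm_term_le) (use n s norm_cm_ext_1[of \<phi>, OF \<phi>] in \<open>auto simp: h_def\<close>)
      finally show ?thesis .
    qed
    have Mhs: "(\<lambda>n. M n * h i n) summable_on {1..}"
      by (rule abs_summable_summable, rule Infinite_Sum.abs_summable_on_comparison_test'[OF M2]) (use Mh in auto)
    have ab: "(\<lambda>n. norm (u n - v n)) summable_on {1..}"
      by (rule Infinite_Sum.abs_summable_on_comparison_test'[OF Mhs le])
    have "twist_sum b \<phi> (s + \<i> * of_real (\<tau> i)) - twist_sum b (\<lambda>p. \<phi> p * \<psi> p) s = infsum (\<lambda>n. u n - v n) {1..}"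
      using us vs infsum_add[OF us, of "\<lambda>n. - v n"] by (simp add: infsum_uminus summable_on_uminus twist_sum_def u_def v_def)
    also have "norm \<dots> \<le> infsum (\<lambda>n. norm (u n - v n)) {1..}"
      by (rule norm_infsum_bound[OF ab])
    also have "\<dots> \<le> infsum (\<lambda>n. M n * h i n) {1..}"
      by (rule infsum_mono[OF ab Mhs le])
    finally show ?thesis .
  qed
  show ?thesis
  proof (rule uniform_limitI)
    fix e :: real assume "e > 0"
    hence "eventually (\<lambda>i. (\<Sum>\<^sub>\<infinity>n\<in>{1..}. M n * h i n) < e) sequentially"
      using lim0 by (intro order_tendstoD(2)) auto
    thus "\<forall>\<^sub>F i in sequentially. \<forall>x\<in>{s. \<sigma> \<le> Re s}. dist (twist_sum b \<phi> (x + \<i> * complex_of_real (\<tau> i))) (twist_sum b (\<lambda>p. \<phi> p * \<psi> p) x) < e"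
    proof eventually_elim
      case (elim i)
      thus ?case using diff[of _ i] by (auto simp: dist_norm intro: le_less_trans)
    qed
  qed
qed

text \<open>Hurwitz leaves two possibilities for a limit of zero-free functions: no zeros, or
  constancy. With a zero at \<open>s0\<close> constancy means vanishing throughout the strip.
  Twisting back by the conjugate of \<open>\<psi>\<close> would then make the original series vanish
  throughout the strip, against finiteness.\<close>

lemma twist_zero_free:
  assumes "\<eta> > 0" and fin: "finite {s. 1 < Re s \<and> Re s < 1 + \<eta> \<and> twist_sum b (\<lambda>_. 1) s = 0}"
    and \<psi>: "\<And>p. prime p \<Longrightarrow> norm (\<psi> p) = 1" and s0: "1 < Re s0" "Re s0 < 1 + \<eta>"
  shows "twist_sum b \<psi> s0 \<noteq> 0"
proof
  assume zero: "twist_sum b \<psi> s0 = 0"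
  define Z where "Z = {s. 1 < Re s \<and> Re s < 1 + \<eta> \<and> twist_sum b (\<lambda>_. 1) s = 0}"
  obtain B where B: "\<And>s. s \<in> Z \<Longrightarrow> Im s < B"
  proof -
    have "bdd_above (Im ` Z)" using fin by (intro bdd_above_finite) (auto simp: Z_def)
    then obtain B where "\<forall>s\<in>Z. Im s \<le> B" by (auto simp: bdd_above_def)
    thus ?thesis by (intro that[of "B + 1"]) force
  qed
  obtain \<tau> :: "nat \<Rightarrow> real" where conj: "(\<forall>i. \<tau> i \<ge> real i) \<and> (\<forall>n>0. (\<lambda>i. of_nat n powr (- \<i> * of_real (\<tau> i))) \<longlonglongrightarrow> cm_ext \<psi> n)"
    using vertical_shifts_approximate[OF \<psi>] by (rule exE)
  have \<tau>: "\<And>i. \<tau> i \<ge> real i"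
    "\<And>n. n > 0 \<Longrightarrow> (\<lambda>i. of_nat n powr (- \<i> * of_real (\<tau> i))) \<longlonglongrightarrow> cm_ext \<psi> n"
    using conj by simp_all
  have all0: "twist_sum b \<psi> s = 0" if s: "1 < Re s" "Re s < 1 + \<eta>" for s
  proof -
    define R where "R = 1 + \<bar>Im s\<bar> + \<bar>Im s0\<bar>"
    define U where "U = {s. 1 < Re s \<and> Re s < 1 + \<eta> \<and> -R < Im s \<and> Im s < R}"
    have U: "U = {s. 1 < Re s} \<inter> {s. Re s < 1 + \<eta>} \<inter> {s. -R < Im s} \<inter> {s. Im s < R}"
      by (auto simp: U_def)
    have opU: "open U" unfolding U
      by (intro open_Int open_halfspace_Re_gt open_halfspace_Re_lt open_halfspace_Im_gt open_halfspace_Im_lt)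
    have conU: "connected U" unfolding U
      by (intro convex_connected convex_Int convex_halfspace_Re_gt convex_halfspace_Re_lt
            convex_halfspace_Im_gt convex_halfspace_Im_lt)
    \<comment> \<open>From index \<open>i0\<close> on, every shifted copy of \<open>U\<close> lies
      above the height \<open>B\<close>, hence above all zeros.\<close>
    obtain i0 :: nat where i0: "real i0 \<ge> R + \<bar>B\<bar>" using real_arch_simple by blast
    define F where "F = (\<lambda>i s. twist_sum b (\<lambda>_. 1) (s + \<i> * of_real (\<tau> (i + i0))))"
    have "twist_sum b \<psi> constant_on U"
    proof (rule ccontr)
      assume nc: "\<not> twist_sum b \<psi> constant_on U"
      have "twist_sum b \<psi> s0 \<noteq> 0"
      proof (rule Hurwitz_no_zeros[OF opU conU _ _ _ nc])
        show "F i holomorphic_on U" for i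
        proof -
          have "twist_sum b (\<lambda>_. 1) \<circ> (\<lambda>s. s + \<i> * of_real (\<tau> (i + i0))) holomorphic_on U"
            by (rule holomorphic_on_compose_gen[OF _ holomorphic_twist_sum])
               (auto intro!: holomorphic_intros simp: U_def)
          thus ?thesis by (simp add: F_def o_def)
        qed
        show "twist_sum b \<psi> holomorphic_on U"
          by (rule holomorphic_on_subset[OF holomorphic_twist_sum[OF \<psi>]]) (auto simp: U_def)
        show "uniform_limit K F (twist_sum b \<psi>) sequentially" if K: "compact K" "K \<subseteq> U" for K
        proof (cases "K = {}")
          case False
          have "continuous_on K Re" by (intro continuous_intros)
          then obtain z where z: "z \<in> K" "\<And>y. y \<in> K \<Longrightarrow> Re z \<le> Re y"
            using continuous_attains_inf[OF K(1) False, of Re] by metis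
          have "Re z > 1" using z K by (auto simp: U_def)
          have "uniform_limit {s. Re s \<ge> Re z} (\<lambda>i s. twist_sum b (\<lambda>_. 1) (s + \<i> * of_real (\<tau> (i + i0))))
                  (twist_sum b (\<lambda>p. 1 * \<psi> p)) sequentially"
          proof (rule twist_sum_shift_uniform_limit[OF _ \<psi> _ \<open>Re z > 1\<close>])
            show "(\<lambda>i. of_nat n powr (- \<i> * of_real (\<tau> (i + i0)))) \<longlonglongrightarrow> cm_ext \<psi> n" if "n > 0" for n
              by (rule LIMSEQ_ignore_initial_segment[OF \<tau>(2)[OF that], of i0])
          qed auto
          hence "uniform_limit {s. Re s \<ge> Re z} F (twist_sum b \<psi>) sequentially" by (simp add: F_def)
          thus ?thesis by (rule uniform_limit_on_subset) (use z in auto)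
        qed (simp add: uniform_limit_iff)
        show "F i s \<noteq> 0" if "s \<in> U" for i s
        proof
          assume "F i s = 0"
          hence "s + \<i> * of_real (\<tau> (i + i0)) \<in> Z" using that by (auto simp: F_def Z_def U_def)
          from B[OF this] have "Im s + \<tau> (i + i0) < B" by simp
          thus False using \<tau>(1)[of "i + i0"] i0 that by (auto simp: U_def)
        qed
        show "s0 \<in> U" using s0 by (auto simp: U_def R_def)
      qed
      with zero show False by simp
    qed
    moreover have "s \<in> U" "s0 \<in> U" using s s0 by (auto simp: U_def R_def)
    ultimately show ?thesis using zero by (auto simp: constant_on_def)
  qed
  \<comment> \<open>The inverse twist: \<open>\<psi> p * cnj (\<psi> p) = 1\<close> at primes, so
    shifts of the vanishing function converge to the untwisted series.\<close>
  have cnj: "norm (cnj (\<psi> p)) = 1" if "prime p" for p using \<psi>[OF that] by simp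
  obtain \<tau>' :: "nat \<Rightarrow> real" where conj: "(\<forall>i. \<tau>' i \<ge> real i) \<and> (\<forall>n>0. (\<lambda>i. of_nat n powr (- \<i> * of_real (\<tau>' i))) \<longlonglongrightarrow> cm_ext (\<lambda>p. cnj (\<psi> p)) n)"
    using vertical_shifts_approximate[OF cnj] by (rule exE)
  have \<tau>': "\<And>i. \<tau>' i \<ge> real i"
    "\<And>n. n > 0 \<Longrightarrow> (\<lambda>i. of_nat n powr (- \<i> * of_real (\<tau>' i))) \<longlonglongrightarrow> cm_ext (\<lambda>p. cnj (\<psi> p)) n"
    using conj by simp_all
  have "s \<in> Z" if s: "1 < Re s" "Re s < 1 + \<eta>" for s
  proof -
    have "uniform_limit {z. Re z \<ge> Re s} (\<lambda>i s. twist_sum b \<psi> (s + \<i> * of_real (\<tau>' i))) (twist_sum b (\<lambda>p. \<psi> p * cnj (\<psi> p))) sequentially"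
      by (rule twist_sum_shift_uniform_limit[OF \<psi> cnj \<tau>'(2) s(1)])
    hence "(\<lambda>i. twist_sum b \<psi> (s + \<i> * of_real (\<tau>' i))) \<longlonglongrightarrow> twist_sum b (\<lambda>p. \<psi> p * cnj (\<psi> p)) s"
      by (rule tendsto_uniform_limitI) auto
    hence "(\<lambda>i. 0) \<longlonglongrightarrow> twist_sum b (\<lambda>p. \<psi> p * cnj (\<psi> p)) s"
      using all0[of "s + \<i> * of_real (\<tau>' i)" for i] s by simp
    hence "twist_sum b (\<lambda>p. \<psi> p * cnj (\<psi> p)) s = 0" using LIMSEQ_unique tendsto_const by blast
    moreover have "cm_ext (\<lambda>p. \<psi> p * cnj (\<psi> p)) n = cm_ext (\<lambda>_. 1) n" for n
      by (rule cm_ext_cong) (use \<psi> in \<open>auto simp: complex_norm_square[symmetric]\<close>)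
    ultimately show ?thesis using s by (simp add: Z_def twist_sum_def)
  qed
  hence "(\<lambda>t. Complex (1 + \<eta> / 2) t) ` UNIV \<subseteq> Z" using assms(1) by auto
  moreover have "infinite ((\<lambda>t. Complex (1 + \<eta> / 2) t) ` (UNIV :: real set))"
    by (subst finite_image_iff) (auto simp: inj_on_def infinite_UNIV_char_0)
  ultimately show False using fin finite_subset unfolding Z_def by blast
qed

end

text \<open>\<open>P\<close> may contain nonprimes, so that \<open>{..N0}\<close> can stand for the
  primes up to \<open>N0\<close>.\<close>

definition smooth_over :: "nat set \<Rightarrow> nat set" where
  "smooth_over P = {n. n \<ge> 1 \<and> (\<forall>p. prime p \<longrightarrow> p dvd n \<longrightarrow> p \<in> P)}"

section \<open>Functions of the twisting parameter on the unit disc\<close>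

context dirichlet_coeffs
begin

text \<open>For \<open>norm w = 1\<close> this is the twist by \<open>h p * w ^ e p\<close> at the
  real point \<open>\<sigma>\<close>, which is how zero-freeness of twists becomes a boundary
  condition. Inside the disc it is no longer a unimodular twist.\<close>

definition disc_fun :: "(nat \<Rightarrow> complex) \<Rightarrow> (nat \<Rightarrow> nat) \<Rightarrow> real \<Rightarrow> complex \<Rightarrow> complex" where
  "disc_fun h e \<sigma> w = (\<Sum>\<^sub>\<infinity>n\<in>{1..}. b n * (cm_ext h n * w ^ add_ext e n) * of_nat n powr (- of_real \<sigma>))"

lemma disc_term_le:
  assumes "\<And>p. prime p \<Longrightarrow> norm (h p) = 1" "norm w \<le> 1" "\<sigma>' \<le> \<sigma>" "n \<in> {1..}"
  shows "norm (b n * (cm_ext h n * w ^ add_ext e n) * of_nat n powr (- of_real \<sigma>)) \<le> norm (b n) * real n powr (- \<sigma>')"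
proof (rule norm_term_le)
  show "norm (cm_ext h n * w ^ add_ext e n) \<le> 1"
    using norm_cm_ext_1[of h n] assms by (simp add: norm_mult norm_power power_le_one)
qed (use assms in auto)

lemma disc_summable:
  assumes "\<And>p. prime p \<Longrightarrow> norm (h p) = 1" "norm w \<le> 1" "\<sigma> > 1"
  shows "(\<lambda>n. b n * (cm_ext h n * w ^ add_ext e n) * of_nat n powr (- of_real \<sigma>)) summable_on {1..}"
  by (rule abs_summable_summable, rule Infinite_Sum.abs_summable_on_comparison_test'[OF summ[OF assms(3)]])
     (rule disc_term_le[OF assms(1,2) order_refl])

lemma disc_fun_continuous:
  assumes "\<And>p. prime p \<Longrightarrow> norm (h p) = 1" "\<sigma> > 1"
  shows "continuous_on (cball 0 1) (disc_fun h e \<sigma>)"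
proof -
  have "continuous_on (cball 0 1) (\<lambda>w. \<Sum>\<^sub>\<infinity>n\<in>{1..}. b n * (cm_ext h n * w ^ add_ext e n) * of_nat n powr (- of_real \<sigma>))"
  proof (rule continuous_on_infsum[OF _ _ summ[OF assms(2)]])
    show "norm (b n * (cm_ext h n * w ^ add_ext e n) * of_nat n powr (- of_real \<sigma>)) \<le> norm (b n) * real n powr (- \<sigma>)"
      if "n \<in> {1..}" "w \<in> cball 0 1" for n w
      using that by (intro disc_term_le assms(1)) auto
  qed (auto intro!: continuous_intros)
  thus ?thesis by (simp add: disc_fun_def[abs_def])
qed

lemma disc_fun_holomorphic:
  assumes "\<And>p. prime p \<Longrightarrow> norm (h p) = 1" "\<sigma> > 1"
  shows "disc_fun h e \<sigma> holomorphic_on ball 0 1"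
proof -
  have "(\<lambda>w. \<Sum>\<^sub>\<infinity>n\<in>{1..}. b n * (cm_ext h n * w ^ add_ext e n) * of_nat n powr (- of_real \<sigma>)) holomorphic_on ball 0 1"
  proof (rule holomorphic_on_infsum[OF _ _ _ summ[OF assms(2)]])
    show "norm (b n * (cm_ext h n * w ^ add_ext e n) * of_nat n powr (- of_real \<sigma>)) \<le> norm (b n) * real n powr (- \<sigma>)"
      if "n \<in> {1..}" "w \<in> ball 0 1" for n w
      using that by (intro disc_term_le assms(1)) auto
  qed (auto intro!: holomorphic_intros)
  thus ?thesis by (simp add: disc_fun_def[abs_def])
qed

text \<open>Phases and abscissa are deformed together, from \<open>h\<close> and
  \<open>\<sigma>\<close> to 1 and \<open>\<sigma>0\<close>. On the unit circle every stage is a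
  unimodular twist inside the strip. At the end of the path only terms with \<open>n > N0\<close>
  depend on \<open>w\<close>, and by the choice of \<open>N0\<close> they move the value by at most
  half its modulus at \<open>w = 1\<close>.\<close>

lemma disc_fun_zero_free:
  assumes torus: "\<And>\<psi> s. (\<And>p. prime p \<Longrightarrow> norm (\<psi> p) = 1) \<Longrightarrow> 1 < Re s \<Longrightarrow> Re s < 1 + \<eta> \<Longrightarrow> twist_sum b \<psi> s \<noteq> 0"
    and \<sigma>0: "1 < \<sigma>0" "\<sigma>0 < 1 + \<eta>" and \<sigma>: "1 < \<sigma>" "\<sigma> < 1 + \<eta>"
    and tail: "(\<Sum>\<^sub>\<infinity>n\<in>{N0<..}. norm (b n) * real n powr (- \<sigma>0)) \<le> norm (twist_sum b (\<lambda>_. 1) (of_real \<sigma>0)) / 4"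
    and e: "\<And>p. prime p \<Longrightarrow> p \<le> N0 \<Longrightarrow> e p = 0"
    and h: "\<And>p. prime p \<Longrightarrow> norm (h p) = 1" and w: "w \<in> cball 0 1"
  shows "disc_fun h e \<sigma> w \<noteq> 0"
proof -
  \<comment> \<open>A path of unimodular phases through the argument, equal to \<open>h\<close> at
    \<open>t = 0\<close> on primes and to 1 at \<open>t = 1\<close>.\<close>
  define H where "H = (\<lambda>t::real. \<lambda>p. exp (\<i> * of_real ((1 - t) * Arg (h p))))"
  define S where "S = (\<lambda>t::real. (1 - t) * \<sigma> + t * \<sigma>0)"
  define G where "G = (\<lambda>t w. disc_fun (H t) e (S t) w)"
  define \<sigma>' where "\<sigma>' = min \<sigma> \<sigma>0"
  have \<sigma>': "\<sigma>' > 1" using \<sigma> \<sigma>0 by (simp add: \<sigma>'_def)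
  have H1: "norm (H t p) = 1" for t p by (simp add: H_def)
  have S_bd: "\<sigma>' \<le> S t" "1 < S t" "S t < 1 + \<eta>" if "t \<in> {0..1}" for t
  proof -
    have "(1 - t) * \<sigma>' + t * \<sigma>' \<le> S t" unfolding S_def \<sigma>'_def
      using that by (intro add_mono mult_left_mono) auto
    thus "\<sigma>' \<le> S t" by (simp add: algebra_simps)
    thus "1 < S t" using \<sigma>' by simp
    have "S t \<le> (1 - t) * max \<sigma> \<sigma>0 + t * max \<sigma> \<sigma>0" unfolding S_def
      using that by (intro add_mono mult_left_mono) auto
    also have "\<dots> = max \<sigma> \<sigma>0" by (simp add: algebra_simps)
    also have "\<dots> < 1 + \<eta>" using \<sigma> \<sigma>0 by simp
    finally show "S t < 1 + \<eta>" .
  qed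
  have "G 0 w \<noteq> 0"
  proof (rule zero_free_deformation[OF _ _ _ _ w])
    show "continuous_on ({0..1} \<times> cball 0 1) (\<lambda>(t, w). G t w)"
    proof -
      have "continuous_on ({0..1} \<times> cball 0 1) (\<lambda>x. \<Sum>\<^sub>\<infinity>n\<in>{1..}. b n * (cm_ext (H (fst x)) n * snd x ^ add_ext e n) * of_nat n powr (- of_real (S (fst x))))"
      proof (rule continuous_on_infsum[OF _ _ summ[OF \<sigma>']])
        fix n :: nat assume n: "n \<in> {1..}"
        have "continuous_on ({0..1} \<times> cball 0 1) (\<lambda>x :: real \<times> complex. cm_ext (H (fst x)) n)"
          unfolding continuous_on_def
        proof (intro ballI)
          fix x :: "real \<times> complex" assume x: "x \<in> {0..1} \<times> cball 0 1"
          have "((\<lambda>i. H (fst i) p) \<longlongrightarrow> H (fst x) p) (at x within {0..1} \<times> cball 0 1)" for p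
          proof -
            have "continuous_on ({0..1} \<times> cball 0 1) (\<lambda>x :: real \<times> complex. H (fst x) p)"
              unfolding H_def by (intro continuous_intros)
            thus ?thesis using x by (simp only: continuous_on_def)
          qed
          thus "((\<lambda>x. cm_ext (H (fst x)) n) \<longlongrightarrow> cm_ext (H (fst x)) n) (at x within {0..1} \<times> cball 0 1)"
            by (rule tendsto_cm_ext)
        qed
        thus "continuous_on ({0..1} \<times> cball 0 1) (\<lambda>x. b n * (cm_ext (H (fst x)) n * snd x ^ add_ext e n) * of_nat n powr (- of_real (S (fst x))))"
          unfolding S_def using n by (auto intro!: continuous_intros)
        show "norm (b n * (cm_ext (H (fst x)) n * snd x ^ add_ext e n) * of_nat n powr (- of_real (S (fst x)))) \<le> norm (b n) * real n powr (- \<sigma>')"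
          if "x \<in> {0..1} \<times> cball 0 1" for x
          using that S_bd n by (intro disc_term_le H1) auto
      qed
      thus ?thesis by (simp add: G_def disc_fun_def case_prod_beta')
    qed
    show "G t holomorphic_on ball 0 1" if "t \<in> {0..1}" for t
      unfolding G_def using disc_fun_holomorphic[of "H t" "S t" e, OF H1 S_bd(2)[OF that]] .
    show "G t w \<noteq> 0" if "t \<in> {0..1}" "norm w = 1" for t w
    proof -
      have "G t w = twist_sum b (\<lambda>p. H t p * w ^ e p) (of_real (S t))"
        by (simp add: G_def disc_fun_def twist_sum_def cm_ext_distrib cm_ext_power)
      moreover have "twist_sum b (\<lambda>p. H t p * w ^ e p) (of_real (S t)) \<noteq> 0"
        by (rule torus) (use that S_bd in \<open>auto simp: norm_mult norm_power H1\<close>)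
      ultimately show ?thesis by simp
    qed
    show "G 1 w \<noteq> 0" if w: "w \<in> cball 0 1" for w
    proof
      assume 0: "G 1 w = 0"
      define D where "D = norm (twist_sum b (\<lambda>_. 1) (of_real \<sigma>0))"
      have "D > 0" unfolding D_def using torus[of "\<lambda>_. 1" "of_real \<sigma>0"] \<sigma>0 by simp
      have H11: "H 1 = (\<lambda>_. 1)" by (simp add: H_def)
      define u where "u = (\<lambda>w n. b n * (cm_ext (\<lambda>_. 1) n * w ^ add_ext e n) * of_nat n powr (- of_real \<sigma>0))"
      define M where "M = (\<lambda>n. norm (b n) * real n powr (- \<sigma>0))"
      have su: "u v summable_on {1..}" if "norm v \<le> 1" for v
        unfolding u_def by (rule disc_summable) (use that \<sigma>0 in auto)
      have M: "M summable_on {N0<..}" unfolding M_def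
        by (rule summable_on_subset[OF summ[OF \<sigma>0(1)]]) auto
      have M2: "(\<lambda>n. 2 * M n) summable_on {N0<..}" by (rule summable_on_cmult_right[OF M])
      \<comment> \<open>All prime factors of such an \<open>n\<close> are at most \<open>N0\<close>
        and have exponent 0, so the term does not involve \<open>w\<close>.\<close>
      have u_eq: "u w n - u 1 n = 0" if n: "n \<in> {1..} - {N0<..}" for n
      proof -
        have n0: "n > 0" "n \<le> N0" using n by auto
        have "e p = 0" if "prime p" "p dvd n" for p
          using e[OF that(1)] dvd_imp_le[OF that(2) n0(1)] n0(2) by simp
        hence "add_ext e n = 0" using add_ext_eq_0_iff[OF n0(1)] by blast
        thus ?thesis by (simp add: u_def)
      qed
      have u_le: "norm (u w n - u 1 n) \<le> 2 * M n" if n: "n \<in> {N0<..}" for n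
      proof -
        have "norm (u v n) \<le> M n" if "norm v \<le> 1" for v
          unfolding u_def M_def by (rule disc_term_le) (use that n in auto)
        from this[of w] this[of 1] show ?thesis using norm_triangle_ineq4[of "u w n" "u 1 n"] w by simp
      qed
      have abs: "(\<lambda>n. norm (u w n - u 1 n)) summable_on {N0<..}"
        by (rule Infinite_Sum.abs_summable_on_comparison_test'[OF M2 u_le])
      have "G 1 w - twist_sum b (\<lambda>_. 1) (of_real \<sigma>0) = infsum (u w) {1..} - infsum (u 1) {1..}"
        by (simp add: G_def H11 S_def disc_fun_def twist_sum_def u_def)
      also have "\<dots> = infsum (\<lambda>n. u w n - u 1 n) {1..}"
        by (rule infsum_diff[symmetric]) (use su w in auto)
      also have "\<dots> = infsum (\<lambda>n. u w n - u 1 n) {N0<..}"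
        by (rule infsum_cong_neutral) (use u_eq in auto)
      also have "norm \<dots> \<le> infsum (\<lambda>n. norm (u w n - u 1 n)) {N0<..}" by (rule norm_infsum_bound[OF abs])
      also have "\<dots> \<le> infsum (\<lambda>n. 2 * M n) {N0<..}" by (rule infsum_mono[OF abs M2 u_le])
      also have "\<dots> = 2 * infsum M {N0<..}" by (rule infsum_cmult_right) (use M in auto)
      also have "\<dots> \<le> D / 2" using tail by (simp add: M_def D_def)
      finally show False using 0 \<open>D > 0\<close> by (simp add: D_def)
    qed
  qed
  moreover have "G 0 w = disc_fun h e \<sigma> w"
  proof -
    have "H 0 p = h p" if "prime p" for p
    proof -
      have "h p \<noteq> 0" using h[OF that] by auto
      hence "h p = of_real (norm (h p)) * exp (\<i> * of_real (Arg (h p)))" by (rule Arg_eq)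
      thus ?thesis using h[OF that] by (simp add: H_def)
    qed
    hence "cm_ext (H 0) n = cm_ext h n" for n by (intro cm_ext_cong)
    thus ?thesis by (simp add: G_def disc_fun_def S_def)
  qed
  ultimately show ?thesis by simp
qed

text \<open>Unwanted primes cannot be deleted by a unimodular twist, but they can be given a high
  power of \<open>w\<close>: for \<open>norm w \<le> 1 / 2\<close> each integer containing one is
  damped by at least \<open>(1 / 2) ^ k\<close>. What is left is nearly affine and zero-free, which
  limits the slope.\<close>

lemma linear_part_bound:
  assumes torus: "\<And>\<psi> s. (\<And>p. prime p \<Longrightarrow> norm (\<psi> p) = 1) \<Longrightarrow> 1 < Re s \<Longrightarrow> Re s < 1 + \<eta> \<Longrightarrow> twist_sum b \<psi> s \<noteq> 0"
    and \<sigma>0: "1 < \<sigma>0" "\<sigma>0 < 1 + \<eta>" and \<sigma>: "1 < \<sigma>" "\<sigma> < 1 + \<eta>"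
    and tail: "(\<Sum>\<^sub>\<infinity>n\<in>{N0<..}. norm (b n) * real n powr (- \<sigma>0)) \<le> norm (twist_sum b (\<lambda>_. 1) (of_real \<sigma>0)) / 4"
    and h: "\<And>p. prime p \<Longrightarrow> norm (h p) = 1" and Q: "\<And>p. p \<in> Q \<Longrightarrow> N0 < p"
    and near: "\<And>w. norm w \<le> 1 / 2 \<Longrightarrow>
      norm ((\<Sum>\<^sub>\<infinity>n\<in>smooth_over ({..N0} \<union> Q). b n * (cm_ext h n * w ^ add_ext (\<lambda>p. if p \<in> Q then 1 else 0) n) * of_nat n powr (- of_real \<sigma>))
           - (a0 + a1 * w)) \<le> 1"
  shows "norm a1 / 2 \<le> norm a0 + 4"
proof -
  define M where "M = (\<lambda>n. norm (b n) * real n powr (- \<sigma>))"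
  have M: "M summable_on {1..}" unfolding M_def by (rule summ[OF \<sigma>(1)])
  define N where "N = smooth_over ({..N0} \<union> Q)"
  define E where "E = (\<lambda>p. if p \<in> Q then 1 else 0 :: nat)"
  have N1: "N \<subseteq> {1..}" by (auto simp: N_def smooth_over_def)
  obtain k :: nat where k: "(1 / 2) ^ k * infsum M {1..} \<le> 1"
  proof -
    have "(\<lambda>k. (1 / 2 :: real) ^ k * infsum M {1..}) \<longlonglongrightarrow> 0 * infsum M {1..}"
      by (intro tendsto_mult LIMSEQ_realpow_zero tendsto_const) auto
    hence "eventually (\<lambda>k. (1 / 2 :: real) ^ k * infsum M {1..} < 1) sequentially"
      by (intro order_tendstoD) auto
    then obtain k where "(1 / 2 :: real) ^ k * infsum M {1..} < 1" by (auto simp: eventually_at_top_linorder)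
    thus ?thesis by (intro that) (auto intro: less_imp_le)
  qed
  \<comment> \<open>Exponent 0 on small primes is what \<open>disc_fun_zero_free\<close> asks for, 1
    on \<open>Q\<close> produces the linear term, and a single finite \<open>k\<close> makes the
    contribution of all remaining primes at most 1.\<close>
  define e where "e = (\<lambda>p. if p \<le> N0 then 0 else if p \<in> Q then 1 else k)"
  define u where "u = (\<lambda>w n. b n * (cm_ext h n * w ^ add_ext e n) * of_nat n powr (- of_real \<sigma>))"
  define v where "v = (\<lambda>w n. b n * (cm_ext h n * w ^ add_ext E n) * of_nat n powr (- of_real \<sigma>))"
  have diff: "norm (disc_fun h e \<sigma> w - infsum (v w) N) \<le> 1" if w: "norm w \<le> 1 / 2" for w
  proof -
    have su: "u w summable_on {1..}" unfolding u_def by (rule disc_summable) (use h \<sigma> w in auto)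
    have NN: "({1..} - N) \<union> N = {1..}" using N1 by auto
    have "infsum (u w) (({1..} - N) \<union> N) = infsum (u w) ({1..} - N) + infsum (u w) N"
      by (rule infsum_Un_disjoint) (use su N1 in \<open>auto intro: summable_on_subset\<close>)
    hence "infsum (u w) {1..} = infsum (u w) ({1..} - N) + infsum (u w) N" unfolding NN .
    moreover have "infsum (u w) N = infsum (v w) N"
    proof (rule infsum_cong)
      fix n assume n: "n \<in> N"
      have "add_ext e n = add_ext E n"
      proof (rule add_ext_cong)
        fix p assume "prime p" "p dvd n"
        hence "p \<le> N0 \<or> p \<in> Q" using n by (auto simp: N_def smooth_over_def)
        thus "e p = E p" using Q[of p] by (auto simp: e_def E_def)
      qed
      thus "u w n = v w n" by (simp add: u_def v_def)
    qed
    ultimately have "disc_fun h e \<sigma> w - infsum (v w) N = infsum (u w) ({1..} - N)"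
      by (simp add: disc_fun_def u_def)
    also have "norm \<dots> \<le> infsum (\<lambda>n. (1 / 2) ^ k * M n) {1..}"
    proof -
      have le: "norm (u w n) \<le> (1 / 2) ^ k * M n" if n: "n \<in> {1..} - N" for n
      proof -
        obtain p where p: "prime p" "p dvd n" "\<not> p \<le> N0" "p \<notin> Q"
          using n by (auto simp: N_def smooth_over_def)
        hence "k \<le> add_ext e n" using add_ext_ge[of n p e] n by (auto simp: e_def)
        have "norm (w ^ add_ext e n) \<le> (1 / 2) ^ add_ext e n" using w by (simp add: norm_power power_mono)
        also have "\<dots> \<le> (1 / 2) ^ k" using \<open>k \<le> add_ext e n\<close> by (intro power_decreasing) auto
        finally have wk: "norm (w ^ add_ext e n) \<le> (1 / 2) ^ k" .
        have "norm (u w n) = norm (w ^ add_ext e n) * M n"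
          using n norm_cm_ext_1[of h n, OF h] by (simp add: u_def M_def norm_mult norm_nat_powr)
        also have "\<dots> \<le> (1 / 2) ^ k * M n" by (intro mult_right_mono wk) (simp add: M_def)
        finally show ?thesis .
      qed
      have sM: "(\<lambda>n. (1 / 2) ^ k * M n) summable_on ({1..} - N)"
        by (rule summable_on_subset[OF summable_on_cmult_right[OF M]]) auto
      have abs: "(\<lambda>n. norm (u w n)) summable_on ({1..} - N)"
        by (rule Infinite_Sum.abs_summable_on_comparison_test'[OF sM le])
      have "norm (infsum (u w) ({1..} - N)) \<le> infsum (\<lambda>n. norm (u w n)) ({1..} - N)"
        by (rule norm_infsum_bound[OF abs])
      also have "\<dots> \<le> infsum (\<lambda>n. (1 / 2) ^ k * M n) ({1..} - N)" by (rule infsum_mono[OF abs sM le])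
      also have "\<dots> \<le> infsum (\<lambda>n. (1 / 2) ^ k * M n) {1..}"
        by (rule infsum_mono2) (use sM summable_on_cmult_right[OF M] in \<open>auto simp: M_def\<close>)
      finally show ?thesis .
    qed
    also have "\<dots> = (1 / 2) ^ k * infsum M {1..}" by (rule infsum_cmult_right) (use M in auto)
    finally show ?thesis using k by linarith
  qed
  \<comment> \<open>Radius \<open>1 / 2\<close>; the error 2 is 1 from the damped primes plus 1 from
    the hypothesis \<open>near\<close>.\<close>
  have "norm a1 * (1 / 2) \<le> norm a0 + 2 * 2"
  proof (rule zero_free_near_affine)
    show "continuous_on (cball 0 (1 / 2)) (disc_fun h e \<sigma>)"
      by (rule continuous_on_subset[OF disc_fun_continuous]) (use h \<sigma> in auto)
    show "disc_fun h e \<sigma> holomorphic_on ball 0 (1 / 2)"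
      by (rule holomorphic_on_subset[OF disc_fun_holomorphic]) (use h \<sigma> in auto)
    show "disc_fun h e \<sigma> w \<noteq> 0" if "w \<in> cball 0 (1 / 2)" for w
      by (rule disc_fun_zero_free[OF torus \<sigma>0 \<sigma> tail _ h]) (use that in \<open>auto simp: e_def\<close>)
    show "norm (disc_fun h e \<sigma> w - (a0 + a1 * w)) \<le> 2" if "w \<in> cball 0 (1 / 2)" for w
    proof -
      have w: "norm w \<le> 1 / 2" using that by simp
      have le1: "norm (infsum (v w) N - (a0 + a1 * w)) \<le> 1" using near[OF w] by (simp add: v_def N_def E_def)
      have "norm ((disc_fun h e \<sigma> w - infsum (v w) N) + (infsum (v w) N - (a0 + a1 * w))) \<le> 1 + 1"
        by (rule norm_triangle_mono[OF diff[OF w] le1])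
      thus ?thesis by (simp only: diff_add_cancel add_diff_eq one_add_one)
    qed
  qed auto
  thus ?thesis by simp
qed

end

section \<open>Dirichlet characters and primes in residue classes\<close>

text \<open>A character on a subgroup of the units modulo \<open>k\<close>, written as a set of
  natural numbers closed under congruence. Such characters are extended one generator at a time
  until they live on all units.\<close>

definition partial_char :: "nat \<Rightarrow> nat set \<Rightarrow> (nat \<Rightarrow> complex) \<Rightarrow> bool" where
  "partial_char k H \<xi> \<longleftrightarrow> (\<forall>a\<in>H. coprime a k) \<and> 1 \<in> H \<and> (\<forall>a\<in>H. \<forall>b\<in>H. a * b \<in> H \<and> \<xi> (a * b) = \<xi> a * \<xi> b)
     \<and> (\<forall>a\<in>H. \<forall>b. [a = b] (mod k) \<longrightarrow> b \<in> H \<and> \<xi> a = \<xi> b) \<and> \<xi> 1 = 1"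

lemma partial_charD:
  assumes "partial_char k H \<xi>"
  shows "a \<in> H \<Longrightarrow> coprime a k" "1 \<in> H" "a \<in> H \<Longrightarrow> b \<in> H \<Longrightarrow> a * b \<in> H"
    "a \<in> H \<Longrightarrow> b \<in> H \<Longrightarrow> \<xi> (a * b) = \<xi> a * \<xi> b" "a \<in> H \<Longrightarrow> [a = b] (mod k) \<Longrightarrow> b \<in> H"
    "a \<in> H \<Longrightarrow> [a = b] (mod k) \<Longrightarrow> \<xi> a = \<xi> b" "\<xi> 1 = 1"
  using assms unfolding partial_char_def by blast+

lemma partial_char_power:
  assumes "partial_char k H \<xi>" "a \<in> H"
  shows "a ^ n \<in> H" "\<xi> (a ^ n) = \<xi> a ^ n"
proof -
  have "a ^ n \<in> H \<and> \<xi> (a ^ n) = \<xi> a ^ n"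
    by (induction n) (use partial_charD[OF assms(1)] assms(2) in auto)
  thus "a ^ n \<in> H" "\<xi> (a ^ n) = \<xi> a ^ n" by auto
qed

lemma partial_char_extend:
  assumes pc: "partial_char k H \<xi>" and y: "coprime y k" and k: "k > 0"
    and n: "n > 0" "y ^ n \<in> H" "\<And>i. 0 < i \<Longrightarrow> i < n \<Longrightarrow> y ^ i \<notin> H" and c: "c ^ n = \<xi> (y ^ n)"
  obtains H' \<xi>' where "partial_char k H' \<xi>'" "H \<subseteq> H'" "y \<in> H'" "\<And>a. a \<in> H \<Longrightarrow> \<xi>' a = \<xi> a" "\<xi>' y = c"
proof -
  note D = partial_charD[OF pc]
  define t where "t = totient k"
  have t: "t > 0" using k by (simp add: t_def)
  have inv: "[h ^ (t - 1) * h = 1] (mod k)" if "coprime h k" for h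
    using euler_theorem[OF that] t by (cases t) (auto simp: t_def mult.commute)
  have cancelH: "x \<in> H" if x: "h \<in> H" "x * h \<in> H" for x h
  proof (rule D(5))
    show "(x * h) * h ^ (t - 1) \<in> H" by (intro D(3) x partial_char_power(1)[OF pc])
    have "[x * (h ^ (t - 1) * h) = x * 1] (mod k)" by (intro cong_mult inv D(1) x cong_refl)
    thus "[(x * h) * h ^ (t - 1) = x] (mod k)" by (simp add: mult_ac)
  qed
  have ydvd: "n dvd e" if "y ^ e \<in> H" for e
  proof -
    have e: "y ^ e = y ^ (e mod n) * (y ^ n) ^ (e div n)"
      by (simp add: power_mult[symmetric] power_add[symmetric])
    have "y ^ (e mod n) \<in> H"
      by (rule cancelH[of "(y ^ n) ^ (e div n)"]) (use that e n partial_char_power(1)[OF pc] in auto)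
    hence "e mod n = 0" using n(3)[of "e mod n"] n(1) by (metis gr0I mod_less_divisor)
    thus ?thesis by auto
  qed
  have \<xi>y: "\<xi> (y ^ e) = c ^ e" if "y ^ e \<in> H" for e
  proof -
    from ydvd[OF that] obtain u where u: "e = n * u" by (auto elim: dvdE)
    have "\<xi> (y ^ e) = \<xi> ((y ^ n) ^ u)" by (simp add: u power_mult)
    also have "\<dots> = c ^ e" using partial_char_power(2)[OF pc n(2)] by (simp add: c[symmetric] u power_mult)
    finally show ?thesis .
  qed
  \<comment> \<open>Two representations of one residue: cancelling \<open>y ^ i\<close> shows that
    \<open>y ^ (j - i)\<close> lies in \<open>H\<close>, where the value is already forced to be a
    power of \<open>c\<close>.\<close>
  have key_le: "\<xi> h * c ^ i = \<xi> h' * c ^ j"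
    if h: "h \<in> H" "h' \<in> H" "[h * y ^ i = h' * y ^ j] (mod k)" "i \<le> j" for h h' i j
  proof -
    define e where "e = j - i"
    have j: "j = i + e" using h by (simp add: e_def)
    have "[h * y ^ i = (h' * y ^ e) * y ^ i] (mod k)" using h(3) by (simp add: j power_add mult_ac)
    hence hh: "[h = h' * y ^ e] (mod k)"
      using y by (subst (asm) cong_mult_rcancel_nat) auto
    hence "h' * y ^ e \<in> H" using D(5)[OF h(1)] by blast
    hence ye: "y ^ e \<in> H" using cancelH[OF h(2), of "y ^ e"] by (simp add: mult.commute)
    have "\<xi> h = \<xi> h' * \<xi> (y ^ e)" using D(6)[OF h(1) hh] D(4)[OF h(2) ye] by simp
    thus ?thesis using \<xi>y[OF ye] by (simp add: j power_add)
  qed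
  have key: "\<xi> h * c ^ i = \<xi> h' * c ^ j"
    if h: "h \<in> H" "h' \<in> H" "[h * y ^ i = h' * y ^ j] (mod k)" for h h' i j
    using key_le[OF h] key_le[OF h(2,1) cong_sym[OF h(3)]] by (cases "i \<le> j") auto
  define H' where "H' = {a. \<exists>h i. h \<in> H \<and> [a = h * y ^ i] (mod k)}"
  \<comment> \<open>The choice is harmless, since by \<open>key\<close> all representations give the
    same value.\<close>
  define \<xi>' where "\<xi>' = (\<lambda>a. SOME z. \<exists>h i. h \<in> H \<and> [a = h * y ^ i] (mod k) \<and> z = \<xi> h * c ^ i)"
  have \<xi>': "\<xi>' a = \<xi> h * c ^ i" if "h \<in> H" "[a = h * y ^ i] (mod k)" for a h i
  proof -
    have "\<exists>z h i. h \<in> H \<and> [a = h * y ^ i] (mod k) \<and> z = \<xi> h * c ^ i" using that by blast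
    hence "\<exists>h i. h \<in> H \<and> [a = h * y ^ i] (mod k) \<and> \<xi>' a = \<xi> h * c ^ i"
      unfolding \<xi>'_def by (rule someI_ex)
    then obtain h' j where "h' \<in> H" "[a = h' * y ^ j] (mod k)" "\<xi>' a = \<xi> h' * c ^ j" by blast
    thus ?thesis using key[of h' h j i] that by (metis cong_sym cong_trans)
  qed
  have H_sub: "a \<in> H'" "\<xi>' a = \<xi> a" if "a \<in> H" for a
  proof -
    have *: "[a = a * y ^ 0] (mod k)" by simp
    thus "a \<in> H'" using that unfolding H'_def by blast
    show "\<xi>' a = \<xi> a" using \<xi>'[OF that *] by simp
  qed
  have y': "y \<in> H'" "\<xi>' y = c"
  proof -
    have *: "[y = 1 * y ^ 1] (mod k)" by simp
    thus "y \<in> H'" using D(2) unfolding H'_def by blast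
    show "\<xi>' y = c" using \<xi>'[OF D(2) *] D(7) by simp
  qed
  have "partial_char k H' \<xi>'"
    unfolding partial_char_def
  proof (intro conjI ballI allI impI)
    fix a assume "a \<in> H'"
    then obtain h i where h: "h \<in> H" "[a = h * y ^ i] (mod k)" by (auto simp: H'_def)
    have "coprime (h * y ^ i) k" using D(1)[OF h(1)] y by simp
    thus "coprime a k" using h(2) by (metis cong_imp_coprime cong_sym)
    fix b assume "[a = b] (mod k)"
    hence *: "[b = h * y ^ i] (mod k)" using h(2) by (metis cong_sym cong_trans)
    thus "b \<in> H'" using h by (auto simp: H'_def)
    show "\<xi>' a = \<xi>' b" using \<xi>'[OF h] \<xi>'[OF h(1) *] by simp
  next
    fix a b assume "a \<in> H'" "b \<in> H'"
    then obtain h i h' j where h: "h \<in> H" "[a = h * y ^ i] (mod k)" "h' \<in> H" "[b = h' * y ^ j] (mod k)"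
      by (auto simp: H'_def)
    have ab: "[a * b = (h * h') * y ^ (i + j)] (mod k)"
      using cong_mult[OF h(2,4)] by (simp add: power_add mult_ac)
    thus "a * b \<in> H'" using D(3)[OF h(1,3)] by (auto simp: H'_def)
    show "\<xi>' (a * b) = \<xi>' a * \<xi>' b"
      using \<xi>'[OF D(3)[OF h(1,3)] ab] \<xi>'[OF h(1,2)] \<xi>'[OF h(3,4)] D(4)[OF h(1,3)]
      by (simp add: power_add mult_ac)
  qed (use H_sub D in auto)
  thus ?thesis using that H_sub y' by blast
qed

lemma dirichlet_character_of_partial_char:
  assumes pc: "partial_char k H \<xi>" and H: "\<And>a. coprime a k \<Longrightarrow> a \<in> H" and k: "k > 0"
  shows "dirichlet_character k (\<lambda>n. if coprime n k then \<xi> n else 0)"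
proof -
  note D = partial_charD[OF pc]
  have nz: "\<xi> a \<noteq> 0" if "coprime a k" for a
  proof
    assume "\<xi> a = 0"
    moreover have "\<xi> (a ^ totient k) = 1"
      using D(6)[of "a ^ totient k" 1] H that euler_theorem[OF that] D(7) by auto
    moreover have "(0 :: complex) ^ totient k = 0" using k by (simp add: zero_power)
    ultimately show False using partial_char_power(2)[OF pc H[OF that], of "totient k"] by auto
  qed
  have "\<xi> (n + k) = \<xi> n" if "coprime n k" for n
    using D(6)[of n "n + k"] H[OF that] by (simp add: cong_def)
  moreover have "coprime (n + k) k \<longleftrightarrow> coprime n k" for n
    unfolding coprime_iff_gcd_eq_1 by (simp only: gcd_add1)
  ultimately show ?thesis unfolding dirichlet_character_def using k nz D(4) H by auto
qed

text \<open>Start on the subgroup generated by \<open>g\<close>, sending \<open>g\<close> to a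
  primitive root of unity of order equal to the order of \<open>g\<close>, and extend to a maximal
  subgroup; the extension lemma shows that it contains all units.\<close>

lemma exists_dirichlet_character_neq_1:
  assumes k: "k > 0" and g: "coprime g k" "\<not> [g = 1] (mod k)"
  shows "\<exists>\<psi>. dirichlet_character k \<psi> \<and> \<psi> g \<noteq> 1"
proof -
  have pow1: "\<exists>n>0. y ^ n \<in> H" if "partial_char k H \<xi>" "coprime y k" for y H \<xi>
    using partial_charD(5)[OF that(1) partial_charD(2)[OF that(1)], of "y ^ totient k"] euler_theorem[OF that(2)] k
    by (intro exI[of _ "totient k"]) (auto simp: cong_sym)
  \<comment> \<open>Subgroups are infinite sets of naturals, so their size is measured by residues
    below \<open>k\<close>; this is bounded by \<open>k\<close> and a maximum exists.\<close>
  define P where "P = (\<lambda>N. \<exists>H \<xi>. partial_char k H \<xi> \<and> g \<in> H \<and> \<xi> g \<noteq> 1 \<and> card (H \<inter> {..<k}) = N)"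
  have "\<exists>N. P N"
  proof -
    define H where "H = {a. [a = 1] (mod k)}"
    have pc: "partial_char k H (\<lambda>_. 1)"
    proof -
      have "coprime a k" if "[a = 1] (mod k)" for a
        using that by (metis cong_imp_coprime cong_sym coprime_1_left)
      moreover have "[a * b = 1] (mod k)" if "[a = 1] (mod k)" "[b = 1] (mod k)" for a b
        using cong_mult[OF that] by simp
      moreover have "[b = 1] (mod k)" if "[a = 1] (mod k)" "[a = b] (mod k)" for a b
        using that by (metis cong_sym cong_trans)
      ultimately show ?thesis unfolding partial_char_def H_def by auto
    qed
    \<comment> \<open>The order of \<open>g\<close> modulo \<open>k\<close>; it exceeds 1 because
      \<open>g\<close> is not congruent to 1, so a root of unity different from 1 is
      available.\<close>
    define n where "n = (LEAST n. n > 0 \<and> g ^ n \<in> H)"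
    have n: "n > 0" "g ^ n \<in> H" using pow1[OF pc g(1)] unfolding n_def by (metis (mono_tags, lifting) LeastI)+
    have nmin: "g ^ i \<notin> H" if "0 < i" "i < n" for i using that not_less_Least unfolding n_def by blast
    have "n \<noteq> 1" using n g by (auto simp: H_def)
    hence "n > 1" using n by auto
    define c where "c = exp (2 * of_real pi * \<i> / of_nat n)"
    have "c ^ n = 1" unfolding c_def exp_of_nat_mult[symmetric] using n by simp
    moreover have "c \<noteq> 1"
      using complex_root_unity_eq_1[of n 1] \<open>n > 1\<close> by (simp add: c_def mult_ac)
    ultimately obtain H' \<xi>' where "partial_char k H' \<xi>'" "g \<in> H'" "\<xi>' g = c"
      using partial_char_extend[OF pc g(1) k n nmin, of c] by metis
    thus ?thesis using \<open>c \<noteq> 1\<close> unfolding P_def by blast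
  qed
  moreover have bd: "N \<le> k" if "P N" for N
    using that card_mono[of "{..<k}" "_ \<inter> {..<k}"] unfolding P_def by fastforce
  ultimately obtain N where N: "P N" "\<And>N'. P N' \<Longrightarrow> N' \<le> N"
    using Greatest_le_nat[of P _ k] GreatestI_nat[of P _ k] by metis
  then obtain H \<xi> where H: "partial_char k H \<xi>" "g \<in> H" "\<xi> g \<noteq> 1" "card (H \<inter> {..<k}) = N"
    unfolding P_def by blast
  have all: "y \<in> H" if y: "coprime y k" for y
  proof (rule ccontr)
    assume yH: "y \<notin> H"
    define n where "n = (LEAST n. n > 0 \<and> y ^ n \<in> H)"
    have n: "n > 0" "y ^ n \<in> H" using pow1[OF H(1) y] unfolding n_def by (metis (mono_tags, lifting) LeastI)+
    have nmin: "y ^ i \<notin> H" if "0 < i" "i < n" for i using that not_less_Least unfolding n_def by blast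
    \<comment> \<open>An \<open>n\<close>-th root in the complex numbers. Nonvanishing of
      \<open>\<xi>\<close> is not part of \<open>partial_char\<close>, hence the case of the value
      0.\<close>
    obtain c where c: "c ^ n = \<xi> (y ^ n)"
    proof -
      have "\<exists>c. c ^ n = \<xi> (y ^ n)"
      proof (cases "\<xi> (y ^ n) = 0")
        case True thus ?thesis using n by (intro exI[of _ 0]) auto
      next
        case False
        have "exp (Ln (\<xi> (y ^ n)) / of_nat n) ^ n = \<xi> (y ^ n)"
          unfolding exp_of_nat_mult[symmetric] using n False by simp
        thus ?thesis by blast
      qed
      thus ?thesis using that by blast
    qed
    obtain H' \<xi>' where H': "partial_char k H' \<xi>'" "H \<subseteq> H'" "y \<in> H'" "\<And>a. a \<in> H \<Longrightarrow> \<xi>' a = \<xi> a"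
      using partial_char_extend[OF H(1) y k n nmin c] by metis
    have "P (card (H' \<inter> {..<k}))" unfolding P_def using H' H(2,3) by (intro exI[of _ H'] exI[of _ \<xi>']) auto
    hence "card (H' \<inter> {..<k}) \<le> N" by (rule N(2))
    moreover have "H \<inter> {..<k} \<subset> H' \<inter> {..<k}"
    proof -
      have cg: "[y mod k = y] (mod k)" "[y = y mod k] (mod k)" by (simp_all add: cong_def)
      have "y mod k \<in> H'" using partial_charD(5)[OF H'(1,3) cg(2)] .
      moreover have "y mod k \<notin> H" using partial_charD(5)[OF H(1) _ cg(1)] yH by blast
      moreover have "y mod k < k" using k by simp
      ultimately show ?thesis using H'(2) by blast
    qed
    hence "card (H \<inter> {..<k}) < card (H' \<inter> {..<k})" by (intro psubset_card_mono) auto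
    ultimately show False using H(4) by simp
  qed
  show ?thesis
    using dirichlet_character_of_partial_char[OF H(1) all k] H(3) g(1)
    by (intro exI[of _ "\<lambda>n. if coprime n k then \<xi> n else 0"]) auto
qed

section \<open>Characters, their linear span and residue classes\<close>

lemma dirichlet_character_cong:
  assumes "dirichlet_character k \<psi>" "[a = b] (mod k)"
  shows "\<psi> a = \<psi> b"
proof -
  have shift: "\<psi> (n + t * k) = \<psi> n" for n t
  proof (induction t)
    case (Suc t)
    have "\<psi> (n + Suc t * k) = \<psi> ((n + t * k) + k)" by (simp add: algebra_simps)
    also have "\<dots> = \<psi> (n + t * k)" using assms(1) unfolding dirichlet_character_def by blast
    finally show ?case using Suc by simp
  qed auto
  have "\<psi> n = \<psi> (n mod k)" for n using shift[of "n mod k" "n div k"] by simp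
  thus ?thesis using assms(2) unfolding cong_def by metis
qed

lemma dirichlet_character_mult: "dirichlet_character k \<psi> \<Longrightarrow> \<psi> (a * b) = \<psi> a * \<psi> b"
  and dirichlet_character_nonzero_iff: "dirichlet_character k \<psi> \<Longrightarrow> \<psi> a \<noteq> 0 \<longleftrightarrow> coprime a k"
  unfolding dirichlet_character_def by blast+

lemma dirichlet_character_principal:
  assumes "k > 0" shows "dirichlet_character k (principal_character k)"
proof -
  have "coprime (n + k) k \<longleftrightarrow> coprime n k" for n :: nat
    unfolding coprime_iff_gcd_eq_1 by (simp only: gcd_add1)
  thus ?thesis using assms unfolding dirichlet_character_def principal_character_def by auto
qed

lemma dirichlet_character_1:
  assumes "dirichlet_character k \<psi>" shows "\<psi> 1 = 1"
  using dirichlet_character_mult[OF assms, of 1 1] dirichlet_character_nonzero_iff[OF assms, of 1] by simp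

lemma dirichlet_character_times:
  assumes "dirichlet_character k \<psi>" "dirichlet_character k \<phi>"
  shows "dirichlet_character k (\<lambda>n. \<psi> n * \<phi> n)"
  using assms unfolding dirichlet_character_def by (auto simp: mult_ac)

text \<open>Multiplication by a unit \<open>b\<close> with \<open>\<psi> b \<noteq> 1\<close>
  permutes the reduced residues and multiplies the sum by \<open>\<psi> b\<close>.\<close>

lemma sum_nonprincipal_character:
  assumes \<psi>: "dirichlet_character k \<psi>" "\<psi> \<noteq> principal_character k" and k: "k > 0"
  shows "(\<Sum>a | a < k \<and> coprime a k. \<psi> a) = 0"
proof -
  define R where "R = {a. a < k \<and> coprime a k}"
  obtain b where b: "coprime b k" "\<psi> b \<noteq> 1"
    using \<psi> dirichlet_character_nonzero_iff[OF \<psi>(1)] unfolding principal_character_def fun_eq_iff by metis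
  define h where "h = (\<lambda>a. a * b mod k)"
  have inj: "inj_on h R"
  proof (rule inj_onI)
    fix x y assume xy: "x \<in> R" "y \<in> R" "h x = h y"
    hence "[x * b = y * b] (mod k)" by (simp add: h_def cong_def)
    hence "[x = y] (mod k)" using b(1) by (simp add: cong_mult_rcancel_nat)
    thus "x = y" using xy by (auto simp: R_def cong_def)
  qed
  have "h ` R \<subseteq> R" using b(1) k by (auto simp: h_def R_def coprime_commute)
  hence img: "h ` R = R" using inj by (intro endo_inj_surj) (auto simp: R_def)
  have "(\<Sum>a\<in>R. \<psi> a) = (\<Sum>a\<in>h ` R. \<psi> a)" by (simp add: img)
  also have "\<dots> = (\<Sum>a\<in>R. \<psi> (h a))" by (subst sum.reindex[OF inj]) (simp add: o_def)
  also have "\<dots> = (\<Sum>a\<in>R. \<psi> (a * b))"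
    by (intro sum.cong refl dirichlet_character_cong[OF \<psi>(1)]) (simp add: h_def cong_def)
  also have "\<dots> = (\<Sum>a\<in>R. \<psi> a) * \<psi> b"
    by (simp add: dirichlet_character_mult[OF \<psi>(1)] sum_distrib_right)
  finally show ?thesis using b(2) by (simp add: R_def)
qed

text \<open>Closing the characters under linear operations makes it possible to prove a linear
  estimate for each character and to transfer it by induction, with neither a count of the
  characters nor explicit coefficients.\<close>

inductive char_span :: "nat \<Rightarrow> (nat \<Rightarrow> complex) \<Rightarrow> bool" for k where
  char: "dirichlet_character k \<psi> \<Longrightarrow> char_span k \<psi>"
| add: "char_span k g \<Longrightarrow> char_span k h \<Longrightarrow> char_span k (\<lambda>n. g n + h n)"
| scale: "char_span k g \<Longrightarrow> char_span k (\<lambda>n. c * g n)"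

lemma char_span_times:
  assumes "char_span k g" "char_span k h"
  shows "char_span k (\<lambda>n. g n * h n)"
  using assms(1)
proof induction
  case (char \<psi>)
  show ?case using assms(2)
  proof induction
    case (char \<phi>) thus ?case using \<open>dirichlet_character k \<psi>\<close> dirichlet_character_times char_span.char by blast
  next
    case (add g h) thus ?case using char_span.add[OF add.IH] by (simp add: algebra_simps)
  next
    case (scale g c) thus ?case using char_span.scale[OF scale.IH, of c] by (simp add: algebra_simps)
  qed
next
  case (add g h') thus ?case using char_span.add[OF add.IH] by (simp add: algebra_simps)
next
  case (scale g c) thus ?case using char_span.scale[OF scale.IH, of c] by (simp add: algebra_simps)
qed

text \<open>Interpolation instead of orthogonality: for each other reduced residue \<open>a\<close>
  some character separates \<open>a\<close> from \<open>m\<close>, and the product of the factors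
  \<open>\<Psi> a n - \<Psi> a a\<close> kills all of them. The span is closed under products
  because characters are.\<close>

lemma char_span_class:
  assumes k: "k > 0" and m: "coprime m k"
  shows "char_span k (\<lambda>n. if [n = m] (mod k) then 1 else 0)"
proof -
  define R where "R = {a. a < k \<and> coprime a k \<and> \<not> [a = m] (mod k)}"
  have "\<exists>\<psi>. dirichlet_character k \<psi> \<and> \<psi> a \<noteq> \<psi> m" if "a \<in> R" for a
  proof -
    \<comment> \<open>An inverse of \<open>m\<close> modulo \<open>k\<close> by Euler's theorem; a
      character nontrivial at \<open>a * m'\<close> separates \<open>a\<close> from
      \<open>m\<close>.\<close>
    define m' where "m' = m ^ (totient k - 1)"
    have mm: "[m' * m = 1] (mod k)"
      using euler_theorem[OF m] k by (cases "totient k") (auto simp: m'_def mult.commute)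
    have cop: "coprime m' k" using m by (simp add: m'_def)
    have "\<not> [a * m' = 1] (mod k)"
    proof
      assume "[a * m' = 1] (mod k)"
      hence "[a * m' = m * m'] (mod k)" using mm by (metis cong_sym cong_trans mult.commute)
      thus False using that cop by (simp add: cong_mult_rcancel_nat R_def)
    qed
    moreover have "coprime (a * m') k" using that cop by (simp add: R_def)
    ultimately obtain \<psi> where \<psi>: "dirichlet_character k \<psi>" "\<psi> (a * m') \<noteq> 1"
      using exists_dirichlet_character_neq_1[OF k] by blast
    have "\<psi> m' * \<psi> m = 1"
      using dirichlet_character_cong[OF \<psi>(1) mm] dirichlet_character_mult[OF \<psi>(1)] dirichlet_character_1[OF \<psi>(1)] by simp
    hence "\<psi> a \<noteq> \<psi> m" using \<psi> dirichlet_character_mult[OF \<psi>(1)] by (metis mult.commute)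
    thus ?thesis using \<psi>(1) by blast
  qed
  then obtain \<Psi> where \<Psi>: "\<And>a. a \<in> R \<Longrightarrow> dirichlet_character k (\<Psi> a)" "\<And>a. a \<in> R \<Longrightarrow> \<Psi> a a \<noteq> \<Psi> a m"
    by metis
  \<comment> \<open>The principal character removes the residues not coprime to \<open>k\<close>;
    for \<open>S = R\<close> the product then vanishes off the class of \<open>m\<close>.\<close>
  define P where "P = (\<lambda>S n. principal_character k n * (\<Prod>a\<in>S. \<Psi> a n - \<Psi> a a))"
  have finR: "finite R" by (simp add: R_def)
  have span: "char_span k (P S)" if "finite S" "S \<subseteq> R" for S
    using that
  proof (induction S rule: finite_induct)
    case empty
    thus ?case using char_span.char[OF dirichlet_character_principal[OF k]] by (simp add: P_def)
  next
    case (insert a S)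
    hence IH: "char_span k (P S)" by auto
    have "char_span k (\<lambda>n. P S n * \<Psi> a n + (- \<Psi> a a) * P S n)"
      by (intro char_span.add char_span_times char_span.scale IH char_span.char \<Psi>(1)) (use insert in auto)
    also have "(\<lambda>n. P S n * \<Psi> a n + (- \<Psi> a a) * P S n) = P (insert a S)"
      using insert.hyps by (auto simp: P_def algebra_simps)
    finally show ?case .
  qed
  have "\<Psi> a m - \<Psi> a a \<noteq> 0" if "a \<in> R" for a using \<Psi>(2)[OF that] by (metis right_minus_eq)
  hence Pm: "P R m \<noteq> 0" using finR m unfolding P_def principal_character_def by (simp add: prod_zero_iff)
  have "char_span k (\<lambda>n. (1 / P R m) * P R n)"
    by (intro char_span.scale span finR order_refl)
  also have "(\<lambda>n. (1 / P R m) * P R n) = (\<lambda>n. if [n = m] (mod k) then 1 else 0)"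
  proof
    fix n
    consider "[n = m] (mod k)" | "\<not> coprime n k" | "coprime n k" "\<not> [n = m] (mod k)" by blast
    thus "(1 / P R m) * P R n = (if [n = m] (mod k) then 1 else 0)"
    proof cases
      case 1
      have "P R n = P R m"
        unfolding P_def using dirichlet_character_cong[OF _ 1] \<Psi>(1) dirichlet_character_principal[OF k]
        by (intro arg_cong2[where f = "(*)"] prod.cong) auto
      thus ?thesis using Pm 1 by simp
    next
      case 2
      hence "\<not> [n = m] (mod k)" using m by (metis cong_imp_coprime cong_sym)
      thus ?thesis using 2 by (simp add: P_def principal_character_def)
    next
      case 3
      have nk: "[n mod k = n] (mod k)" by (simp add: cong_def)
      have "n mod k \<in> R" using 3 k nk by (auto simp: R_def cong_def)
      moreover have "\<Psi> (n mod k) n - \<Psi> (n mod k) (n mod k) = 0"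
        using dirichlet_character_cong[OF \<Psi>(1) nk] calculation by simp
      ultimately have "P R n = 0" using finR unfolding P_def by (metis mult_zero_right prod_zero)
      thus ?thesis using 3 by simp
    qed
  qed
  finally show ?thesis .
qed

text \<open>Equidistribution up to an error of smaller order: the weighted sum over one reduced
  class is the sum over all reduced classes divided by their number, up to O(x / ln^2 x). For the
  class of \<open>m\<close> the main term x / ln x survives.\<close>

lemma primes_in_class_lower_bound:
  fixes u :: "nat \<Rightarrow> real"
  assumes u: "\<And>p. u p \<ge> 0" and k: "k > 0" and m: "coprime m k" and c: "c > 0"
    and lower: "\<And>x. x \<ge> x0 \<Longrightarrow> (\<Sum>p | prime p \<and> real p \<le> x. u p) \<ge> c * (x / ln x)"
    and chars: "\<And>x \<psi>. x \<ge> x0 \<Longrightarrow> dirichlet_character k \<psi> \<Longrightarrow> \<psi> \<noteq> principal_character k \<Longrightarrow>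
      norm (\<Sum>p | prime p \<and> real p \<le> x. of_real (u p) * \<psi> p) \<le> C * (x / (ln x)\<^sup>2)"
  shows "\<exists>c'>0. \<exists>x1. \<forall>x\<ge>x1. (\<Sum>p | prime p \<and> real p \<le> x \<and> [p = m] (mod k). u p) \<ge> c' * (x / ln x)"
proof -
  define E where "E = (\<lambda>x g. \<Sum>p | prime p \<and> real p \<le> x. of_real (u p) * (g p :: complex))"
  define R where "R = {a. a < k \<and> coprime a k}"
  define N where "N = real (card R)"
  have fin: "finite {p. prime p \<and> real p \<le> x}" for x
    by (rule finite_subset[of _ "{..nat \<lfloor>x\<rfloor>}"]) (auto simp: le_nat_floor)
  have "1 mod k \<in> R" using k by (auto simp: R_def)
  hence N: "N > 0" unfolding N_def by (auto simp: card_gt_0_iff R_def)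
  \<comment> \<open>The quantity is linear in \<open>g\<close>. It vanishes for the principal
    character, and for the others the sum over \<open>R\<close> is 0 and the hypothesis bounds the
    rest; induction over the span gives it for class indicators. The absolute value avoids any sign
    assumption on \<open>x\<close>.\<close>
  have "\<exists>K\<ge>0. \<forall>x\<ge>x0. norm (of_real N * E x g - (\<Sum>a\<in>R. g a) * E x (principal_character k)) \<le> K * \<bar>x / (ln x)\<^sup>2\<bar>"
    if "char_span k g" for g
    using that
  proof induction
    case (char \<psi>)
    show ?case
    proof (cases "\<psi> = principal_character k")
      case True
      have "(\<Sum>a\<in>R. \<psi> a) = of_real N" by (simp add: True principal_character_def R_def N_def)
      thus ?thesis by (intro exI[of _ 0]) (simp add: True)
    next
      case False
      have 0: "(\<Sum>a\<in>R. \<psi> a) = 0" using sum_nonprincipal_character[OF char False k] by (simp add: R_def)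
      have "norm (of_real N * E x \<psi>) \<le> N * \<bar>C\<bar> * \<bar>x / (ln x)\<^sup>2\<bar>" if "x \<ge> x0" for x
      proof -
        have "norm (E x \<psi>) \<le> C * (x / (ln x)\<^sup>2)" unfolding E_def by (rule chars[OF that char False])
        also have "\<dots> \<le> \<bar>C\<bar> * \<bar>x / (ln x)\<^sup>2\<bar>" by (metis abs_ge_self abs_mult)
        finally have "N * norm (E x \<psi>) \<le> N * (\<bar>C\<bar> * \<bar>x / (ln x)\<^sup>2\<bar>)"
          using N by (intro mult_left_mono) auto
        moreover have "norm (of_real N * E x \<psi>) = N * norm (E x \<psi>)" using N by (simp add: norm_mult)
        ultimately show ?thesis by (simp only: mult.assoc)
      qed
      thus ?thesis using N by (intro exI[of _ "N * \<bar>C\<bar>"]) (simp add: 0)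
    qed
  next
    case (add g h)
    then obtain K1 K2 where K: "K1 \<ge> 0" "K2 \<ge> 0"
      "\<forall>x\<ge>x0. norm (of_real N * E x g - (\<Sum>a\<in>R. g a) * E x (principal_character k)) \<le> K1 * \<bar>x / (ln x)\<^sup>2\<bar>"
      "\<forall>x\<ge>x0. norm (of_real N * E x h - (\<Sum>a\<in>R. h a) * E x (principal_character k)) \<le> K2 * \<bar>x / (ln x)\<^sup>2\<bar>"
      by blast
    have "norm (of_real N * E x (\<lambda>n. g n + h n) - (\<Sum>a\<in>R. g a + h a) * E x (principal_character k)) \<le> (K1 + K2) * \<bar>x / (ln x)\<^sup>2\<bar>"
      if "x \<ge> x0" for x
    proof -
      have "of_real N * E x (\<lambda>n. g n + h n) - (\<Sum>a\<in>R. g a + h a) * E x (principal_character k) =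
         (of_real N * E x g - (\<Sum>a\<in>R. g a) * E x (principal_character k)) +
         (of_real N * E x h - (\<Sum>a\<in>R. h a) * E x (principal_character k))"
        by (simp add: E_def sum.distrib algebra_simps)
      thus ?thesis using K(3,4) that by (metis (no_types, lifting) norm_triangle_le add_mono distrib_right)
    qed
    thus ?case using K by (intro exI[of _ "K1 + K2"]) auto
  next
    case (scale g c)
    then obtain K where K: "K \<ge> 0"
      "\<forall>x\<ge>x0. norm (of_real N * E x g - (\<Sum>a\<in>R. g a) * E x (principal_character k)) \<le> K * \<bar>x / (ln x)\<^sup>2\<bar>" by blast
    have "norm (of_real N * E x (\<lambda>n. c * g n) - (\<Sum>a\<in>R. c * g a) * E x (principal_character k)) \<le> (norm c * K) * \<bar>x / (ln x)\<^sup>2\<bar>"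
      if "x \<ge> x0" for x
    proof -
      have "of_real N * E x (\<lambda>n. c * g n) - (\<Sum>a\<in>R. c * g a) * E x (principal_character k) =
         c * (of_real N * E x g - (\<Sum>a\<in>R. g a) * E x (principal_character k))" (is "?l = c * ?Z")
      proof -
        have "E x (\<lambda>n. c * g n) = c * E x g" unfolding E_def sum_distrib_left by (simp add: mult_ac)
        moreover have "(\<Sum>a\<in>R. c * g a) = c * (\<Sum>a\<in>R. g a)" by (rule sum_distrib_left[symmetric])
        ultimately show ?thesis by (simp add: right_diff_distrib mult_ac)
      qed
      moreover have "norm c * norm ?Z \<le> norm c * (K * \<bar>x / (ln x)\<^sup>2\<bar>)"
        using K(2) that by (intro mult_left_mono) auto
      ultimately show ?thesis by (simp only: norm_mult mult.assoc)
    qed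
    thus ?case using K by (intro exI[of _ "norm c * K"]) auto
  qed
  from this[OF char_span_class[OF k m]] obtain K where K: "K \<ge> 0"
    "\<And>x. x \<ge> x0 \<Longrightarrow> norm (of_real N * E x (\<lambda>n. if [n = m] (mod k) then 1 else 0) -
       (\<Sum>a\<in>R. if [a = m] (mod k) then 1 else 0) * E x (principal_character k)) \<le> K * \<bar>x / (ln x)\<^sup>2\<bar>"
    by blast
  have mR: "m mod k \<in> R" using m k by (auto simp: R_def)
  have "(\<Sum>a\<in>R. if [a = m] (mod k) then 1 else 0 :: complex) = (\<Sum>a\<in>R. if a = m mod k then 1 else 0)"
    by (intro sum.cong refl) (auto simp: R_def cong_def)
  also have "\<dots> = 1" using mR by (subst sum.delta) (auto simp: R_def)
  finally have sum1: "(\<Sum>a\<in>R. if [a = m] (mod k) then 1 else 0 :: complex) = 1" .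
  define S where "S = (\<lambda>x. \<Sum>p | prime p \<and> real p \<le> x \<and> [p = m] (mod k). u p)"
  define T where "T = (\<lambda>x. \<Sum>p | prime p \<and> real p \<le> x \<and> coprime p k. u p)"
  define U where "U = (\<Sum>p\<in>{..k}. u p)"
  have ES: "E x (\<lambda>n. if [n = m] (mod k) then 1 else 0) = of_real (S x)" for x
  proof -
    have "E x (\<lambda>n. if [n = m] (mod k) then 1 else 0) = (\<Sum>p | prime p \<and> real p \<le> x. if [p = m] (mod k) then of_real (u p) else 0)"
      unfolding E_def by (intro sum.cong) auto
    also have "\<dots> = (\<Sum>p\<in>{p. prime p \<and> real p \<le> x} \<inter> {p. [p = m] (mod k)}. of_real (u p))"
      using fin by (subst sum.inter_restrict) auto
    also have "{p. prime p \<and> real p \<le> x} \<inter> {p. [p = m] (mod k)} = {p. prime p \<and> real p \<le> x \<and> [p = m] (mod k)}" by auto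
    finally show ?thesis by (simp add: S_def)
  qed
  have ET: "E x (principal_character k) = of_real (T x)" for x
  proof -
    have "E x (principal_character k) = (\<Sum>p | prime p \<and> real p \<le> x. if coprime p k then of_real (u p) else 0)"
      unfolding E_def principal_character_def by (intro sum.cong) auto
    also have "\<dots> = (\<Sum>p\<in>{p. prime p \<and> real p \<le> x} \<inter> {p. coprime p k}. of_real (u p))"
      using fin by (subst sum.inter_restrict) auto
    also have "{p. prime p \<and> real p \<le> x} \<inter> {p. coprime p k} = {p. prime p \<and> real p \<le> x \<and> coprime p k}" by auto
    finally show ?thesis by (simp add: T_def)
  qed
  \<comment> \<open>A prime dividing \<open>k\<close> is at most \<open>k\<close>, so passing to
    primes coprime to \<open>k\<close> loses at most the constant \<open>U\<close>.\<close>
  have T_ge: "T x \<ge> c * (x / ln x) - U" if "x \<ge> x0" for x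
  proof -
    have "(\<Sum>p | prime p \<and> real p \<le> x. u p) \<le> (\<Sum>p\<in>{p. prime p \<and> real p \<le> x \<and> coprime p k} \<union> {..k}. u p)"
    proof (rule sum_mono2)
      show "finite ({p. prime p \<and> real p \<le> x \<and> coprime p k} \<union> {..k})"
        using finite_subset[OF _ fin[of x], of "{p. prime p \<and> real p \<le> x \<and> coprime p k}"] by auto
      show "{p. prime p \<and> real p \<le> x} \<subseteq> {p. prime p \<and> real p \<le> x \<and> coprime p k} \<union> {..k}"
      proof (intro subsetI)
        fix p assume p: "p \<in> {p. prime p \<and> real p \<le> x}"
        show "p \<in> {p. prime p \<and> real p \<le> x \<and> coprime p k} \<union> {..k}"
        proof (cases "p \<le> k")
          case False
          hence "\<not> p dvd k" using k dvd_imp_le by blast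
          thus ?thesis using p prime_imp_coprime by blast
        qed auto
      qed
    qed (use u in auto)
    also have "\<dots> \<le> T x + U"
    proof -
      have "finite {p. prime p \<and> real p \<le> x \<and> coprime p k}" by (rule finite_subset[OF _ fin[of x]]) auto
      hence "(\<Sum>p\<in>{p. prime p \<and> real p \<le> x \<and> coprime p k} \<union> {..k}. u p) + (\<Sum>p\<in>{p. prime p \<and> real p \<le> x \<and> coprime p k} \<inter> {..k}. u p)
          = (\<Sum>p | prime p \<and> real p \<le> x \<and> coprime p k. u p) + (\<Sum>p\<in>{..k}. u p)"
        by (intro sum.union_inter) auto
      moreover have "(\<Sum>p\<in>{p. prime p \<and> real p \<le> x \<and> coprime p k} \<inter> {..k}. u p) \<ge> 0" by (intro sum_nonneg u)
      ultimately show ?thesis unfolding T_def U_def by linarith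
    qed
    finally show ?thesis using lower[OF that] by linarith
  qed
  have S_ge: "N * S x \<ge> c * (x / ln x) - U - K * \<bar>x / (ln x)\<^sup>2\<bar>" if "x \<ge> x0" for x
  proof -
    have "\<bar>N * S x - T x\<bar> \<le> K * \<bar>x / (ln x)\<^sup>2\<bar>"
    proof -
      have "of_real N * of_real (S x) - 1 * of_real (T x) = (of_real (N * S x - T x) :: complex)" by simp
      thus ?thesis using K(2)[OF that] unfolding sum1 ES ET by (metis norm_of_real)
    qed
    thus ?thesis using T_ge[OF that] by linarith
  qed
  \<comment> \<open>Both losses are of smaller order than x / ln x and eventually consume at most
    half of the main term.\<close>
  have "((\<lambda>x::real. (U + K * \<bar>x / (ln x)\<^sup>2\<bar>) / (x / ln x)) \<longlongrightarrow> 0) at_top"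
    by real_asymp
  hence "eventually (\<lambda>x. (U + K * \<bar>x / (ln x)\<^sup>2\<bar>) / (x / ln x) < c / 2) at_top"
    using c by (intro order_tendstoD) auto
  hence "eventually (\<lambda>x. (U + K * \<bar>x / (ln x)\<^sup>2\<bar>) / (x / ln x) < c / 2 \<and> x \<ge> x0 \<and> x > 1) at_top"
    by (intro eventually_conj eventually_ge_at_top eventually_gt_at_top)
  then obtain x1 where x1: "\<And>x. x \<ge> x1 \<Longrightarrow> (U + K * \<bar>x / (ln x)\<^sup>2\<bar>) / (x / ln x) < c / 2 \<and> x \<ge> x0 \<and> x > 1"
    unfolding eventually_at_top_linorder by blast
  have "S x \<ge> c / 2 / N * (x / ln x)" if "x \<ge> x1" for x
  proof -
    note x = x1[OF that]
    have "x / ln x > 0" using x by simp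
    hence "U + K * \<bar>x / (ln x)\<^sup>2\<bar> \<le> c / 2 * (x / ln x)"
      using x pos_divide_less_eq[OF \<open>x / ln x > 0\<close>] less_imp_le by blast
    hence "N * S x \<ge> c / 2 * (x / ln x)" using S_ge[of x] x by simp
    hence "S x \<ge> c / 2 * (x / ln x) / N" unfolding pos_divide_le_eq[OF N] by (simp only: mult.commute)
    moreover have "c / 2 / N * (x / ln x) = c / 2 * (x / ln x) / N" by (rule times_divide_eq_left)
    ultimately show ?thesis by linarith
  qed
  moreover have "c / 2 / N > 0" using c N by simp
  ultimately show ?thesis unfolding S_def by blast
qed

text \<open>Partial summation compares the sum with that of \<open>1 / (n * ln n)\<close> over
  [q, q^t], which is at least ln ln (q^t) - ln ln q = ln t. This is free of \<open>q\<close>, so one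
  \<open>t\<close> serves all large \<open>q\<close>.\<close>

lemma log_weight_lower_bound:
  fixes w :: "nat \<Rightarrow> real"
  assumes w: "\<And>n. w n \<ge> 0" "\<And>n. w n \<le> D" and c: "c > 0"
    and lower: "\<And>x. real x \<ge> x1 \<Longrightarrow> (\<Sum>n=1..x. w n) \<ge> c * (real x / ln (real x))"
  shows "\<exists>t\<ge>1. \<exists>q1. \<forall>q\<ge>q1. (\<Sum>n=q..q ^ t. w n / real n) \<ge> L"
proof -
  define S where "S = (\<lambda>N. \<Sum>n=1..N. w n)"
  have D: "D \<ge> 0" using w[of 0] by linarith
  have tele: "x / (real n * real (n + 1)) + x / real (n + 1) = x / real n" if "n \<ge> 1" for n :: nat and x :: real
  proof -
    have "x / real (n + 1) = real n * x / (real n * real (n + 1))" using that by simp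
    hence "x / (real n * real (n + 1)) + x / real (n + 1) = x * real (n + 1) / (real n * real (n + 1))"
      by (simp add: add_divide_distrib[symmetric] algebra_simps)
    thus ?thesis by simp
  qed
  \<comment> \<open>Summation by parts, with 1/n - 1/(n+1) written as
    \<open>1 / (real n * real (n + 1))\<close>.\<close>
  have abel: "(\<Sum>n=q..N. w n / real n) = (\<Sum>n=q..N. S n / (real n * real (n + 1))) + S N / real (N + 1) - S (q - 1) / real q"
    if "q \<ge> 1" "q \<le> N" for q N
    using that(2)
  proof (induction N rule: dec_induct)
    case base
    have "S q = S (q - 1) + w q" using that(1) unfolding S_def by (cases q) auto
    thus ?case using tele[of q "S q"] that(1) by (simp add: add_divide_distrib del: of_nat_Suc)
  next
    case (step N)
    have "S (Suc N) = S N + w (Suc N)" unfolding S_def by simp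
    thus ?case using step tele[of "Suc N" "S (Suc N)"] by (simp add: add_divide_distrib del: of_nat_Suc)
  qed
  have S_le: "S N \<le> D * real N" for N
    unfolding S_def using sum_bounded_above[of "{1..N}" w D] w(2) by (simp add: mult.commute)
  have lnln: "ln (ln (real (N + 1))) - ln (ln (real q)) \<le> (\<Sum>n=q..N. 1 / (real n * ln (real n)))"
    if "q \<ge> 2" "q \<le> N" for q N
  proof -
    have st: "ln (ln (real (Suc n))) - ln (ln (real n)) \<le> 1 / (real n * ln (real n))" if "n \<ge> 2" for n
    proof -
      have pos: "ln (real n) > 0" "ln (real (Suc n)) > 0" using that by auto
      have "ln (ln (real (Suc n))) - ln (ln (real n)) = ln (ln (real (Suc n)) / ln (real n))"
        using pos by (subst ln_div) auto
      also have "\<dots> \<le> ln (real (Suc n)) / ln (real n) - 1" using pos by (intro ln_le_minus_one) auto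
      also have "\<dots> = (ln (real (Suc n)) - ln (real n)) / ln (real n)" using pos by (simp add: field_simps)
      also have "ln (real (Suc n)) - ln (real n) = ln (real (Suc n) / real n)" using that by (subst ln_div) auto
      also have "\<dots> \<le> real (Suc n) / real n - 1" using that by (intro ln_le_minus_one) auto
      also have "\<dots> = 1 / real n" using that by (simp add: field_simps)
      finally show ?thesis using pos by (simp add: divide_right_mono)
    qed
    show ?thesis using that(2)
    proof (induction N rule: dec_induct)
      case base thus ?case using st[OF that(1)] by simp
    next
      case (step N) thus ?case using st[of "Suc N"] that(1) by simp
    qed
  qed
  \<comment> \<open>The main term is at least \<open>c / 2 * ln t\<close>; it has to cover
    \<open>L\<close> and the boundary term at \<open>q\<close>, which is at most
    \<open>D\<close>.\<close>
  obtain t :: nat where t: "ln (real t) \<ge> 2 * (L + D) / c" "t \<ge> 1"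
  proof -
    obtain t :: nat where "real t \<ge> exp (2 * (L + D) / c)" using real_arch_simple by blast
    moreover have "t \<ge> 1" using calculation by (cases t) (auto simp: not_le)
    moreover have "ln (real t) \<ge> 2 * (L + D) / c" using calculation by (subst ln_ge_iff) auto
    ultimately show ?thesis using that by blast
  qed
  obtain q1 :: nat where q1: "real q1 \<ge> max x1 2" using real_arch_simple by blast
  have "(\<Sum>n=q..q ^ t. w n / real n) \<ge> L" if q: "q \<ge> q1" for q
  proof -
    have q2: "q \<ge> 2" "real q \<ge> x1" using q1 q by linarith+
    have qt: "q \<le> q ^ t" using t(2) q2 by (simp add: self_le_power)
    have lnq: "ln (real q) > 0" using q2 by simp
    have "ln (real t) = ln (ln (real (q ^ t))) - ln (ln (real q))"
      using lnq t(2) q2 by (simp add: ln_realpow ln_mult)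
    also have "\<dots> \<le> ln (ln (real (q ^ t + 1))) - ln (ln (real q))"
    proof -
      have "real (q ^ t) \<ge> 2" using qt q2(1) by linarith
      hence "ln (real (q ^ t)) > 0" by (intro ln_gt_zero) linarith
      moreover have "ln (real (q ^ t)) \<le> ln (real (q ^ t + 1))"
        using \<open>real (q ^ t) \<ge> 2\<close> by (intro ln_mono) linarith+
      ultimately have "ln (ln (real (q ^ t))) \<le> ln (ln (real (q ^ t + 1)))" by (metis ln_mono)
      thus ?thesis by linarith
    qed
    also have "\<dots> \<le> (\<Sum>n=q..q^t. 1 / (real n * ln (real n)))" by (rule lnln[OF q2(1) qt])
    finally have "c / 2 * ln (real t) \<le> c / 2 * (\<Sum>n=q..q^t. 1 / (real n * ln (real n)))"
      using c by (intro mult_left_mono) auto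
    also have "\<dots> = (\<Sum>n=q..q^t. c / 2 * (1 / (real n * ln (real n))))" by (rule sum_distrib_left)
    also have "\<dots> \<le> (\<Sum>n=q..q^t. S n / (real n * real (n + 1)))"
    proof (rule sum_mono)
      fix n assume n: "n \<in> {q..q^t}"
      have n2: "n \<ge> 2" "real n \<ge> x1" using n q2 by auto
      \<comment> \<open>The factor 1/2 is the price of replacing \<open>n + 1\<close> by
        \<open>2 * n\<close>.\<close>
      have "c / 2 * (1 / (real n * ln (real n))) = c * (real n / ln (real n)) / (real n * (2 * real n))"
        using n2 by (simp add: field_simps)
      also have "\<dots> \<le> S n / (real n * (2 * real n))" unfolding S_def
        by (intro divide_right_mono lower n2) auto
      also have "\<dots> \<le> S n / (real n * real (n + 1))"
      proof (rule divide_left_mono)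
        show "0 \<le> S n" unfolding S_def by (intro sum_nonneg w)
      qed (use n2 in auto)
      finally show "c / 2 * (1 / (real n * ln (real n))) \<le> S n / (real n * real (n + 1))" .
    qed
    finally have 1: "c / 2 * ln (real t) \<le> (\<Sum>n=q..q^t. S n / (real n * real (n + 1)))" .
    have 2: "S (q ^ t) / real (q ^ t + 1) \<ge> 0" unfolding S_def by (intro divide_nonneg_nonneg sum_nonneg w) auto
    have 3: "S (q - 1) / real q \<le> D"
    proof -
      have "S (q - 1) \<le> D * real q" using S_le[of "q - 1"] D q2
        by (meson diff_le_self mult_left_mono of_nat_le_iff order_trans)
      thus ?thesis using q2 by (simp add: pos_divide_le_eq)
    qed
    have "c / 2 * ln (real t) \<ge> L + D" using t(1) c by (simp add: field_simps)
    thus ?thesis using abel[of q "q^t"] q2 qt 1 2 3 by linarith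
  qed
  thus ?thesis using t(2) by blast
qed

section \<open>A mean square estimate for exponential sums\<close>

lemma sum_inverse_le_ln: "n \<ge> 1 \<Longrightarrow> (\<Sum>j=1..n. 1 / real j) \<le> 1 + ln (real n)"
proof (induction n rule: nat_induct_at_least)
  case (Suc n)
  have "ln (real n / real (Suc n)) \<le> real n / real (Suc n) - 1"
    using Suc by (intro ln_le_minus_one) auto
  also have "real n / real (Suc n) - 1 = - (1 / real (Suc n))"
    by (simp add: field_simps)
  also have "ln (real n / real (Suc n)) = ln (real n) - ln (real (Suc n))"
    using Suc by (subst ln_div) auto
  finally show ?case using Suc by simp
qed auto

text \<open>A crude Jordan inequality. Up to \<open>pi / 3\<close> the derivative of the difference
  is nonnegative because the cosine is at least 1/2; beyond, the sine is at least
  \<open>sqrt 3 / 2\<close>, which exceeds half of \<open>pi / 2\<close>.\<close>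

lemma sin_ge_half:
  fixes t :: real
  assumes "0 \<le> t" "t \<le> pi / 2"
  shows "t / 2 \<le> sin t"
proof (cases "t \<le> pi / 3")
  case True
  have "sin 0 - 0 / 2 \<le> sin t - t / 2"
  proof (rule DERIV_nonneg_imp_nondecreasing[OF assms(1)])
    fix x assume x: "0 \<le> x" "x \<le> t"
    have "((\<lambda>x. sin x - x / 2) has_real_derivative (cos x - 1 / 2)) (at x)"
      by (auto intro!: derivative_eq_intros)
    moreover have "cos x \<ge> cos (pi / 3)" using x True by (intro cos_monotone_0_pi_le) auto
    ultimately show "\<exists>y. ((\<lambda>x. sin x - x / 2) has_real_derivative y) (at x) \<and> 0 \<le> y"
      by (auto simp: cos_60)
  qed
  thus ?thesis by simp
next
  case False
  have "sin (pi / 3) \<le> sin t" using False assms by (intro sin_monotone_2pi_le) auto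
  moreover have "sqrt 3 \<ge> 17 / 10" by (rule real_le_rsqrt) (simp add: power2_eq_square)
  moreover have "t \<le> 17 / 10" using assms pi_less_4 pi_approx by auto
  ultimately show ?thesis by (simp add: sin_60)
qed

lemma norm_e2pi [simp]: "norm (e2pi (of_real x)) = 1"
  by (simp add: e2pi_def norm_exp_eq_Re)

lemma e2pi_add: "e2pi (x + y) = e2pi x * e2pi y"
  by (simp add: e2pi_def algebra_simps exp_add)

lemma e2pi_of_int [simp]: "e2pi (of_int n) = 1"
  using exp_integer_2pi[of "real_of_int n"] by (simp add: e2pi_def mult_ac)

lemma e2pi_power: "e2pi x ^ n = e2pi (of_nat n * x)"
  by (simp add: e2pi_def exp_of_nat_mult[symmetric] algebra_simps)

lemma cnj_e2pi: "cnj (e2pi (of_real x)) = e2pi (of_real (- x))"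
  by (simp add: e2pi_def exp_cnj)

lemma norm_1_minus_e2pi_ge:
  fixes x \<delta> :: real
  assumes "\<And>z :: int. \<bar>x - of_int z\<bar> \<ge> \<delta>"
  shows "norm (1 - e2pi (of_real x)) \<ge> \<delta>"
proof -
  define y where "y = x - of_int (round x)"
  have y: "\<bar>y\<bar> \<le> 1 / 2" "\<bar>y\<bar> \<ge> \<delta>"
    using of_int_round_abs_le[of x] assms[of "round x"] by (auto simp: y_def abs_minus_commute)
  have "e2pi (of_real x) = e2pi (of_real y + of_int (round x))"
    by (simp add: y_def)
  also have "\<dots> = exp (\<i> * of_real (2 * pi * y))"
    by (subst e2pi_add, simp) (simp add: e2pi_def algebra_simps)
  finally have "norm (1 - e2pi (of_real x)) = norm (exp (\<i> * of_real (2 * pi * y)) - 1)"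
    by (simp add: norm_minus_commute)
  also have "\<dots> = 2 * \<bar>sin (pi * y)\<bar>" by (subst dist_exp_i_1) simp
  also have "\<bar>sin (pi * y)\<bar> = \<bar>sin (pi * \<bar>y\<bar>)\<bar>" by (cases "y \<ge> 0") auto
  finally have *: "norm (1 - e2pi (of_real x)) = 2 * \<bar>sin (pi * \<bar>y\<bar>)\<bar>" .
  have "pi * \<bar>y\<bar> / 2 \<le> sin (pi * \<bar>y\<bar>)"
    using mult_left_mono[OF y(1), of pi] by (intro sin_ge_half) auto
  with * have "norm (1 - e2pi (of_real x)) \<ge> pi * \<bar>y\<bar>" by linarith
  moreover have "pi * \<bar>y\<bar> \<ge> 1 * \<bar>y\<bar>" using pi_gt3 by (intro mult_right_mono) auto
  ultimately show ?thesis using y by linarith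
qed

lemma norm_geometric_log_sum_le:
  fixes z :: complex
  assumes "norm z = 1" "z \<noteq> 1" "0 < q" "q \<le> V"
  shows "norm (\<Sum>v=q..V. z ^ v / of_nat v) \<le> 2 / (real q * norm (1 - z))"
proof -
  define S where "S = (\<lambda>V. \<Sum>v=q..V. z ^ v / of_nat v)"
  \<comment> \<open>The induction carries the boundary term of the summation by parts. The bound
    \<open>2 / q - 1 / V\<close> grows by exactly the \<open>1 / V - 1 / (V + 1)\<close> that each
    step adds.\<close>
  have "norm ((1 - z) * S V + z ^ Suc V / of_nat V) \<le> 2 / real q - 1 / real V"
    using assms(4)
  proof (induction V rule: dec_induct)
    case base
    have "(1 - z) * S q + z ^ Suc q / of_nat q = z ^ q / of_nat q"
      by (simp add: S_def diff_divide_distrib left_diff_distrib)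
    thus ?case using assms by (simp add: norm_divide norm_power)
  next
    case (step V)
    have V: "V > 0" using step assms by simp
    have "S (Suc V) = S V + z ^ Suc V / of_nat (Suc V)" using step by (simp add: S_def)
    hence "(1 - z) * S (Suc V) + z ^ Suc (Suc V) / of_nat (Suc V) =
           ((1 - z) * S V + z ^ Suc V / of_nat V) - z ^ Suc V * (1 / of_nat V - 1 / of_nat (Suc V))"
      by (simp add: algebra_simps add_divide_distrib diff_divide_distrib del: of_nat_Suc)
    also have "norm \<dots> \<le> (2 / real q - 1 / real V) + norm (z ^ Suc V * (1 / of_nat V - 1 / of_nat (Suc V)))"
      by (rule order_trans[OF norm_triangle_ineq4]) (use step.IH in auto)
    also have "norm (z ^ Suc V * (1 / of_nat V - 1 / of_nat (Suc V))) = \<bar>1 / real V - 1 / real (Suc V)\<bar>"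
    proof -
      have "(1 / of_nat V - 1 / of_nat (Suc V) :: complex) = of_real (1 / real V - 1 / real (Suc V))" by simp
      thus ?thesis using assms(1) unfolding norm_mult norm_power by (metis norm_of_real mult_1 power_one)
    qed
    also have "\<dots> = 1 / real V - 1 / real (Suc V)" using V by (simp add: field_simps)
    finally show ?case by simp
  qed
  moreover have "norm (z ^ Suc V / of_nat V) = 1 / real V" using assms by (simp add: norm_divide norm_power norm_mult)
  ultimately have "norm ((1 - z) * S V) \<le> 2 / real q"
    using norm_triangle_ineq4[of "(1 - z) * S V + z ^ Suc V / of_nat V" "z ^ Suc V / of_nat V"] by simp
  hence "norm (1 - z) * norm (S V) \<le> 2 / real q" unfolding norm_mult .
  moreover have "norm (1 - z) > 0" using assms by simp
  ultimately show ?thesis unfolding S_def using assms(3) by (simp add: field_simps del: norm_mult)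
qed

text \<open>For distinct \<open>b\<close> and \<open>b'\<close> in a window of length at most q/2,
  the fraction A/q times their difference stays 1/q away from integers, and replacing A/q by
  \<open>lam\<close> costs at most 1/(2q). The points are thus spaced by 1/(2q) modulo 1, and few
  fit into an interval of length \<open>2 * \<delta>\<close>.\<close>

lemma card_close_in_window_le:
  fixes lam \<alpha> \<delta> :: real and A :: int and q x B :: nat
  assumes q: "q > 0" "coprime A (int q)" "\<bar>lam - of_int A / real q\<bar> < 1 / (real q)\<^sup>2"
    and B: "2 * B \<le> q" and "\<delta> > 0"
  shows "real (card {b \<in> {x..<x+B}. \<exists>z::int. \<bar>lam * real b - \<alpha> - of_int z\<bar> < \<delta>}) \<le> 4 * real q * \<delta> + 2"
proof -
  define S where "S = {b \<in> {x..<x+B}. \<exists>z::int. \<bar>lam * real b - \<alpha> - of_int z\<bar> < \<delta>}"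
  have "\<forall>b\<in>S. \<exists>z::int. \<bar>lam * real b - \<alpha> - of_int z\<bar> < \<delta>" by (auto simp: S_def)
  then obtain z :: "nat \<Rightarrow> int" where z: "\<And>b. b \<in> S \<Longrightarrow> \<bar>lam * real b - \<alpha> - of_int (z b)\<bar> < \<delta>"
    by metis
  define y where "y = (\<lambda>b. lam * real b - \<alpha> - of_int (z b))"
  \<comment> \<open>Points spaced by 1/(2q) fall into different cells of length 1/(2q), so counting
    them is counting integers in an interval.\<close>
  define g where "g = (\<lambda>b. \<lfloor>2 * real q * y b\<rfloor>)"
  have sep: "\<bar>y b - y b'\<bar> \<ge> 1 / (2 * real q)" if b: "b \<in> S" "b' \<in> S" "b \<noteq> b'" for b b'
  proof -
    define h where "h = int b - int b'"
    define n where "n = z b - z b'"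
    have "x \<le> b" "b < x + B" "x \<le> b'" "b' < x + B" using b by (auto simp: S_def)
    hence h: "h \<noteq> 0" "2 * \<bar>h\<bar> < int q" using b(3) B unfolding h_def abs_if by (simp_all split: if_splits)
    have "\<not> int q dvd A * h - n * int q"
    proof
      assume "int q dvd A * h - n * int q"
      hence "int q dvd A * h" by (metis dvd_diff_commute dvd_diff_right_iff dvd_triv_right)
      hence "int q dvd h" using q(2) by (metis coprime_commute coprime_dvd_mult_right_iff)
      thus False using h zdvd_imp_le[of "int q" "\<bar>h\<bar>"] by auto
    qed
    hence "A * h - n * int q \<noteq> 0" by auto
    hence "\<bar>A * h - n * int q\<bar> \<ge> 1" by simp
    hence ge1: "\<bar>of_int A * of_int h - of_int n * real q\<bar> \<ge> 1"
      by (metis (mono_tags, opaque_lifting) of_int_1_le_iff of_int_abs of_int_diff of_int_mult of_int_of_nat_eq)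
    hence 1: "\<bar>of_int A / real q * of_int h - of_int n\<bar> \<ge> 1 / real q"
    proof -
      have "of_int A / real q * of_int h - of_int n = (of_int A * of_int h - of_int n * real q) / real q"
        using q(1) by (simp add: field_simps)
      thus ?thesis using ge1 by (simp add: abs_divide divide_right_mono)
    qed
    have "\<bar>(lam - of_int A / real q) * of_int h\<bar> \<le> 1 / (real q)\<^sup>2 * (real q / 2)"
      unfolding abs_mult using h(2) q(3) by (intro mult_mono) auto
    also have "\<dots> = 1 / (2 * real q)" using q(1) by (simp add: power2_eq_square field_simps)
    finally have 2: "\<bar>(lam - of_int A / real q) * of_int h\<bar> \<le> 1 / (2 * real q)" .
    have "y b - y b' = (lam - of_int A / real q) * of_int h + (of_int A / real q * of_int h - of_int n)"
      by (simp add: y_def h_def n_def algebra_simps)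
    moreover have "1 / real q = 2 * (1 / (2 * real q))" by simp
    ultimately show ?thesis using 1 2 by linarith
  qed
  have inj: "inj_on g S"
  proof (rule inj_onI, rule ccontr)
    fix b b' assume b: "b \<in> S" "b' \<in> S" "g b = g b'" "b \<noteq> b'"
    have "\<bar>2 * real q * y b - 2 * real q * y b'\<bar> < 1" using b(3) unfolding g_def by linarith
    hence "2 * real q * \<bar>y b - y b'\<bar> < 1"
      by (metis abs_mult abs_of_nat abs_numeral right_diff_distrib)
    moreover have "2 * real q * \<bar>y b - y b'\<bar> \<ge> 2 * real q * (1 / (2 * real q))"
      by (intro mult_left_mono sep b) auto
    ultimately show False using q(1) by simp
  qed
  have "g ` S \<subseteq> {\<lfloor>- (2 * real q * \<delta>)\<rfloor>..\<lfloor>2 * real q * \<delta>\<rfloor>}"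
  proof safe
    fix b assume "b \<in> S"
    from z[OF this] have "2 * real q * y b \<le> 2 * real q * \<delta>" "2 * real q * (- \<delta>) \<le> 2 * real q * y b"
      by (intro mult_left_mono; simp add: y_def)+
    thus "g b \<in> {\<lfloor>- (2 * real q * \<delta>)\<rfloor>..\<lfloor>2 * real q * \<delta>\<rfloor>}" unfolding g_def by (auto intro: floor_mono)
  qed
  hence "card (g ` S) \<le> card {\<lfloor>- (2 * real q * \<delta>)\<rfloor>..\<lfloor>2 * real q * \<delta>\<rfloor>}" by (intro card_mono) auto
  hence "card S \<le> nat (\<lfloor>2 * real q * \<delta>\<rfloor> + 1 - \<lfloor>- (2 * real q * \<delta>)\<rfloor>)" using inj by (simp add: card_image)
  hence "real (card S) \<le> real (nat (\<lfloor>2 * real q * \<delta>\<rfloor> + 1 - \<lfloor>- (2 * real q * \<delta>)\<rfloor>))" by simp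
  also have "\<dots> \<le> 4 * real q * \<delta> + 2"
  proof -
    have "0 \<le> 2 * real q * \<delta>" using assms by simp
    thus ?thesis by linarith
  qed
  finally show ?thesis by (simp add: S_def)
qed

lemma sum_inverse_window_le:
  fixes S :: "nat set" and c :: real
  assumes window: "\<And>x. real (card (S \<inter> {x..<x+B})) \<le> c" and B: "B > 0" "B \<le> q" and c: "c \<ge> 0"
  shows "(\<Sum>b\<in>S \<inter> {q..X}. 1 / real b) \<le> c / real B * (1 + ln (real (X + 1)))"
proof -
  define j where "j = (\<lambda>b. (b - q) div B)"
  have "(\<Sum>b\<in>S \<inter> {q..X}. 1 / real b) = (\<Sum>i\<in>{..X}. \<Sum>b\<in>{b\<in>S \<inter> {q..X}. j b = i}. 1 / real b)"
  proof (rule sum.group[symmetric])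
    show "j ` (S \<inter> {q..X}) \<subseteq> {..X}"
    proof safe
      fix b assume "b \<in> {q..X}"
      hence "b - q \<le> X" by auto
      thus "j b \<le> X" unfolding j_def by (rule order_trans[OF div_le_dividend])
    qed
  qed auto
  also have "\<dots> \<le> (\<Sum>i\<in>{..X}. c / real B * (1 / real (Suc i)))"
  proof (rule sum_mono)
    fix i
    have mem: "b \<in> S \<inter> {q+i*B..<q+i*B+B} \<and> 1 / real b \<le> 1 / (real B * real (Suc i))"
      if "b \<in> {b\<in>S \<inter> {q..X}. j b = i}" for b
    proof -
      have b: "b \<in> S" "q \<le> b" "(b - q) div B = i" using that by (auto simp: j_def)
      have "i * B \<le> b - q" using b(3) by (metis div_times_less_eq_dividend)
      moreover have "b - q < i * B + B" using b(3) B(1) by (metis dividend_less_div_times add.commute)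
      ultimately have "q + i * B \<le> b" "b < q + i * B + B" using b(2) by linarith+
      hence *: "b \<in> S \<inter> {q+i*B..<q+i*B+B}" using b(1) by simp
      \<comment> \<open>The shift of the index by one comes from \<open>B \<le> q\<close>: the
        window numbered \<open>i\<close> starts at q + iB, which is at least B(i+1).\<close>
      hence "B * Suc i \<le> b" using B by (auto simp: algebra_simps)
      hence "real B * real (Suc i) \<le> real b" by (metis of_nat_le_iff of_nat_mult)
      thus ?thesis using * B by (auto intro!: divide_left_mono mult_pos_pos simp del: of_nat_Suc)
    qed
    have "(\<Sum>b\<in>{b\<in>S \<inter> {q..X}. j b = i}. 1 / real b) \<le> (\<Sum>b\<in>{b\<in>S \<inter> {q..X}. j b = i}. 1 / (real B * real (Suc i)))"
      using mem by (intro sum_mono) blast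
    also have "\<dots> = real (card {b\<in>S \<inter> {q..X}. j b = i}) * (1 / (real B * real (Suc i)))" by simp
    also have "\<dots> \<le> c * (1 / (real B * real (Suc i)))"
    proof (rule mult_right_mono)
      have "card {b\<in>S \<inter> {q..X}. j b = i} \<le> card (S \<inter> {q+i*B..<q+i*B+B})"
        using mem by (intro card_mono) auto
      thus "real (card {b\<in>S \<inter> {q..X}. j b = i}) \<le> c" using window[of "q+i*B"] by linarith
    qed auto
    finally show "(\<Sum>b\<in>{b\<in>S \<inter> {q..X}. j b = i}. 1 / real b) \<le> c / real B * (1 / real (Suc i))" by simp
  qed
  also have "\<dots> = c / real B * (\<Sum>i\<in>{..X}. 1 / real (Suc i))" by (simp add: sum_distrib_left)
  also have "(\<Sum>i\<in>{..X}. 1 / real (Suc i)) = (\<Sum>j=1..X+1. 1 / real j)"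
    by (rule sum.reindex_bij_witness[of _ "\<lambda>j. j - 1" Suc]) auto
  also have "c / real B * (\<Sum>j=1..X+1. 1 / real j) \<le> c / real B * (1 + ln (real (X + 1)))"
    using c by (intro mult_left_mono sum_inverse_le_ln) auto
  finally show ?thesis .
qed

text \<open>Expanding the square leaves, for each pair \<open>p\<close>, \<open>b\<close>, the sum
  of \<open>z ^ v / v\<close> with z = e(\<lambda>(p - b)). Since v starts at q, it is small unless
  \<lambda>(p - b) is close to an integer, and for fixed \<open>p\<close> such \<open>b\<close>,
  among them \<open>p\<close> itself, are sparse. One variable is bounded by \<open>d / p\<close>,
  the other keeps its norm sum.\<close>

lemma mean_square_exponential_sum_le:
  fixes lam d :: real and A :: int and q X V :: nat and \<gamma> :: "nat \<Rightarrow> complex"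
  assumes q: "q \<ge> 2" "coprime A (int q)" "\<bar>lam - of_int A / real q\<bar> < 1 / (real q)\<^sup>2"
    and Q: "Q \<subseteq> {q..X}" and \<gamma>: "\<And>p. p \<in> Q \<Longrightarrow> norm (\<gamma> p) \<le> d / real p" and V: "q \<le> V" and d: "d \<ge> 0"
  shows "(\<Sum>v=q..V. (norm (\<Sum>p\<in>Q. \<gamma> p * e2pi (of_real (lam * real (v * p)))))\<^sup>2 / real v)
           \<le> 20 * d * (\<Sum>p\<in>Q. norm (\<gamma> p)) * (1 + ln (real V)) * (1 + ln (real (X + 1))) / sqrt (real q)"
proof -
  have finQ: "finite Q" using Q finite_subset by blast
  define z where "z = (\<lambda>p b. e2pi (of_real (lam * (real p - real b))))"
  define Y where "Y = (\<lambda>p b. norm (\<Sum>v=q..V. z p b ^ v / of_nat v))"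
  \<comment> \<open>The balancing choice: good pairs contribute about 1/(q \<delta>), bad ones have
    density about \<delta>.\<close>
  define \<delta> where "\<delta> = 1 / sqrt (real q)"
  define H where "H = 1 + ln (real V)"
  define K where "K = 1 + ln (real (X + 1))"
  have \<delta>: "\<delta> > 0" using q by (simp add: \<delta>_def)
  have H: "H \<ge> 1" using V q by (simp add: H_def)
  have qd: "real q * \<delta> = sqrt (real q)" using q by (simp add: \<delta>_def real_div_sqrt)
  have nz: "norm (z p b) = 1" for p b unfolding z_def by (rule norm_e2pi)
  have Y_H: "Y p b \<le> H" for p b
  proof -
    have "Y p b \<le> (\<Sum>v=q..V. norm (z p b ^ v / of_nat v))" unfolding Y_def by (rule norm_sum)
    also have "\<dots> = (\<Sum>v=q..V. 1 / real v)" by (simp add: norm_divide norm_power nz)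
    also have "\<dots> \<le> (\<Sum>v=1..V. 1 / real v)" using q by (intro sum_mono2) auto
    also have "\<dots> \<le> H" unfolding H_def using V q by (intro sum_inverse_le_ln) auto
    finally show ?thesis .
  qed
  define bad where "bad = (\<lambda>p. {b. \<exists>n::int. \<bar>lam * real b - lam * real p - of_int n\<bar> < \<delta>})"
  have Y_good: "Y p b \<le> 2 * \<delta> * H" if "b \<notin> bad p" for p b
  proof -
    have "\<bar>lam * (real p - real b) - of_int n\<bar> \<ge> \<delta>" for n :: int
    proof -
      have "\<not> \<bar>lam * real b - lam * real p - of_int (- n)\<bar> < \<delta>" using that unfolding bad_def by blast
      thus ?thesis by (simp add: algebra_simps abs_if split: if_splits)
    qed
    hence *: "norm (1 - z p b) \<ge> \<delta>" unfolding z_def by (rule norm_1_minus_e2pi_ge)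
    hence "z p b \<noteq> 1" using \<delta> by auto
    hence "Y p b \<le> 2 / (real q * norm (1 - z p b))" unfolding Y_def
      using q V by (intro norm_geometric_log_sum_le) (auto simp: nz)
    also have "\<dots> \<le> 2 / (real q * \<delta>)" using * \<delta> q by (intro divide_left_mono mult_left_mono mult_pos_pos) auto
    also have "\<dots> = 2 * \<delta>" unfolding qd by (simp add: \<delta>_def)
    also have "\<dots> \<le> 2 * \<delta> * H" using \<delta> H by simp
    finally show ?thesis .
  qed
  have bad_sum: "(\<Sum>b\<in>bad p \<inter> {q..X}. 1 / real b) \<le> 18 * \<delta> * K" for p
  proof -
    have "(\<Sum>b\<in>bad p \<inter> {q..X}. 1 / real b) \<le> (4 * real q * \<delta> + 2) / real (q div 2) * (1 + ln (real (X + 1)))"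
    proof (rule sum_inverse_window_le)
      fix x
      have "bad p \<inter> {x..<x + q div 2} = {b \<in> {x..<x + q div 2}. \<exists>n::int. \<bar>lam * real b - lam * real p - of_int n\<bar> < \<delta>}"
        by (auto simp: bad_def)
      thus "real (card (bad p \<inter> {x..<x + q div 2})) \<le> 4 * real q * \<delta> + 2"
        using card_close_in_window_le[OF _ q(2,3) _ \<delta>, of "q div 2" x "lam * real p"] q by simp
    qed (use q \<delta> in auto)
    \<comment> \<open>18 = 6 * 3: the summand 2 is absorbed because
      \<open>q * \<delta> = sqrt q \<ge> 1\<close>, and \<open>q \<le> 3 * (q div 2)\<close> for
      \<open>q \<ge> 2\<close>. Good pairs add 2 later, whence the 20 of the statement.\<close>
    also have "(4 * real q * \<delta> + 2) / real (q div 2) \<le> 18 * \<delta>"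
    proof -
      have "sqrt (real q) \<ge> 1" using q by simp
      hence "4 * real q * \<delta> + 2 \<le> 6 * (real q * \<delta>)" unfolding mult.assoc qd by simp
      also have "3 * (q div 2) \<ge> q" using q by presburger
      hence "real q \<le> 3 * real (q div 2)" by (metis of_nat_le_iff of_nat_mult of_nat_numeral)
      hence "6 * (real q * \<delta>) \<le> 6 * (3 * real (q div 2) * \<delta>)" using \<delta> by (intro mult_left_mono mult_right_mono) auto
      finally show ?thesis using q by (simp add: field_simps)
    qed
    finally show ?thesis by (simp add: K_def mult_right_mono)
  qed
  have inner: "(\<Sum>b\<in>Q. norm (\<gamma> b) * Y p b) \<le> 20 * d * H * K * \<delta>" for p
  proof -
    have "(\<Sum>b\<in>Q. norm (\<gamma> b) * Y p b) \<le> (\<Sum>b\<in>Q. d * (Y p b / real b))"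
    proof (rule sum_mono)
      fix b assume "b \<in> Q"
      hence "norm (\<gamma> b) * Y p b \<le> d / real b * Y p b" by (intro mult_right_mono \<gamma>) (auto simp: Y_def)
      thus "norm (\<gamma> b) * Y p b \<le> d * (Y p b / real b)" by simp
    qed
    also have "\<dots> = d * (\<Sum>b\<in>Q. Y p b / real b)" by (simp add: sum_distrib_left)
    finally have 1: "(\<Sum>b\<in>Q. norm (\<gamma> b) * Y p b) \<le> d * (\<Sum>b\<in>Q. Y p b / real b)" .
    have "(\<Sum>b\<in>Q. Y p b / real b) \<le> (\<Sum>b\<in>{q..X}. Y p b / real b)"
      using Q by (intro sum_mono2) (auto simp: Y_def)
    also have "\<dots> = (\<Sum>b\<in>bad p \<inter> {q..X}. Y p b / real b) + (\<Sum>b\<in>{q..X} - bad p. Y p b / real b)"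
      by (subst sum.Int_Diff[of _ _ "bad p"]) (auto simp: Int_commute)
    also have "(\<Sum>b\<in>bad p \<inter> {q..X}. Y p b / real b) \<le> (\<Sum>b\<in>bad p \<inter> {q..X}. H * (1 / real b))"
      by (intro sum_mono) (use Y_H in \<open>auto intro: divide_right_mono\<close>)
    also have "\<dots> = H * (\<Sum>b\<in>bad p \<inter> {q..X}. 1 / real b)" by (simp add: sum_distrib_left)
    also have "\<dots> \<le> H * (18 * \<delta> * K)" using H by (intro mult_left_mono bad_sum) auto
    also have "(\<Sum>b\<in>{q..X} - bad p. Y p b / real b) \<le> (\<Sum>b\<in>{q..X} - bad p. 2 * \<delta> * H * (1 / real b))"
      by (intro sum_mono) (use Y_good in \<open>auto intro: divide_right_mono\<close>)
    also have "\<dots> \<le> (\<Sum>b\<in>{1..X+1}. 2 * \<delta> * H * (1 / real b))"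
      using q \<delta> H by (intro sum_mono2) auto
    also have "\<dots> = 2 * \<delta> * H * (\<Sum>b\<in>{1..X+1}. 1 / real b)" by (simp only: sum_distrib_left)
    also have "\<dots> \<le> 2 * \<delta> * H * K" unfolding K_def
      using \<delta> H by (intro mult_left_mono sum_inverse_le_ln) auto
    finally have "(\<Sum>b\<in>Q. Y p b / real b) \<le> 20 * H * K * \<delta>" by (simp add: algebra_simps)
    with d have "d * (\<Sum>b\<in>Q. Y p b / real b) \<le> d * (20 * H * K * \<delta>)" by (intro mult_left_mono)
    with 1 show ?thesis by (simp add: mult_ac)
  qed
  define S where "S = (\<lambda>v. \<Sum>p\<in>Q. \<gamma> p * e2pi (of_real (lam * real (v * p))))"
  have "of_real (\<Sum>v=q..V. (norm (S v))\<^sup>2 / real v) = (\<Sum>v=q..V. S v * cnj (S v) / of_nat v)"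
    by (simp add: complex_norm_square[symmetric] del: of_real_power)
  also have "\<dots> = (\<Sum>v=q..V. \<Sum>p\<in>Q. \<Sum>b\<in>Q. \<gamma> p * cnj (\<gamma> b) * (z p b ^ v / of_nat v))"
  proof (intro sum.cong refl)
    fix v
    have "e2pi (of_real (lam * real (v * p))) * cnj (e2pi (of_real (lam * real (v * b)))) = z p b ^ v" for p b
      unfolding cnj_e2pi z_def e2pi_power e2pi_add[symmetric] by (simp add: algebra_simps)
    hence "S v * cnj (S v) = (\<Sum>p\<in>Q. \<Sum>b\<in>Q. \<gamma> p * cnj (\<gamma> b) * z p b ^ v)"
      unfolding S_def cnj_sum sum_product complex_cnj_mult
      by (intro sum.cong refl) (metis (no_types, opaque_lifting) mult.assoc mult.left_commute)
    thus "S v * cnj (S v) / of_nat v = (\<Sum>p\<in>Q. \<Sum>b\<in>Q. \<gamma> p * cnj (\<gamma> b) * (z p b ^ v / of_nat v))"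
      by (simp add: sum_divide_distrib)
  qed
  also have "\<dots> = (\<Sum>p\<in>Q. \<Sum>b\<in>Q. \<gamma> p * cnj (\<gamma> b) * (\<Sum>v=q..V. z p b ^ v / of_nat v))"
    by (subst sum.swap, rule sum.cong[OF refl], subst sum.swap) (simp add: sum_distrib_left)
  finally have "norm (of_real (\<Sum>v=q..V. (norm (S v))\<^sup>2 / real v) :: complex) \<le>
      (\<Sum>p\<in>Q. \<Sum>b\<in>Q. norm (\<gamma> p) * (norm (\<gamma> b) * Y p b))"
    by (simp only:) (intro sum_norm_le, auto simp: norm_mult Y_def)
  also have "\<dots> = (\<Sum>p\<in>Q. norm (\<gamma> p) * (\<Sum>b\<in>Q. norm (\<gamma> b) * Y p b))" by (simp add: sum_distrib_left)
  also have "\<dots> \<le> (\<Sum>p\<in>Q. norm (\<gamma> p) * (20 * d * H * K * \<delta>))"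
    by (intro sum_mono mult_left_mono inner) auto
  also have "\<dots> = (\<Sum>p\<in>Q. norm (\<gamma> p)) * (20 * d * H * K * \<delta>)" by (simp add: sum_distrib_right)
  finally have "\<bar>\<Sum>v=q..V. (norm (S v))\<^sup>2 / real v\<bar> \<le> (\<Sum>p\<in>Q. norm (\<gamma> p)) * (20 * d * H * K * \<delta>)"
    unfolding norm_of_real .
  thus ?thesis unfolding S_def H_def K_def \<delta>_def by (simp add: field_simps)
qed

section \<open>The coefficients at primes\<close>

lemma DERIV_prod_linear:
  fixes x :: "'a \<Rightarrow> complex"
  assumes "finite J"
  shows "((\<lambda>w. \<Prod>j\<in>J. 1 - x j * w) has_field_derivative - (\<Sum>j\<in>J. x j)) (at 0)"
  using assms
proof (induction J rule: finite_induct)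
  case (insert a J)
  have "((\<lambda>w. (1 - x a * w) * (\<Prod>j\<in>J. 1 - x j * w)) has_field_derivative
          - x a * (\<Prod>j\<in>J. 1 - x j * 0) + - (\<Sum>j\<in>J. x j) * (1 - x a * 0)) (at 0)"
    by (rule DERIV_mult[OF _ insert.IH]) (auto intro!: derivative_eq_intros)
  thus ?case using insert.hyps by (simp add: add.commute)
qed auto

text \<open>The Euler product is known only as an identity for the untwisted series. Vertical shifts
  make it available with one prime \<open>p0\<close> twisted by \<open>w\<close> on the unit circle;
  all other factors form the constant \<open>C0\<close>. Both sides extend into the disc, and
  comparing the coefficients of \<open>w\<close> gives \<open>f p0\<close> as the sum of the
  \<open>fj j p0\<close>.\<close>

lemma norm_prime_coeff_le_degree:
  assumes mult: "multiplicative_fun f"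
    and summ: "\<And>\<sigma>. \<sigma> > 1 \<Longrightarrow> (\<lambda>n. norm (f n) * real n powr (- \<sigma>)) summable_on {1..}"
    and euler: "log_euler_product f d fj" and p0: "prime p0"
  shows "norm (f p0) \<le> real d"
proof -
  interpret dirichlet_coeffs f by unfold_locales (rule summ)
  have fj: "norm (fj j p) \<le> 1" if "prime p" "j \<in> {1..d}" for j p
    using euler that unfolding log_euler_product_def by blast
  define l where "l = (\<lambda>s p. \<Sum>j=1..d. Ln (1 - fj j p * of_nat p powr (- s)))"
  define ps where "ps = {p :: nat. prime p}"
  have F_exp: "twist_sum f (\<lambda>_. 1) s = exp (- infsum (l s) ps)" if "Re s > 1" for s
  proof -
    obtain logF where "\<forall>s. Re s > 1 \<longrightarrow> exp (logF s) = dirichlet_series f s \<and> (l s has_sum (- logF s)) ps"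
      using euler unfolding log_euler_product_def l_def ps_def by blast
    hence "exp (logF s) = dirichlet_series f s" "infsum (l s) ps = - logF s" using that by (auto intro: infsumI)
    hence "dirichlet_series f s = exp (- infsum (l s) ps)" by simp
    moreover have "dirichlet_series f s = twist_sum f (\<lambda>_. 1) s"
      unfolding dirichlet_series_def twist_sum_def cm_ext_const_1
      by (intro infsum_cong) (simp add: powr_minus_divide)
    ultimately show ?thesis by simp
  qed
  define e where "e = (\<lambda>p. if p = p0 then 1 else 0 :: nat)"
  define \<psi> where "\<psi> = (\<lambda>w p. if p = p0 then w else 1 :: complex)"
  have \<psi>_eq: "\<psi> w = (\<lambda>p. w ^ e p)" for w by (auto simp: \<psi>_def e_def)
  \<comment> \<open>The computation is done at \<open>s = 2\<close>, where every local parameter has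
    modulus at most 1/4 and principal logarithms are continuous and summable over the
    primes.\<close>
  define x where "x = (\<lambda>j. fj j p0 * of_nat p0 powr (- 2))"
  define \<Lambda> where "\<Lambda> = (\<lambda>p. \<Sum>j=1..d. Ln (1 - fj j p * of_nat p powr (- 2)))"
  define C0 where "C0 = exp (- infsum \<Lambda> (ps - {p0}))"
  define \<Phi> where "\<Phi> = (\<lambda>w. \<Sum>\<^sub>\<infinity>n\<in>{1..}. f n * w ^ add_ext e n * of_nat n powr (- 2))"
  define M where "M = (\<lambda>n. norm (f n) * real n powr (- 2))"
  have M: "M summable_on {1..}" unfolding M_def using summ[of 2] by simp
  have small: "norm (of_nat p powr (- s) :: complex) \<le> 1 / 4" if "prime p" "Re s \<ge> 2" for p s
  proof -
    have p: "p \<ge> 2" using that prime_ge_2_nat by blast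
    have "norm (of_nat p powr (- s) :: complex) = real p powr (- Re s)" using p by (simp add: norm_nat_powr)
    also have "\<dots> \<le> real p powr (- 2)" using p that by (intro powr_mono) auto
    also have "\<dots> = 1 / (real p)\<^sup>2" using p by (simp add: powr_minus_divide flip: powr_numeral)
    also have "\<dots> \<le> 1 / 2\<^sup>2" using p by (intro divide_left_mono power_mono) auto
    finally show ?thesis by simp
  qed
  have small': "norm (fj j p * v * of_nat p powr (- s)) \<le> real p powr (- 2)" "norm (fj j p * v * of_nat p powr (- s)) \<le> 1 / 4"
    if "prime p" "Re s = 2" "j \<in> {1..d}" "norm v = 1" for j p s v
  proof -
    have *: "norm (fj j p * v * of_nat p powr (- s)) \<le> norm (of_nat p powr (- s) :: complex)"
      using mult_right_mono[OF fj[OF that(1,3)], of "norm (of_nat p powr (- s) :: complex)"] that by (simp add: norm_mult)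
    also have "\<dots> = real p powr (- 2)" using prime_gt_0_nat[OF that(1)] that by (simp add: norm_nat_powr)
    finally show "norm (fj j p * v * of_nat p powr (- s)) \<le> real p powr (- 2)" .
    show "norm (fj j p * v * of_nat p powr (- s)) \<le> 1 / 4" using * small[OF that(1), of s] that by simp
  qed
  have Ln_le: "norm (Ln (1 - z)) \<le> 2 * norm z" if "norm z \<le> 1 / 4" for z
    using norm_Ln_le[of "- z"] that by simp
  have Msum: "(\<lambda>p. 2 * real d * real p powr (- 2)) summable_on ps"
  proof -
    have "summable (\<lambda>n. real n powr (- 2))" by (subst summable_real_powr_iff) simp
    hence "(\<lambda>n. real n powr (- 2)) summable_on UNIV"
      by (subst summable_on_UNIV_nonneg_real_iff) auto
    hence "(\<lambda>n. 2 * real d * real n powr (- 2)) summable_on UNIV" by (rule summable_on_cmult_right)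
    thus ?thesis by (rule summable_on_subset) auto
  qed
  define lw where "lw = (\<lambda>w p. \<Sum>j=1..d. Ln (1 - fj j p * \<psi> w p * of_nat p powr (- 2)))"
  have lw_bd: "norm (\<Sum>j=1..d. Ln (1 - fj j p * v * of_nat p powr (- s))) \<le> 2 * real d * real p powr (- 2)"
    if "prime p" "Re s = 2" "norm v = 1" for p s v
  proof -
    have "norm (\<Sum>j=1..d. Ln (1 - fj j p * v * of_nat p powr (- s))) \<le> (\<Sum>j=1..d. 2 * real p powr (- 2))"
      using small'[OF that(1,2) _ that(3)] by (intro sum_norm_le order_trans[OF Ln_le]) auto
    thus ?thesis by simp
  qed
  \<comment> \<open>Exponentiating removes the ambiguity of the logarithm of the series. The limit
    of the shifts is taken on both sides of the identity: dominated convergence over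
    \<open>n\<close> on the left, over primes on the right.\<close>
  have on_circle: "\<Phi> w * (\<Prod>j=1..d. 1 - x j * w) = C0" if w: "norm w = 1" for w
  proof -
    have \<psi>1: "norm (\<psi> w p) = 1" for p using w by (simp add: \<psi>_def)
    obtain \<tau> :: "nat \<Rightarrow> real" where conj: "(\<forall>i. \<tau> i \<ge> real i) \<and> (\<forall>n>0. (\<lambda>i. of_nat n powr (- \<i> * of_real (\<tau> i))) \<longlonglongrightarrow> cm_ext (\<psi> w) n)"
      using vertical_shifts_approximate[OF \<psi>1] by (rule exE)
    have \<tau>: "\<And>n. n > 0 \<Longrightarrow> (\<lambda>i. of_nat n powr (- \<i> * of_real (\<tau> i))) \<longlonglongrightarrow> cm_ext (\<psi> w) n"
      using conj by simp
    have "uniform_limit {s. Re s \<ge> 2} (\<lambda>i s. twist_sum f (\<lambda>_. 1) (s + \<i> * of_real (\<tau> i))) (twist_sum f (\<lambda>p. 1 * \<psi> w p)) sequentially"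
      by (rule twist_sum_shift_uniform_limit[OF _ \<psi>1 \<tau>]) auto
    hence "(\<lambda>i. twist_sum f (\<lambda>_. 1) (2 + \<i> * of_real (\<tau> i))) \<longlonglongrightarrow> twist_sum f (\<lambda>p. 1 * \<psi> w p) 2"
      by (rule tendsto_uniform_limitI) auto
    moreover have "twist_sum f (\<lambda>p. 1 * \<psi> w p) 2 = \<Phi> w"
      unfolding twist_sum_def \<Phi>_def by (simp add: \<psi>_eq cm_ext_power)
    ultimately have lim1: "(\<lambda>i. exp (- infsum (l (2 + \<i> * of_real (\<tau> i))) ps)) \<longlonglongrightarrow> \<Phi> w"
      using F_exp[of "2 + \<i> * of_real (\<tau> i)" for i] by simp
    have "(\<lambda>i. infsum (l (2 + \<i> * of_real (\<tau> i))) ps) \<longlonglongrightarrow> infsum (lw w) ps"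
    proof (rule tendsto_infsum[OF _ _ Msum])
      fix p assume "p \<in> ps"
      hence p: "prime p" "p > 0" by (auto simp: ps_def prime_gt_0_nat)
      show "norm (lw w p) \<le> 2 * real d * real p powr (- 2)"
        unfolding lw_def by (rule lw_bd[OF p(1) _ \<psi>1]) simp
      show "norm (l (2 + \<i> * of_real (\<tau> i)) p) \<le> 2 * real d * real p powr (- 2)" for i
        using lw_bd[OF p(1), of "2 + \<i> * of_real (\<tau> i)" 1] by (simp add: l_def)
      have "(\<lambda>i. of_nat p powr (- \<i> * of_real (\<tau> i))) \<longlonglongrightarrow> \<psi> w p"
        using \<tau>[OF p(2)] by (simp add: cm_ext_prime[OF p(1)])
      hence *: "(\<lambda>i. of_nat p powr (- (2 + \<i> * of_real (\<tau> i)))) \<longlonglongrightarrow> \<psi> w p * of_nat p powr (- 2)"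
      proof -
        assume "(\<lambda>i. of_nat p powr (- \<i> * of_real (\<tau> i))) \<longlonglongrightarrow> \<psi> w p"
        hence "(\<lambda>i. of_nat p powr (- \<i> * of_real (\<tau> i)) * of_nat p powr (- 2)) \<longlonglongrightarrow> \<psi> w p * of_nat p powr (- 2)"
          by (intro tendsto_intros)
        moreover have "of_nat p powr (- \<i> * of_real (\<tau> i)) * of_nat p powr (- 2) = (of_nat p powr (- (2 + \<i> * of_real (\<tau> i))) :: complex)" for i
          unfolding powr_add[symmetric] by (simp add: algebra_simps)
        ultimately show ?thesis by simp
      qed
      show "(\<lambda>i. l (2 + \<i> * of_real (\<tau> i)) p) \<longlonglongrightarrow> lw w p"
        unfolding l_def lw_def
      proof (intro tendsto_sum tendsto_Ln tendsto_diff tendsto_const)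
        fix j assume j: "j \<in> {1..d}"
        show "(\<lambda>i. fj j p * of_nat p powr - (2 + \<i> * complex_of_real (\<tau> i))) \<longlonglongrightarrow> fj j p * \<psi> w p * of_nat p powr (- 2)"
          unfolding mult.assoc by (intro tendsto_mult tendsto_const *)
        show "1 - fj j p * \<psi> w p * of_nat p powr (- 2) \<notin> \<real>\<^sub>\<le>\<^sub>0"
        proof
          assume "1 - fj j p * \<psi> w p * of_nat p powr (- 2) \<in> \<real>\<^sub>\<le>\<^sub>0"
          hence "Re (1 - fj j p * \<psi> w p * of_nat p powr (- 2)) \<le> 0" by (simp add: complex_nonpos_Reals_iff)
          moreover have "Re (fj j p * \<psi> w p * of_nat p powr (- 2)) \<le> 1 / 4"
            using small'(2)[OF p(1) _ j \<psi>1[of p], of 2] abs_Re_le_cmod[of "fj j p * \<psi> w p * of_nat p powr (- 2)"] by simp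
          ultimately show False by simp
        qed
      qed
    qed
    hence "(\<lambda>i. exp (- infsum (l (2 + \<i> * of_real (\<tau> i))) ps)) \<longlonglongrightarrow> exp (- infsum (lw w) ps)"
      by (intro tendsto_intros)
    hence "\<Phi> w = exp (- infsum (lw w) ps)" using lim1 LIMSEQ_unique by blast
    also have "infsum (lw w) ps = lw w p0 + infsum \<Lambda> (ps - {p0})"
    proof -
      have s: "lw w summable_on (ps - {p0})"
        by (rule summable_on_subset[of _ ps], rule abs_summable_summable, rule Infinite_Sum.abs_summable_on_comparison_test'[OF Msum])
           (use lw_bd[OF _ _ \<psi>1, of _ 2] in \<open>auto simp: lw_def ps_def\<close>)
      have "insert p0 (ps - {p0}) = ps" using p0 by (auto simp: ps_def)
      hence "infsum (lw w) ps = lw w p0 + infsum (lw w) (ps - {p0})"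
        using infsum_insert[OF s, of p0] by simp
      also have "infsum (lw w) (ps - {p0}) = infsum \<Lambda> (ps - {p0})"
        by (intro infsum_cong) (auto simp: lw_def \<Lambda>_def \<psi>_def)
      finally show ?thesis .
    qed
    also have "exp (- (lw w p0 + infsum \<Lambda> (ps - {p0}))) = exp (- lw w p0) * C0"
      by (simp add: C0_def exp_add[symmetric])
    finally have "\<Phi> w * exp (lw w p0) = C0" by (simp add: exp_minus field_simps)
    moreover have "exp (lw w p0) = (\<Prod>j=1..d. 1 - x j * w)"
    proof -
      have "exp (lw w p0) = (\<Prod>j=1..d. exp (Ln (1 - fj j p0 * w * of_nat p0 powr (- 2))))"
        unfolding lw_def by (subst exp_sum) (auto simp: \<psi>_def)
      also have "\<dots> = (\<Prod>j=1..d. 1 - fj j p0 * w * of_nat p0 powr (- 2))"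
      proof (intro prod.cong refl exp_Ln notI)
        fix j assume j: "j \<in> {1..d}" and "1 - fj j p0 * w * of_nat p0 powr (- 2) = 0"
        hence "fj j p0 * w * of_nat p0 powr (- 2) = 1" by simp
        thus False using small'(2)[OF p0 _ j w, of 2] by simp
      qed
      finally show ?thesis by (simp add: x_def mult_ac)
    qed
    ultimately show ?thesis by simp
  qed
  have term_le: "norm (f n * w ^ add_ext e n * of_nat n powr (- 2)) \<le> M n" if "n \<in> {1..}" "norm w \<le> 1" for n w
    unfolding M_def using that by (intro norm_term_le) (auto simp: norm_power power_le_one)
  have cont: "continuous_on (cball 0 1) \<Phi>" unfolding \<Phi>_def
    by (rule continuous_on_infsum[OF _ _ M]) (use term_le in \<open>auto intro!: continuous_intros\<close>)
  have hol: "\<Phi> holomorphic_on ball 0 1" unfolding \<Phi>_def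
    by (rule holomorphic_on_infsum[OF _ _ _ M]) (use term_le in \<open>auto intro!: holomorphic_intros\<close>)
  \<comment> \<open>The difference vanishes on the circle, so the maximum principle with bound 0
    makes it vanish inside.\<close>
  have in_disc: "\<Phi> w * (\<Prod>j=1..d. 1 - x j * w) = C0" if "w \<in> cball 0 1" for w
  proof -
    have "norm (\<Phi> w * (\<Prod>j=1..d. 1 - x j * w) - C0) \<le> 0"
    proof (rule maximum_modulus_frontier[of "\<lambda>w. \<Phi> w * (\<Prod>j=1..d. 1 - x j * w) - C0" "cball 0 1" 0 w])
      show "(\<lambda>w. \<Phi> w * (\<Prod>j=1..d. 1 - x j * w) - C0) holomorphic_on interior (cball 0 1)"
        using hol by (auto intro!: holomorphic_intros)
      show "continuous_on (closure (cball 0 1)) (\<lambda>w. \<Phi> w * (\<Prod>j=1..d. 1 - x j * w) - C0)"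
        using cont by (auto intro!: continuous_intros)
      show "norm (\<Phi> z * (\<Prod>j=1..d. 1 - x j * z) - C0) \<le> 0" if "z \<in> frontier (cball 0 1)" for z
        using on_circle[of z] that by (simp add: frontier_cball)
    qed (use that in auto)
    thus ?thesis by simp
  qed
  have C0: "C0 \<noteq> 0" by (simp add: C0_def)
  have \<Phi>_eq: "\<Phi> w = C0 / (\<Prod>j=1..d. 1 - x j * w)" if "w \<in> cball 0 1" for w
    using in_disc[OF that] C0 by (metis mult_zero_right nonzero_mult_div_cancel_right)
  define R where "R = (\<Sum>\<^sub>\<infinity>n\<in>{n. n \<ge> 1 \<and> add_ext e n = 0}. f n * of_nat n powr (- 2))"
  have R: "R = C0"
  proof -
    have "\<Phi> 0 = R" unfolding \<Phi>_def R_def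
      by (rule infsum_cong_neutral) (auto simp: power_0_left)
    thus ?thesis using \<Phi>_eq[of 0] by simp
  qed
  \<comment> \<open>A sequence of nonzero points tending to 0; the limit of the difference quotients
    is computed from the closed form and from the series, which identifies the two linear
    coefficients.\<close>
  define w where "w = (\<lambda>i. of_real (1 / real (Suc i)) :: complex)"
  have "(\<lambda>i. 1 / real (Suc i)) \<longlonglongrightarrow> 0"
    using LIMSEQ_inverse_real_of_nat by (simp add: inverse_eq_divide)
  hence "(\<lambda>i. complex_of_real (1 / real (Suc i))) \<longlonglongrightarrow> complex_of_real 0"
    by (rule tendsto_of_real)
  hence w_lim: "w \<longlonglongrightarrow> 0" unfolding w_def of_real_0 .
  have w1: "w i \<noteq> 0" "norm (w i) \<le> 1" for i by (auto simp: w_def norm_divide simp del: of_nat_Suc)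
  have lim_a: "(\<lambda>i. (\<Phi> (w i) - \<Phi> 0) / (w i)) \<longlonglongrightarrow> C0 * (\<Sum>j=1..d. x j)"
  proof -
    have "((\<lambda>w. C0 / (\<Prod>j=1..d. 1 - x j * w)) has_field_derivative C0 * (\<Sum>j=1..d. x j)) (at 0)"
      by (rule derivative_eq_intros DERIV_prod_linear refl | simp)+
    hence "((\<lambda>w. (C0 / (\<Prod>j=1..d. 1 - x j * w) - C0 / (\<Prod>j=1..d. 1 - x j * 0)) / (w - 0)) \<longlongrightarrow> C0 * (\<Sum>j=1..d. x j)) (at 0)"
      unfolding has_field_derivative_iff .
    hence "((\<lambda>i. (C0 / (\<Prod>j=1..d. 1 - x j * w i) - C0 / (\<Prod>j=1..d. 1 - x j * 0)) / (w i - 0)) \<longlonglongrightarrow> C0 * (\<Sum>j=1..d. x j))"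
      by (rule filterlim_compose) (use w_lim w1 in \<open>auto simp: filterlim_at\<close>)
    thus ?thesis using \<Phi>_eq[of "w i" for i] \<Phi>_eq[of 0] w1 by simp
  qed
  define \<Phi>1 where "\<Phi>1 = (\<Sum>\<^sub>\<infinity>n\<in>{n. n \<ge> 1 \<and> add_ext e n = 1}. f n * of_nat n powr (- 2))"
  have lim_b: "(\<lambda>i. (\<Phi> (w i) - \<Phi> 0) / (w i)) \<longlonglongrightarrow> \<Phi>1"
  proof -
    define g where "g = (\<lambda>i n. f n * ((w i ^ add_ext e n - 0 ^ add_ext e n) / w i) * of_nat n powr (- 2))"
    have s: "(\<lambda>n. f n * v ^ add_ext e n * of_nat n powr (- 2)) summable_on {1..}" if "norm v \<le> 1" for v
      by (rule abs_summable_summable, rule Infinite_Sum.abs_summable_on_comparison_test'[OF M]) (use term_le that in auto)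
    have quot: "(w i ^ m - 0 ^ m) / w i = (if m = 0 then 0 else w i ^ (m - 1))" for i m
      using w1(1)[of i] by (cases m) auto
    have "(\<lambda>i. infsum (g i) {1..}) \<longlonglongrightarrow> infsum (\<lambda>n. if add_ext e n = 1 then f n * of_nat n powr (- 2) else 0) {1..}"
    proof (rule tendsto_infsum[OF _ _ M])
      fix n :: nat assume n: "n \<in> {1..}"
      have "norm (f n * 1 * of_nat n powr (- 2)) \<le> M n" unfolding M_def using n by (intro norm_term_le) auto
      thus "norm (if add_ext e n = 1 then f n * of_nat n powr (- 2) else 0) \<le> M n" by (auto simp: M_def)
      show "norm (g i n) \<le> M n" for i
        unfolding g_def M_def quot using n w1(2)[of i] by (intro norm_term_le) (auto simp: norm_power power_le_one)
      have "(\<lambda>i. w i ^ (m - 1)) \<longlonglongrightarrow> (if m = 1 then 1 else 0)" if "m > 0" for m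
      proof (cases "m = 1")
        case False
        have "(\<lambda>i. w i ^ (m - 1)) \<longlonglongrightarrow> 0 ^ (m - 1)" by (intro tendsto_power w_lim)
        thus ?thesis using False that by (simp add: power_0_left)
      qed auto
      hence "(\<lambda>i. if add_ext e n = 0 then 0 else w i ^ (add_ext e n - 1)) \<longlonglongrightarrow> (if add_ext e n = 1 then 1 else 0)"
        by (cases "add_ext e n = 0") auto
      hence "(\<lambda>i. g i n) \<longlonglongrightarrow> f n * (if add_ext e n = 1 then 1 else 0) * of_nat n powr (- 2)"
        unfolding g_def quot by (intro tendsto_intros)
      thus "(\<lambda>i. g i n) \<longlonglongrightarrow> (if add_ext e n = 1 then f n * of_nat n powr (- 2) else 0)"
        by (simp split: if_splits)
    qed
    moreover have "infsum (\<lambda>n. if add_ext e n = 1 then f n * of_nat n powr (- 2) else 0) {1..} = \<Phi>1"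
      unfolding \<Phi>1_def by (rule infsum_cong_neutral) auto
    moreover have "infsum (g i) {1..} = (\<Phi> (w i) - \<Phi> 0) / w i" for i
    proof -
      have "infsum (g i) {1..} = infsum (\<lambda>n. (f n * w i ^ add_ext e n * of_nat n powr (- 2) - f n * 0 ^ add_ext e n * of_nat n powr (- 2)) / w i) {1..}"
        by (rule infsum_cong) (simp add: g_def algebra_simps diff_divide_distrib)
      also have "\<dots> = infsum (\<lambda>n. (f n * w i ^ add_ext e n * of_nat n powr (- 2) - f n * 0 ^ add_ext e n * of_nat n powr (- 2))) {1..} / w i"
        unfolding divide_inverse by (rule infsum_cmult_left')
      also have "infsum (\<lambda>n. (f n * w i ^ add_ext e n * of_nat n powr (- 2) - f n * 0 ^ add_ext e n * of_nat n powr (- 2))) {1..} = \<Phi> (w i) - \<Phi> 0"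
        unfolding \<Phi>_def by (rule infsum_diff[OF s s]) (simp_all add: w1)
      finally show ?thesis .
    qed
    ultimately show ?thesis by simp
  qed
  \<comment> \<open>An integer with exactly one factor \<open>p0\<close> is \<open>p0\<close> times
    one coprime to it; multiplicativity factors out \<open>f p0\<close> and leaves \<open>R\<close>,
    the value at \<open>w = 0\<close>.\<close>
  have "\<Phi>1 = f p0 * of_nat p0 powr (- 2) * R"
  proof -
    have "\<Phi>1 = (\<Sum>\<^sub>\<infinity>n\<in>{n. n \<ge> 1 \<and> add_ext e n = 0}. f (p0 * n) * of_nat (p0 * n) powr (- 2))"
      unfolding \<Phi>1_def
    proof (rule infsum_reindex_bij_witness[of _ "\<lambda>n. p0 * n" "\<lambda>n. n div p0"])
      fix n assume n: "n \<in> {n. 1 \<le> n \<and> add_ext e n = 1}"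
      hence "p0 dvd n" using add_ext_eq_0_iff[of n e] by (auto simp: e_def split: if_splits)
      then obtain m where m: "n = p0 * m" by (auto elim: dvdE)
      have "m \<ge> 1" using n m by (cases m) auto
      moreover have "add_ext e m = 0" using n m \<open>m \<ge> 1\<close> prime_gt_0_nat[OF p0] by (simp add: add_ext_mult add_ext_prime[OF p0] e_def)
      ultimately show "p0 * (n div p0) = n" "n div p0 \<in> {n. 1 \<le> n \<and> add_ext e n = 0}"
        "f (p0 * (n div p0)) * complex_of_nat (p0 * (n div p0)) powr - 2 = f n * complex_of_nat n powr - 2"
        using m prime_gt_0_nat[OF p0] by auto
    next
      fix n assume "n \<in> {n. 1 \<le> n \<and> add_ext e n = 0}"
      thus "p0 * n div p0 = n" "p0 * n \<in> {n. 1 \<le> n \<and> add_ext e n = 1}"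
        using prime_gt_0_nat[OF p0] by (auto simp: add_ext_mult add_ext_prime[OF p0] e_def)
    qed
    also have "\<dots> = (\<Sum>\<^sub>\<infinity>n\<in>{n. n \<ge> 1 \<and> add_ext e n = 0}. f p0 * of_nat p0 powr (- 2) * (f n * of_nat n powr (- 2)))"
    proof (rule infsum_cong)
      fix n assume n: "n \<in> {n. 1 \<le> n \<and> add_ext e n = 0}"
      hence "\<not> p0 dvd n" using add_ext_eq_0_iff[of n e] p0 by (auto simp: e_def)
      hence "coprime p0 n" using p0 prime_imp_coprime by blast
      hence "f (p0 * n) = f p0 * f n" using mult n prime_gt_0_nat[OF p0] by (auto simp: multiplicative_fun_def)
      moreover have "of_nat (p0 * n) powr (- 2) = (of_nat p0 powr (- 2) * of_nat n powr (- 2) :: complex)"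
        using powr_times_real[of "of_nat p0" "of_nat n" "-2"] by simp
      ultimately show "f (p0 * n) * of_nat (p0 * n) powr (- 2) = f p0 * of_nat p0 powr (- 2) * (f n * of_nat n powr (- 2))"
        by simp
    qed
    also have "\<dots> = f p0 * of_nat p0 powr (- 2) * R" unfolding R_def by (rule infsum_cmult_right')
    finally show ?thesis .
  qed
  moreover have "\<Phi>1 = C0 * (\<Sum>j=1..d. x j)" using lim_a lim_b LIMSEQ_unique by blast
  ultimately have "f p0 * of_nat p0 powr (- 2) = (\<Sum>j=1..d. x j)" using R C0 by simp
  also have "\<dots> = (\<Sum>j=1..d. fj j p0) * of_nat p0 powr (- 2)" by (simp add: x_def sum_distrib_right)
  finally have "f p0 = (\<Sum>j=1..d. fj j p0)" using prime_gt_0_nat[OF p0] by simp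
  also have "norm \<dots> \<le> (\<Sum>j=1..d. 1)" by (rule sum_norm_le) (use fj[OF p0] in auto)
  finally show ?thesis by simp
qed

section \<open>Sums over smooth numbers\<close>

text \<open>Summation by parts with a nonincreasing weight: an average bound on \<open>a\<close>
  survives weighting. The partial sums of \<open>C - a\<close> are nonnegative, and the induction
  keeps the boundary term \<open>B V * g V\<close>. At \<open>V = 0\<close> nothing is known about
  \<open>g\<close>, but \<open>B 0 = 0\<close>.\<close>

lemma sum_weighted_le:
  fixes a g :: "nat \<Rightarrow> real"
  assumes A: "\<And>V. (\<Sum>v=1..V. a v) \<le> C * real V" and g: "\<And>v. v \<ge> 1 \<Longrightarrow> g v \<ge> 0"
    and mono: "\<And>v. v \<ge> 1 \<Longrightarrow> g (Suc v) \<le> g v"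
  shows "(\<Sum>v=1..V. a v * g v) \<le> C * (\<Sum>v=1..V. g v)"
proof -
  define B where "B = (\<lambda>V. \<Sum>v=1..V. C - a v)"
  have B: "B V \<ge> 0" for V using A[of V] by (simp add: B_def sum_subtractf mult.commute)
  have "(\<Sum>v=1..V. (C - a v) * g v) \<ge> B V * g V"
  proof (induction V)
    case (Suc V)
    show ?case
    proof (cases "V = 0")
      case False
      have "B (Suc V) * g (Suc V) = B V * g (Suc V) + (C - a (Suc V)) * g (Suc V)"
        by (simp add: B_def algebra_simps)
      also have "B V * g (Suc V) \<le> B V * g V" using False by (intro mult_left_mono mono B) auto
      finally show ?thesis using Suc by simp
    qed (simp add: B_def)
  qed (simp add: B_def)
  moreover have "B V * g V \<ge> 0"
    by (cases "V = 0") (use B g in \<open>auto simp: B_def\<close>)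
  ultimately have "(\<Sum>v=1..V. (C - a v) * g v) \<ge> 0" by linarith
  thus ?thesis by (simp add: left_diff_distrib sum_subtractf sum_distrib_left)
qed

lemma infsum_sum:
  fixes f :: "'a \<Rightarrow> 'b \<Rightarrow> 'c :: {topological_comm_monoid_add, t2_space}"
  assumes "finite A" "\<And>a. a \<in> A \<Longrightarrow> f a summable_on B"
  shows "(\<lambda>x. \<Sum>a\<in>A. f a x) summable_on B" "infsum (\<lambda>x. \<Sum>a\<in>A. f a x) B = (\<Sum>a\<in>A. infsum (f a) B)"
proof -
  have "(\<lambda>x. \<Sum>a\<in>A. f a x) summable_on B \<and> infsum (\<lambda>x. \<Sum>a\<in>A. f a x) B = (\<Sum>a\<in>A. infsum (f a) B)"
    using assms by (induction A rule: finite_induct) (auto simp: infsum_add summable_on_add)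
  thus "(\<lambda>x. \<Sum>a\<in>A. f a x) summable_on B" "infsum (\<lambda>x. \<Sum>a\<in>A. f a x) B = (\<Sum>a\<in>A. infsum (f a) B)" by auto
qed

lemma smooth_over_dvdD: "n \<in> smooth_over P \<Longrightarrow> prime p \<Longrightarrow> p dvd n \<Longrightarrow> p \<in> P"
  and smooth_over_pos: "n \<in> smooth_over P \<Longrightarrow> n \<ge> 1"
  by (auto simp: smooth_over_def)

lemma smooth_over_coprime_power:
  assumes "n \<in> smooth_over P" "prime p" "p \<notin> P"
  shows "coprime (p ^ j) n"
proof -
  have "\<not> p dvd n" using smooth_over_dvdD[OF assms(1,2)] assms(3) by blast
  hence "coprime p n" using assms(2) prime_imp_coprime by blast
  thus ?thesis by simp
qed

lemma inj_on_prime_power_times_smooth: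
  assumes "prime p" "p \<notin> P"
  shows "inj_on (\<lambda>(j, n). p ^ j * n) (J \<times> smooth_over P)"
proof (rule inj_onI, clarify)
  fix j n i m assume *: "n \<in> smooth_over P" "m \<in> smooth_over P" "p ^ j * n = p ^ i * m"
  have mult: "multiplicity p (p ^ j * n) = j" if "n \<in> smooth_over P" for j n
  proof -
    have "\<not> p dvd n" using smooth_over_dvdD[OF that assms(1)] assms(2) by blast
    moreover have "n \<noteq> 0" using smooth_over_pos[OF that] by simp
    ultimately show ?thesis using assms(1) prime_gt_0_nat[OF assms(1)]
      by (subst prime_elem_multiplicity_mult_distrib) (auto simp: not_dvd_imp_multiplicity_0)
  qed
  have "j = i" using mult[OF *(1), of j] mult[OF *(2), of i] *(3) by simp
  thus "j = i \<and> n = m" using *(3) prime_gt_0_nat[OF assms(1)] by simp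
qed

lemma prime_power_times_smooth_image:
  assumes "prime p" "p \<notin> P"
  shows "(\<lambda>(j, n). p ^ j * n) ` ({i..} \<times> smooth_over P) = {n \<in> smooth_over (insert p P). p ^ i dvd n}"
proof safe
  fix j n assume n: "j \<ge> i" "n \<in> smooth_over P"
  show "p ^ j * n \<in> smooth_over (insert p P)"
    unfolding smooth_over_def
  proof safe
    show "1 \<le> p ^ j * n" using smooth_over_pos[OF n(2)] prime_gt_0_nat[OF assms(1)] by (simp add: Suc_le_eq)
    fix r assume r: "prime r" "r dvd p ^ j * n" "r \<notin> P"
    have "\<not> r dvd n" using smooth_over_dvdD[OF n(2) r(1)] r(3) by blast
    hence "r dvd p ^ j" using r by (simp add: prime_dvd_mult_iff)
    hence "r dvd p" by (rule prime_dvd_power[OF r(1)])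
    thus "r = p" using r(1) assms(1) by (simp add: primes_dvd_imp_eq)
  qed
  show "p ^ i dvd p ^ j * n" using n by (simp add: le_imp_power_dvd)
next
  fix n assume n: "n \<in> smooth_over (insert p P)" "p ^ i dvd n"
  have n0: "n \<noteq> 0" using smooth_over_pos[OF n(1)] by simp
  have np: "\<not> is_unit p" using assms(1) by auto
  obtain m where m: "n = p ^ multiplicity p n * m" "\<not> p dvd m"
    using multiplicity_decompose'[OF n0 np] by metis
  have "multiplicity p n \<ge> i" using n(2) n0 np by (intro multiplicity_geI) auto
  moreover have "m \<in> smooth_over P"
    unfolding smooth_over_def
  proof safe
    show "1 \<le> m" using m n0 by (cases m) auto
    fix r assume r: "prime r" "r dvd m"
    hence "r dvd n" using m(1) by (metis dvd_mult)
    hence "r \<in> insert p P" using n(1) r smooth_over_dvdD by blast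
    thus "r \<in> P" using r m(2) by auto
  qed
  ultimately show "n \<in> (\<lambda>(j, n). p ^ j * n) ` ({i..} \<times> smooth_over P)"
    using m(1) by (intro image_eqI[of _ _ "(multiplicity p n, m)"]) auto
qed

section \<open>Finite Euler products with nonnegative terms\<close>

locale nonneg_multiplicative =
  fixes F :: "nat \<Rightarrow> real"
  assumes F_nonneg: "F n \<ge> 0" and F_1: "F 1 = 1"
    and F_mult: "a > 0 \<Longrightarrow> b > 0 \<Longrightarrow> coprime a b \<Longrightarrow> F (a * b) = F a * F b"
begin

text \<open>One Euler factor at a time; starting the exponent at \<open>i\<close> isolates the
  multiples of \<open>p ^ i\<close>. Nonnegativity makes the double sum unconditional.\<close>

lemma has_sum_prime_power_times_smooth:
  assumes p: "prime p" "p \<notin> P" and s: "(\<lambda>j. F (p ^ j)) summable_on {i..}" "F summable_on smooth_over P"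
  shows "(F has_sum (infsum (\<lambda>j. F (p ^ j)) {i..} * infsum F (smooth_over P))) {n \<in> smooth_over (insert p P). p ^ i dvd n}"
proof -
  have eq: "F (p ^ j * n) = F (p ^ j) * F n" if "n \<in> smooth_over P" for j n
    using smooth_over_coprime_power[OF that p, of j] smooth_over_pos[OF that] prime_gt_0_nat[OF p(1)]
    by (intro F_mult) auto
  define h where "h = (\<lambda>(j, n). p ^ j * n)"
  have inner: "((\<lambda>n. (F \<circ> h) (j, n)) has_sum F (p ^ j) * infsum F (smooth_over P)) (smooth_over P)" for j
  proof -
    have "((\<lambda>n. F (p ^ j) * F n) has_sum F (p ^ j) * infsum F (smooth_over P)) (smooth_over P)"
      using s(2) by (intro has_sum_cmult_right has_sum_infsum)
    thus ?thesis by (rule has_sum_cong[THEN iffD1, rotated]) (simp add: h_def eq)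
  qed
  have outer: "((\<lambda>j. F (p ^ j) * infsum F (smooth_over P)) has_sum (infsum (\<lambda>j. F (p ^ j)) {i..} * infsum F (smooth_over P))) {i..}"
    using s(1) by (intro has_sum_cmult_left has_sum_infsum)
  have sum_h: "((F \<circ> h) has_sum (infsum (\<lambda>j. F (p ^ j)) {i..} * infsum F (smooth_over P))) ({i..} \<times> smooth_over P)"
  proof (rule has_sum_SigmaI[OF inner outer])
    show "(F \<circ> h) summable_on {i..} \<times> smooth_over P"
      by (rule summable_on_SigmaI[OF inner]) (use outer F_nonneg in \<open>auto intro: has_sum_imp_summable\<close>)
  qed
  have img: "h ` ({i..} \<times> smooth_over P) = {n \<in> smooth_over (insert p P). p ^ i dvd n}"
    unfolding h_def by (rule prime_power_times_smooth_image[OF p])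
  have inj_h: "inj_on h ({i..} \<times> smooth_over P)"
    unfolding h_def by (rule inj_on_prime_power_times_smooth[OF p])
  show ?thesis unfolding img[symmetric] has_sum_reindex[OF inj_h] by (rule sum_h)
qed

lemma smooth_sum:
  assumes "finite P" "\<And>p. p \<in> P \<Longrightarrow> prime p" "\<And>p. p \<in> P \<Longrightarrow> (\<lambda>j. F (p ^ j)) summable_on {0..}"
  shows "(F has_sum (\<Prod>p\<in>P. infsum (\<lambda>j. F (p ^ j)) {0..})) (smooth_over P)"
  using assms
proof (induction P rule: finite_induct)
  case empty
  have "n = 1" if "n \<in> smooth_over {}" for n
  proof (rule ccontr)
    assume "n \<noteq> 1"
    then obtain p where "prime p" "p dvd n" using prime_factor_nat by blast
    thus False using that by (auto simp: smooth_over_def)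
  qed
  hence "smooth_over {} = {1}" by (auto simp: smooth_over_def)
  thus ?case by (simp add: has_sum_finiteI F_1[simplified])
next
  case (insert p P)
  hence IH: "(F has_sum (\<Prod>p\<in>P. infsum (\<lambda>j. F (p ^ j)) {0..})) (smooth_over P)" by auto
  have "(F has_sum (infsum (\<lambda>j. F (p ^ j)) {0..} * infsum F (smooth_over P))) {n \<in> smooth_over (insert p P). p ^ 0 dvd n}"
    by (rule has_sum_prime_power_times_smooth) (use insert IH has_sum_imp_summable in auto)
  thus ?case using insert.hyps infsumI[OF IH] by simp
qed

lemma smooth_summable:
  assumes "finite P" "\<And>p. p \<in> P \<Longrightarrow> prime p" "\<And>p. p \<in> P \<Longrightarrow> (\<lambda>j. F (p ^ j)) summable_on {0..}"
  shows "F summable_on smooth_over P"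
  using has_sum_imp_summable[OF smooth_sum[OF assms]] .

lemma infsum_smooth_power_dvd_le:
  assumes "finite P" "\<And>p. p \<in> P \<Longrightarrow> prime p" "\<And>p. p \<in> P \<Longrightarrow> (\<lambda>j. F (p ^ j)) summable_on {0..}" and p: "p \<in> P"
  shows "infsum F {n \<in> smooth_over P. p ^ i dvd n} \<le> infsum (\<lambda>j. F (p ^ j)) {i..} * infsum F (smooth_over P)"
proof -
  define P' where "P' = P - {p}"
  have P: "P = insert p P'" "p \<notin> P'" using p by (auto simp: P'_def)
  have s: "F summable_on smooth_over P" "F summable_on smooth_over P'"
    by (rule smooth_summable; use assms in \<open>auto simp: P'_def\<close>)+
  have "infsum F {n \<in> smooth_over P. p ^ i dvd n} = infsum (\<lambda>j. F (p ^ j)) {i..} * infsum F (smooth_over P')"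
    unfolding P(1)
    by (rule infsumI, rule has_sum_prime_power_times_smooth)
       (use P s assms p in \<open>auto intro: summable_on_subset[of _ "{0..}"]\<close>)
  also have "\<dots> \<le> infsum (\<lambda>j. F (p ^ j)) {i..} * infsum F (smooth_over P)"
  proof (rule mult_left_mono)
    show "infsum F (smooth_over P') \<le> infsum F (smooth_over P)"
      by (rule infsum_mono2[OF s(2,1)]) (use P F_nonneg in \<open>auto simp: smooth_over_def\<close>)
  qed (use F_nonneg in \<open>auto intro: infsum_nonneg\<close>)
  finally show ?thesis .
qed

end

lemma summable_on_powr_real:
  assumes "s < -1"
  shows "(\<lambda>n. real n powr s) summable_on A"
proof -
  have "summable (\<lambda>n. real n powr s)" using assms by (simp add: summable_real_powr_iff)
  hence "(\<lambda>n. real n powr s) summable_on UNIV" by (subst summable_on_UNIV_nonneg_real_iff) auto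
  thus ?thesis by (rule summable_on_subset) auto
qed

text \<open>Two of the at least two factors give \<open>p powr (- (3 / 2))\<close>, summable over
  all integers; the remaining ones are dominated by a geometric series with the ratio for the base
  2.\<close>

lemma powr_prime_powers_summable:
  "(\<lambda>(p, j). real (p ^ j) powr (- (3 / 4))) summable_on ({2..} \<times> {2..})"
proof -
  define r where "r = 2 powr (- (3 / 4) :: real)"
  have r: "0 < r" "r < 1" unfolding r_def by (auto intro: powr_less_one)
  define g where "g = (\<lambda>(p, j). real p powr (- (3 / 2)) * r ^ (j - 2))"
  have rj: "(\<lambda>j. r ^ (j - 2)) summable_on {2..}"
  proof -
    have "(\<lambda>j. r ^ j) summable_on UNIV"
      using r by (subst summable_on_UNIV_nonneg_real_iff) (auto intro: summable_geometric)
    thus ?thesis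
      by (subst summable_on_reindex_bij_witness[of _ "\<lambda>j. j + 2" "\<lambda>j. j - 2" UNIV "\<lambda>j. r ^ j"]) auto
  qed
  have "g summable_on ({2..} \<times> {2..})"
  proof (rule summable_on_SigmaI)
    show "((\<lambda>j. g (p, j)) has_sum (real p powr (- (3 / 2)) * infsum (\<lambda>j. r ^ (j - 2)) {2..})) {2..}" for p
      unfolding g_def using rj by (auto intro!: has_sum_cmult_right)
    show "(\<lambda>p. real p powr (- (3 / 2)) * infsum (\<lambda>j. r ^ (j - 2)) {2..}) summable_on {2..}"
      by (intro summable_on_cmult_left summable_on_powr_real) auto
  qed (use r in \<open>auto simp: g_def\<close>)
  moreover have "(\<lambda>(p, j). real (p ^ j) powr (- (3 / 4))) x \<le> g x" if "x \<in> {2..} \<times> {2..}" for x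
  proof -
    obtain p j where x: "x = (p, j)" "p \<ge> 2" "j \<ge> 2" using \<open>x \<in> _\<close> by auto
    have "2 + (j - 2) = j" using x by simp
    hence "real (p ^ j) = real p ^ (2 + (j - 2))" by (simp only: of_nat_power)
    hence "real (p ^ j) = real p ^ 2 * real p ^ (j - 2)" unfolding power_add .
    hence "real (p ^ j) powr (- (3 / 4)) = (real p ^ 2) powr (- (3 / 4)) * (real p ^ (j - 2)) powr (- (3 / 4))"
      using x by (simp add: powr_mult)
    also have "(real p ^ 2) powr (- (3 / 4)) = real p powr (- (3 / 2))"
    proof -
      have "real p ^ 2 = real p powr 2" using x by simp
      thus ?thesis by (simp only: powr_powr) simp
    qed
    also have "(real p ^ (j - 2)) powr (- (3 / 4)) = (real p powr (- (3 / 4))) ^ (j - 2)"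
    proof -
      have "real p > 0" using x by simp
      hence *: "y ^ (j - 2) = y powr real (j - 2)" if "y = real p \<or> y = real p powr (- (3 / 4))" for y
        using that by (intro powr_realpow[symmetric]) auto
      show ?thesis by (simp only: * powr_powr mult.commute refl simp_thms)
    qed
    also have "\<dots> \<le> r ^ (j - 2)"
      unfolding r_def using x by (intro power_mono powr_mono2') auto
    finally show ?thesis using x by (simp add: g_def mult_left_mono)
  qed
  ultimately show ?thesis by (rule summable_on_comparison_test) auto
qed

section \<open>Absolute bounds for the coefficients on smooth numbers\<close>

locale multiplicative_coeffs =
  fixes f :: "nat \<Rightarrow> complex" and C d :: real
  assumes mult: "multiplicative_fun f"
    and mean_sq: "\<And>V. (\<Sum>v=1..V. (norm (f v))\<^sup>2) \<le> C * real V" and C_nonneg: "C \<ge> 0"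
    and prime_le: "\<And>p. prime p \<Longrightarrow> norm (f p) \<le> d"
begin

text \<open>The exponent varies because abscissae slightly below 1 are needed to bound tails;
  everything is controlled down to 15/16.\<close>

definition F :: "real \<Rightarrow> nat \<Rightarrow> real" where
  "F \<theta> n = norm (f n) * real n powr (- \<theta>)"

lemma nonneg_multiplicative_F: "nonneg_multiplicative (F \<theta>)"
proof
  show "F \<theta> (a * b) = F \<theta> a * F \<theta> b" if "a > 0" "b > 0" "coprime a b" for a b
    using mult that by (simp add: F_def multiplicative_fun_def norm_mult powr_mult)
qed (use mult in \<open>auto simp: F_def multiplicative_fun_def\<close>)

sublocale F: nonneg_multiplicative "F \<theta>" for \<theta> by (rule nonneg_multiplicative_F)

lemma F_mono: "\<theta> \<le> \<theta>' \<Longrightarrow> n \<ge> 1 \<Longrightarrow> F \<theta>' n \<le> F \<theta> n"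
  by (auto simp: F_def intro!: mult_left_mono powr_mono)

lemma d_nonneg: "d \<ge> 0"
  using prime_le[OF two_is_prime_nat] norm_ge_zero[of "f 2"] by linarith

lemma sum_squares_over_n_le:
  assumes "V \<ge> 1"
  shows "(\<Sum>v=1..V. (norm (f v))\<^sup>2 / real v) \<le> C * (1 + ln (real V))"
proof -
  have "(\<Sum>v=1..V. (norm (f v))\<^sup>2 * (1 / real v)) \<le> C * (\<Sum>v=1..V. 1 / real v)"
    by (rule sum_weighted_le[OF mean_sq]) (auto simp: field_simps)
  also have "\<dots> \<le> C * (1 + ln (real V))"
    by (intro mult_left_mono sum_inverse_le_ln assms C_nonneg)
  finally show ?thesis by simp
qed

lemma squares_summable: "(\<lambda>n. (norm (f n))\<^sup>2 * real n powr (- (9 / 8))) summable_on {1..}"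
proof (rule nonneg_bdd_above_summable_on)
  show "bdd_above (sum (\<lambda>n. (norm (f n))\<^sup>2 * real n powr (- (9 / 8))) ` {X. X \<subseteq> {1..} \<and> finite X})"
  proof (rule bdd_aboveI2)
    fix X :: "nat set" assume "X \<in> {X. X \<subseteq> {1..} \<and> finite X}"
    hence X: "X \<subseteq> {1..}" "finite X" by auto
    have "X \<subseteq> {1..Max (insert 1 X)}" using X by auto
    hence "(\<Sum>n\<in>X. (norm (f n))\<^sup>2 * real n powr (- (9 / 8))) \<le> (\<Sum>n=1..Max (insert 1 X). (norm (f n))\<^sup>2 * real n powr (- (9 / 8)))"
      by (intro sum_mono2) auto
    also have "\<dots> \<le> C * (\<Sum>n=1..Max (insert 1 X). real n powr (- (9 / 8)))"
      by (rule sum_weighted_le[OF mean_sq]) (auto intro!: powr_mono2')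
    also have "\<dots> \<le> C * infsum (\<lambda>n. real n powr (- (9 / 8))) {1..}"
      by (intro mult_left_mono finite_sum_le_infsum summable_on_powr_real C_nonneg) auto
    finally show "(\<Sum>n\<in>X. (norm (f n))\<^sup>2 * real n powr (- (9 / 8))) \<le> C * infsum (\<lambda>n. real n powr (- (9 / 8))) {1..}" .
  qed
qed auto

definition G :: "nat \<Rightarrow> real" where "G p = infsum (\<lambda>j. F (15 / 16) (p ^ j)) {2..}"

text \<open>The mean square cannot bound first moments below 1 in general, but it does on the sparse
  set of higher prime powers, by the inequality between products and squares.\<close>

lemma prime_powers_summable: "(\<lambda>(p, j). F (15 / 16) (p ^ j)) summable_on ({p. prime p} \<times> {2..})"
proof -
  define h where "h = (\<lambda>(p :: nat, j :: nat). p ^ j)"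
  have inj: "inj_on h ({p. prime p} \<times> {2..})"
    unfolding h_def by (rule inj_onI) (auto simp: prime_power_inj'')
  have "(\<lambda>n. (norm (f n))\<^sup>2 * real n powr (- (9 / 8))) summable_on h ` ({p. prime p} \<times> {2..})"
  proof (rule summable_on_subset[OF squares_summable])
    show "h ` ({p. prime p} \<times> {2..}) \<subseteq> {1..}" by (auto simp: h_def Suc_le_eq prime_gt_0_nat)
  qed
  hence 1: "((\<lambda>n. (norm (f n))\<^sup>2 * real n powr (- (9 / 8))) \<circ> h) summable_on ({p. prime p} \<times> {2..})"
    using summable_on_reindex[OF inj] by blast
  have 2: "(\<lambda>(p, j). real (p ^ j) powr (- (3 / 4))) summable_on ({p. prime p} \<times> {2..})"
    by (rule summable_on_subset[OF powr_prime_powers_summable]) (auto dest: prime_ge_2_nat)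
  have le: "F (15 / 16) n \<le> (norm (f n))\<^sup>2 * real n powr (- (9 / 8)) + real n powr (- (3 / 4))" for n
  proof -
    \<comment> \<open>15/16 = 9/16 + 3/8. Squaring gives exponent 9/8 > 1, enough for the mean
      square, and 3/4, enough for powers \<open>p ^ j\<close> with \<open>j \<ge> 2\<close>.\<close>
    define a where "a = norm (f n) * real n powr (- (9 / 16))"
    define c where "c = real n powr (- (3 / 8))"
    have "F (15 / 16) n = a * c" by (simp add: F_def a_def c_def powr_add[symmetric])
    also have "\<dots> \<le> a\<^sup>2 + c\<^sup>2"
    proof -
      have "a * c \<ge> 0" by (simp add: a_def c_def)
      thus ?thesis using sum_squares_bound[of a c] by linarith
    qed
    also have "a\<^sup>2 = (norm (f n))\<^sup>2 * real n powr (- (9 / 8))"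
      unfolding a_def power_mult_distrib by (simp add: power2_eq_square powr_add[symmetric])
    also have "c\<^sup>2 = real n powr (- (3 / 4))" unfolding c_def by (simp add: power2_eq_square powr_add[symmetric])
    finally show ?thesis .
  qed
  show ?thesis
  proof (rule summable_on_comparison_test[OF summable_on_add[OF 1 2]])
    fix x :: "nat \<times> nat"
    show "(case x of (p, j) \<Rightarrow> F (15 / 16) (p ^ j)) \<le> ((\<lambda>n. (norm (f n))\<^sup>2 * real n powr (- (9 / 8))) \<circ> h) x + (case x of (p, j) \<Rightarrow> real (p ^ j) powr (- (3 / 4)))"
      using le[of "h x"] by (simp add: h_def case_prod_beta')
  qed (auto simp: F.F_nonneg)
qed

lemma F_prime_power_summable:
  assumes "prime p" "\<theta> \<ge> 15 / 16"
  shows "(\<lambda>j. F \<theta> (p ^ j)) summable_on {i..}"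
proof -
  have "(\<lambda>j. (\<lambda>(p, j). F (15 / 16) (p ^ j)) (p, j)) summable_on {2..}"
  proof -
    have "((\<lambda>(p, j). F (15 / 16) (p ^ j)) \<circ> Pair p) summable_on {2..}"
      by (subst summable_on_reindex[symmetric])
         (use assms in \<open>auto simp: inj_on_def intro!: summable_on_subset[OF prime_powers_summable]\<close>)
    thus ?thesis by (simp add: o_def)
  qed
  hence "(\<lambda>j. F (15 / 16) (p ^ j)) summable_on {2..}" by simp
  hence "(\<lambda>j. F (15 / 16) (p ^ j)) summable_on ({2..} \<union> {0, 1})" by (intro summable_on_union) auto
  hence "(\<lambda>j. F (15 / 16) (p ^ j)) summable_on {i..}" by (rule summable_on_subset) auto
  thus ?thesis
    by (rule summable_on_comparison_test)
       (use assms prime_gt_0_nat in \<open>auto simp: F.F_nonneg Suc_le_eq intro!: F_mono\<close>)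
qed

lemma G_summable: "G summable_on {p. prime p}"
proof -
  have "(\<lambda>p. infsum (\<lambda>j. F (15 / 16) (p ^ j)) {2..}) summable_on {p. prime p}"
    using summable_on_Sigma_banach[OF prime_powers_summable] by simp
  thus ?thesis by (simp add: G_def[abs_def])
qed

lemma G_nonneg: "G p \<ge> 0"
  unfolding G_def by (intro infsum_nonneg) (simp add: F.F_nonneg)

lemma G_tail:
  assumes "\<delta> > 0"
  shows "\<exists>q0. \<forall>Q. finite Q \<longrightarrow> (\<forall>p\<in>Q. prime p \<and> p \<ge> q0) \<longrightarrow> (\<Sum>p\<in>Q. G p) \<le> \<delta>"
proof -
  obtain B where B: "finite B" "B \<subseteq> {p. prime p}" "dist (sum G B) (infsum G {p. prime p}) \<le> \<delta>"
    using infsum_finite_approximation[OF G_summable assms] by blast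
  define q0 where "q0 = Suc (Max (insert 0 B))"
  have "(\<Sum>p\<in>Q. G p) \<le> \<delta>" if Q: "finite Q" "\<forall>p\<in>Q. prime p \<and> p \<ge> q0" for Q
  proof -
    have disj: "B \<inter> Q = {}"
    proof safe
      fix x assume "x \<in> B" "x \<in> Q"
      hence "x \<le> Max (insert 0 B)" "x \<ge> q0" using B Q by auto
      thus "x \<in> {}" by (simp add: q0_def)
    qed
    have "sum G B + sum G Q = sum G (B \<union> Q)" using B Q disj by (simp add: sum.union_disjoint)
    also have "\<dots> \<le> infsum G {p. prime p}"
      by (rule finite_sum_le_infsum[OF G_summable]) (use B Q G_nonneg in auto)
    finally show ?thesis using B(3) by (simp add: dist_real_def)
  qed
  thus ?thesis by blast
qed

text \<open>The Euler product over \<open>P\<close> at the extreme abscissa 15/16, a bound for all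
  larger ones. Together with \<open>T0\<close> it depends neither on \<open>Q\<close> nor on the
  abscissa.\<close>

definition K0 :: "nat set \<Rightarrow> real" where "K0 P = (\<Prod>p\<in>P. infsum (\<lambda>j. F (15 / 16) (p ^ j)) {0..})"

definition T0 :: real where "T0 = infsum G {p. prime p}"

lemma F_smooth_summable:
  assumes "finite P" "\<And>p. p \<in> P \<Longrightarrow> prime p" "\<theta> \<ge> 15 / 16"
  shows "F \<theta> summable_on smooth_over P"
  by (rule F.smooth_summable[OF assms(1,2) F_prime_power_summable]) (use assms in auto)

lemma infsum_prime_power_le:
  assumes "prime p" "15 / 16 \<le> \<theta>"
  shows "infsum (\<lambda>j. F \<theta> (p ^ j)) {i..} \<le> infsum (\<lambda>j. F (15 / 16) (p ^ j)) {i..}"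
  by (intro infsum_mono F_prime_power_summable F_mono) (use assms prime_gt_0_nat in \<open>auto simp: Suc_le_eq\<close>)

text \<open>The bound sees \<open>Q\<close> only through the sum of \<open>norm (f p) / p\<close>,
  which is kept bounded while \<open>Q\<close> moves to infinity. Lowering the abscissa to
  \<open>\<theta>\<close> costs the factor \<open>exp 1\<close> in that sum.\<close>

lemma F_smooth_le:
  assumes P: "finite P" "\<And>p. p \<in> P \<Longrightarrow> prime p" and Q: "finite Q" "\<And>p. p \<in> Q \<Longrightarrow> prime p" "P \<inter> Q = {}"
    and \<theta>: "15 / 16 \<le> \<theta>" "\<And>p. p \<in> Q \<Longrightarrow> real p powr (1 - \<theta>) \<le> exp 1"
  shows "infsum (F \<theta>) (smooth_over (P \<union> Q)) \<le> K0 P * exp (exp 1 * (\<Sum>p\<in>Q. norm (f p) / real p) + T0)"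
proof -
  have "infsum (F \<theta>) (smooth_over (P \<union> Q)) = (\<Prod>p\<in>P \<union> Q. infsum (\<lambda>j. F \<theta> (p ^ j)) {0..})"
    by (rule infsumI, rule F.smooth_sum[OF _ _ F_prime_power_summable[OF _ \<theta>(1)]]) (use P Q in auto)
  also have "\<dots> = (\<Prod>p\<in>P. infsum (\<lambda>j. F \<theta> (p ^ j)) {0..}) * (\<Prod>p\<in>Q. infsum (\<lambda>j. F \<theta> (p ^ j)) {0..})"
    using P Q by (intro prod.union_disjoint) auto
  also have "\<dots> \<le> K0 P * (\<Prod>p\<in>Q. exp (exp 1 * (norm (f p) / real p) + G p))"
  proof (rule mult_mono)
    show "(\<Prod>p\<in>P. infsum (\<lambda>j. F \<theta> (p ^ j)) {0..}) \<le> K0 P"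
      unfolding K0_def using P \<theta> by (intro prod_mono conjI infsum_nonneg infsum_prime_power_le) (auto simp: F.F_nonneg)
    show "(\<Prod>p\<in>Q. infsum (\<lambda>j. F \<theta> (p ^ j)) {0..}) \<le> (\<Prod>p\<in>Q. exp (exp 1 * (norm (f p) / real p) + G p))"
    proof (intro prod_mono conjI infsum_nonneg F.F_nonneg)
      fix p assume p: "p \<in> Q"
      have s: "(\<lambda>j. F \<theta> (p ^ j)) summable_on {2..}" using F_prime_power_summable[OF Q(2)[OF p] \<theta>(1)] .
      \<comment> \<open>In the local factor the exponent 0 gives 1, the exponent 1 gives the prime
        sum, and all higher ones are absorbed in \<open>G\<close>.\<close>
      have sets: "{0..} = insert 0 (insert 1 {2 :: nat..})" by auto
      have "infsum (\<lambda>j. F \<theta> (p ^ j)) {0..} = F \<theta> (p ^ 0) + (F \<theta> (p ^ 1) + infsum (\<lambda>j. F \<theta> (p ^ j)) {2..})"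
        unfolding sets using s by (subst infsum_insert; simp add: summable_on_insert_iff infsum_insert)
      also have "\<dots> = 1 + (F \<theta> p + infsum (\<lambda>j. F \<theta> (p ^ j)) {2..})" using F.F_1[of \<theta>] by simp
      also have "F \<theta> p \<le> exp 1 * (norm (f p) / real p)"
      proof -
        have "F \<theta> p = norm (f p) / real p * real p powr (1 - \<theta>)"
          using prime_gt_0_nat[OF Q(2)[OF p]] by (simp add: F_def powr_diff powr_minus_divide)
        also have "\<dots> \<le> norm (f p) / real p * exp 1" by (intro mult_left_mono \<theta>(2) p) auto
        finally show ?thesis by (simp add: mult.commute)
      qed
      also have "infsum (\<lambda>j. F \<theta> (p ^ j)) {2..} \<le> G p"
        unfolding G_def by (rule infsum_prime_power_le[OF Q(2)[OF p] \<theta>(1)])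
      also have "1 + (exp 1 * (norm (f p) / real p) + G p) \<le> exp (exp 1 * (norm (f p) / real p) + G p)"
        by (rule exp_ge_add_one_self)
      finally show "infsum (\<lambda>j. F \<theta> (p ^ j)) {0..} \<le> exp (exp 1 * (norm (f p) / real p) + G p)" by simp
    qed
  qed (auto simp: K0_def F.F_nonneg intro!: prod_nonneg infsum_nonneg)
  also have "(\<Prod>p\<in>Q. exp (exp 1 * (norm (f p) / real p) + G p)) = exp (exp 1 * (\<Sum>p\<in>Q. norm (f p) / real p) + (\<Sum>p\<in>Q. G p))"
    using Q(1) by (simp add: exp_sum[symmetric] sum.distrib sum_distrib_left)
  also have "K0 P * \<dots> \<le> K0 P * exp (exp 1 * (\<Sum>p\<in>Q. norm (f p) / real p) + T0)"
  proof -
    have "(\<Sum>p\<in>Q. G p) \<le> T0" unfolding T0_def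
      by (rule finite_sum_le_infsum[OF G_summable]) (use Q G_nonneg in auto)
    thus ?thesis by (intro mult_left_mono) (auto simp: K0_def F.F_nonneg intro!: prod_nonneg infsum_nonneg)
  qed
  finally show ?thesis .
qed

end

section \<open>Integers with several large prime factors\<close>

lemma smooth_over_primes: "smooth_over P = smooth_over {p \<in> P. prime p}"
  by (auto simp: smooth_over_def)

lemma add_ext_indicator:
  assumes "finite Q" "\<And>p. p \<in> Q \<Longrightarrow> prime p" "n > 0"
  shows "add_ext (\<lambda>p. if p \<in> Q then 1 else 0) n = (\<Sum>p\<in>Q. multiplicity p n)"
proof -
  have "sum_mset (image_mset (\<lambda>p. if p \<in> Q then 1 else 0) M) = (\<Sum>p\<in>Q. count M p)" for M
  proof (induction M)
    case (add x M)
    have "(\<Sum>p\<in>Q. count (add_mset x M) p) = (\<Sum>p\<in>Q. (if p = x then 1 else 0) + count M p)"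
      by (intro sum.cong) auto
    also have "\<dots> = (if x \<in> Q then 1 else 0) + (\<Sum>p\<in>Q. count M p)"
      using assms(1) by (simp add: sum.distrib)
    finally show ?case using add by simp
  qed auto
  thus ?thesis unfolding add_ext_def using assms by (simp add: count_prime_factorization_prime)
qed

text \<open>The product of the primes divides \<open>v\<close> and is at least
  \<open>2 ^ card S\<close>; the factor 2 covers 1 / ln 2.\<close>

lemma card_prime_divisors_le:
  assumes "finite S" "\<And>p. p \<in> S \<Longrightarrow> prime p \<and> p dvd v" "v \<ge> 1"
  shows "real (card S) \<le> 2 * ln (real v)"
proof -
  have "(\<Prod>p\<in>S. p) dvd v"
    using assms(1,2)
  proof (induction S rule: finite_induct)
    case (insert p S)
    have "coprime p (\<Prod>p\<in>S. p)"
      using insert by (intro prod_coprime_right) (auto intro!: primes_coprime)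
    thus ?case using insert by (simp add: divides_mult)
  qed auto
  hence le: "(\<Prod>p\<in>S. p) \<le> v" using assms(3) by (intro dvd_imp_le) auto
  have "2 ^ card S \<le> (\<Prod>p\<in>S. p)"
    using assms(2) prime_ge_2_nat by (subst prod_constant[symmetric], intro prod_mono) auto
  with le have "2 ^ card S \<le> v" by simp
  hence "real (2 ^ card S) \<le> real v" by (simp only: of_nat_le_iff)
  hence "ln (2 ^ card S) \<le> ln (real v)" by (intro ln_mono) auto
  hence "real (card S) * ln 2 \<le> ln (real v)" by (simp add: ln_realpow)
  moreover have "real (card S) * (1 / 2) \<le> real (card S) * ln 2"
    using ln2_ge_two_thirds by (intro mult_left_mono) auto
  ultimately show ?thesis by simp
qed

context multiplicative_coeffs
begin

text \<open>Four sources of error: integers divisible by some \<open>p ^ 2\<close> with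
  \<open>p \<in> Q\<close>, bounded by \<open>G\<close>; then, after writing n = p v, those with v >
  V, bounded by lowering the abscissa to \<open>\<theta>\<close>; the condition that
  \<open>p\<close> does not divide \<open>v\<close>, removed at the cost of few prime divisors; and
  the bilinear sum over q \<le> v \<le> V, bounded by Cauchy-Schwarz and the mean square
  estimate.\<close>

lemma multiple_prime_part_le:
  fixes lam :: real and m k q X V :: nat and A :: int and Q P :: "nat set" and h :: "nat \<Rightarrow> complex" and w :: complex
    and \<sigma> \<theta> B \<delta> :: real
  defines "E \<equiv> \<lambda>n. add_ext (\<lambda>p. if p \<in> Q then 1 else 0) n"
    and "g \<equiv> \<lambda>n. (if [n = m] (mod k) then f n * e2pi (of_real (lam * real n)) else 0) * (cm_ext h n * w ^ add_ext (\<lambda>p. if p \<in> Q then 1 else 0) n) * of_nat n powr (- of_real \<sigma>)"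
    and "K1 \<equiv> K0 P * exp (exp 1 * B + T0)"
  assumes P: "finite P" "\<And>p. p \<in> P \<Longrightarrow> prime p" and mk: "coprime m k"
    and Q: "Q \<subseteq> {q..X}" "\<And>p. p \<in> Q \<Longrightarrow> prime p" "\<And>p. p \<in> Q \<Longrightarrow> [p = m] (mod k)" "P \<inter> Q = {}"
    and q: "q \<ge> 2" "coprime A (int q)" "\<bar>lam - of_int A / real q\<bar> < 1 / (real q)\<^sup>2"
    and B: "(\<Sum>p\<in>Q. norm (f p) / real p) \<le> B"
    and h: "\<And>p. prime p \<Longrightarrow> norm (h p) = 1" and w: "norm w \<le> 1" and \<sigma>: "\<sigma> \<ge> 1"
    and V: "q \<le> V" and \<theta>: "15 / 16 \<le> \<theta>" "\<theta> \<le> 1" "\<And>p. p \<in> Q \<Longrightarrow> real p powr (1 - \<theta>) \<le> exp 1"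
    and \<delta>: "(\<Sum>p\<in>Q. G p) \<le> \<delta>"
  shows "norm (infsum g {n \<in> smooth_over (P \<union> Q). E n \<ge> 2}) \<le>
    \<delta> * K1 + (B * K1 * real V powr (- (1 - \<theta>)) + K1 * (d / real q * (2 * ln (real V)))
     + sqrt (C * (1 + ln (real V))) * sqrt (20 * d * B * (1 + ln (real V)) * (1 + ln (real (X + 1))) / sqrt (real q)))"
proof -
  define N where "N = smooth_over (P \<union> Q)"
  have finQ: "finite Q" using Q(1) finite_subset by blast
  have N1: "n \<ge> 1" if "n \<in> N" for n using that by (auto simp: N_def smooth_over_def)
  have B0: "B \<ge> 0" using B sum_nonneg[of Q "\<lambda>p. norm (f p) / real p"] by auto
  have K0: "K0 P \<ge> 0" by (auto simp: K0_def F.F_nonneg intro!: prod_nonneg infsum_nonneg)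
  hence K1: "K1 \<ge> 0" by (simp add: K1_def)
  have Fsum: "F t summable_on N" if "t \<ge> 15 / 16" for t
    unfolding N_def by (rule F_smooth_summable) (use P Q finQ that in auto)
  have Z: "infsum (F t) N \<le> K1" if t: "\<theta> \<le> t" "t \<le> 1" for t
  proof -
    have "infsum (F t) N \<le> K0 P * exp (exp 1 * (\<Sum>p\<in>Q. norm (f p) / real p) + T0)"
      unfolding N_def
    proof (rule F_smooth_le[OF P finQ Q(2) Q(4)])
      show "15 / 16 \<le> t" using \<theta> t by simp
      fix p assume p: "p \<in> Q"
      have "real p powr (1 - t) \<le> real p powr (1 - \<theta>)"
        using t prime_gt_0_nat[OF Q(2)[OF p]] by (intro powr_mono) auto
      thus "real p powr (1 - t) \<le> exp 1" using \<theta>(3)[OF p] by simp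
    qed
    also have "\<dots> \<le> K1" unfolding K1_def
      using B K0 by (intro mult_left_mono) auto
    finally show ?thesis .
  qed
  have gF: "norm (g n) \<le> F 1 n" if n: "n \<ge> 1" for n
  proof -
    have "norm (g n) \<le> (norm (f n) * 1) * (1 * 1) * real n powr (- \<sigma>)"
      unfolding g_def norm_mult norm_power
      using n w norm_cm_ext_1[of h n, OF h] by (intro mult_mono) (auto simp: norm_mult norm_nat_powr power_le_one simp del: of_real_mult)
    also have "\<dots> \<le> (norm (f n) * 1) * (1 * 1) * real n powr (- 1)"
      using n \<sigma> by (intro mult_left_mono powr_mono) auto
    also have "\<dots> = F 1 n" by (simp add: F_def)
    finally show ?thesis .
  qed
  have Eeq: "E n = (\<Sum>p\<in>Q. multiplicity p n)" if "n \<in> N" for n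
    unfolding E_def using add_ext_indicator[OF finQ Q(2)] N1[OF that] by simp
  have Emult: "E (a * b) = E a + E b" if "a > 0" "b > 0" for a b
    unfolding E_def using that by (rule add_ext_mult)
  have Ep: "E p = 1" if "p \<in> Q" for p using that Q(2)[OF that] by (simp add: E_def add_ext_prime)
  \<comment> \<open>Free of squares of primes from \<open>Q\<close> only; arbitrary powers of primes
    in \<open>P\<close> remain allowed.\<close>
  define sqf where "sqf = (\<lambda>n. \<forall>p\<in>Q. \<not> p ^ 2 dvd n)"
  define NS where "NS = {n \<in> N. E n \<ge> 2 \<and> \<not> sqf n}"
  define SQ where "SQ = {n \<in> N. E n \<ge> 2 \<and> sqf n}"
  define Vs where "Vs = {n \<in> N. E n \<ge> 1 \<and> sqf n}"
  have g_sum: "g summable_on S" if "S \<subseteq> N" for S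
  proof (rule abs_summable_summable, rule Infinite_Sum.abs_summable_on_comparison_test')
    show "F 1 summable_on S" using that by (intro summable_on_subset[OF Fsum]) auto
    show "norm (g n) \<le> F 1 n" if "n \<in> S" for n using that \<open>S \<subseteq> N\<close> by (intro gF N1) auto
  qed
  have norm_le: "norm (infsum u S) \<le> infsum U S"
    if "U summable_on S" "\<And>n. n \<in> S \<Longrightarrow> norm (u n) \<le> U n" for u :: "nat \<Rightarrow> complex" and U S
  proof -
    have abs: "(\<lambda>n. norm (u n)) summable_on S" by (rule Infinite_Sum.abs_summable_on_comparison_test'[OF that])
    show ?thesis using norm_infsum_bound[OF abs] infsum_mono[OF abs that] by linarith
  qed

  have NS_le: "norm (infsum g NS) \<le> \<delta> * K1"
  proof -
    have "norm (infsum g NS) \<le> infsum (F 1) NS"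
      by (rule norm_le) (auto simp: NS_def intro: gF N1 summable_on_subset[OF Fsum])
    \<comment> \<open>Union bound over the primes whose square divides \<open>n\<close>; no
      cancellation is used.\<close>
    also have "\<dots> \<le> infsum (\<lambda>n. \<Sum>p\<in>Q. if p ^ 2 dvd n then F 1 n else 0) N"
    proof (rule infsum_mono_neutral)
      have s: "(\<lambda>n. if p ^ 2 dvd n then F 1 n else 0) summable_on N" for p
        by (rule summable_on_comparison_test[OF Fsum[of 1]]) (auto simp: F.F_nonneg)
      show "(\<lambda>n. \<Sum>p\<in>Q. if p ^ 2 dvd n then F 1 n else 0) summable_on N"
        by (rule infsum_sum(1)[OF finQ s])
      show "F 1 n \<le> (\<Sum>p\<in>Q. if p ^ 2 dvd n then F 1 n else 0)" if "n \<in> NS \<inter> N" for n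
      proof -
        obtain p where p: "p \<in> Q" "p ^ 2 dvd n" using \<open>n \<in> NS \<inter> N\<close> by (auto simp: NS_def sqf_def)
        have "(if p ^ 2 dvd n then F 1 n else 0) \<le> (\<Sum>p\<in>Q. if p ^ 2 dvd n then F 1 n else 0)"
          by (rule member_le_sum[OF p(1) _ finQ]) (auto simp: F.F_nonneg)
        thus ?thesis using p by simp
      qed
      show "F 1 summable_on NS" by (rule summable_on_subset[OF Fsum]) (auto simp: NS_def)
    qed (auto simp: NS_def F.F_nonneg intro!: sum_nonneg)
    also have "\<dots> = (\<Sum>p\<in>Q. infsum (\<lambda>n. if p ^ 2 dvd n then F 1 n else 0) N)"
      by (rule infsum_sum(2)[OF finQ]) (rule summable_on_comparison_test[OF Fsum[of 1]], auto simp: F.F_nonneg)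
    also have "\<dots> \<le> (\<Sum>p\<in>Q. G p * K1)"
    proof (rule sum_mono)
      fix p assume p: "p \<in> Q"
      have "infsum (\<lambda>n. if p ^ 2 dvd n then F 1 n else 0) N = infsum (F 1) {n \<in> smooth_over (P \<union> Q). p ^ 2 dvd n}"
        by (rule infsum_cong_neutral) (auto simp: N_def)
      also have "\<dots> \<le> infsum (\<lambda>j. F 1 (p ^ j)) {2..} * infsum (F 1) (smooth_over (P \<union> Q))"
        by (rule F.infsum_smooth_power_dvd_le[OF _ _ F_prime_power_summable]) (use P Q finQ p in auto)
      also have "\<dots> \<le> G p * K1"
        unfolding G_def using Z[of 1] \<theta> Q(2)[OF p]
        by (intro mult_mono infsum_prime_power_le infsum_nonneg) (auto simp: F.F_nonneg N_def)
      finally show "infsum (\<lambda>n. if p ^ 2 dvd n then F 1 n else 0) N \<le> G p * K1" .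
    qed
    also have "\<dots> \<le> \<delta> * K1" using \<delta> K1 by (simp add: sum_distrib_right[symmetric] mult_right_mono)
    finally show ?thesis .
  qed

  define \<gamma> where "\<gamma> = (\<lambda>p. f p * h p * of_nat p powr (- of_real \<sigma>))"
  define Xs where "Xs = (\<lambda>v. \<Sum>p\<in>Q. \<gamma> p * e2pi (of_real (lam * real (v * p))))"
  \<comment> \<open>The sum that actually arises carries the condition that \<open>p\<close> does
    not divide \<open>v\<close>; the mean square estimate applies to the unrestricted
    \<open>Xs\<close>.\<close>
  define Xr where "Xr = (\<lambda>v. \<Sum>p\<in>{p \<in> Q. \<not> p dvd v}. \<gamma> p * e2pi (of_real (lam * real (v * p))))"
  have \<gamma>_le: "norm (\<gamma> p) \<le> norm (f p) / real p" if p: "p \<in> Q" for p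
  proof -
    have pos: "p > 0" using Q(2)[OF p] prime_gt_0_nat by blast
    have "norm (\<gamma> p) = norm (f p) * real p powr (- \<sigma>)"
      using h[OF Q(2)[OF p]] pos by (simp add: \<gamma>_def norm_mult norm_nat_powr)
    also have "\<dots> \<le> norm (f p) * real p powr (- 1)" using pos \<sigma> by (intro mult_left_mono powr_mono) auto
    also have "\<dots> = norm (f p) / real p" using pos by (simp add: powr_minus_divide)
    finally show ?thesis .
  qed
  have \<gamma>_sum: "(\<Sum>p\<in>Q. norm (\<gamma> p)) \<le> B" using sum_mono[OF \<gamma>_le] B by (rule order_trans)
  have \<gamma>_d: "norm (\<gamma> p) \<le> d / real p" if p: "p \<in> Q" for p
    using \<gamma>_le[OF p] prime_le[OF Q(2)[OF p]] by (meson divide_right_mono of_nat_0_le_iff order_trans)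
  have \<gamma>_q: "norm (\<gamma> p) \<le> d / real q" if p: "p \<in> Q" for p
  proof -
    have "d / real p \<le> d / real q" using p Q(1) q d_nonneg by (intro divide_left_mono mult_pos_pos) auto
    thus ?thesis using \<gamma>_d[OF p] by simp
  qed
  have Xr_B: "norm (Xr v) \<le> B" for v
  proof -
    have "norm (Xr v) \<le> (\<Sum>p\<in>{p \<in> Q. \<not> p dvd v}. norm (\<gamma> p))"
      unfolding Xr_def by (rule sum_norm_le) (simp add: norm_mult del: of_real_mult)
    also have "\<dots> \<le> (\<Sum>p\<in>Q. norm (\<gamma> p))" using finQ by (intro sum_mono2) auto
    finally show ?thesis using \<gamma>_sum by simp
  qed
  have Xr_Xs: "norm (Xr v) \<le> norm (Xs v) + d / real q * (2 * ln (real V))" if v: "1 \<le> v" "v \<le> V" for v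
  proof -
    define D where "D = {p \<in> Q. p dvd v}"
    have "Xs v = Xr v + (\<Sum>p\<in>D. \<gamma> p * e2pi (of_real (lam * real (v * p))))"
      unfolding Xs_def Xr_def D_def using finQ
      by (subst sum.union_disjoint[symmetric]) (auto intro!: sum.cong)
    hence "norm (Xr v) \<le> norm (Xs v) + norm (\<Sum>p\<in>D. \<gamma> p * e2pi (of_real (lam * real (v * p))))"
      by (metis add_diff_cancel_right' norm_triangle_ineq4)
    also have "norm (\<Sum>p\<in>D. \<gamma> p * e2pi (of_real (lam * real (v * p)))) \<le> (\<Sum>p\<in>D. d / real q)"
      by (rule sum_norm_le) (use \<gamma>_q in \<open>auto simp: norm_mult D_def simp del: of_real_mult\<close>)
    also have "\<dots> = d / real q * real (card D)" by simp
    also have "\<dots> \<le> d / real q * (2 * ln (real V))"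
    proof (rule mult_left_mono)
      have "real (card D) \<le> 2 * ln (real v)"
        by (rule card_prime_divisors_le) (use finQ Q(2) v in \<open>auto simp: D_def\<close>)
      also have "\<dots> \<le> 2 * ln (real V)" using v by simp
      finally show "real (card D) \<le> 2 * ln (real V)" .
    qed (use d_nonneg in auto)
    finally show ?thesis by simp
  qed

  have g_mult: "g (p * v) =
      (if [v = 1] (mod k) then f v * cm_ext h v * w ^ (E v + 1) * of_nat v powr (- of_real \<sigma>) else 0) * (\<gamma> p * e2pi (of_real (lam * real (v * p))))"
    if p: "p \<in> Q" "\<not> p dvd v" and v: "v \<in> N" for p v
  proof -
    have pos: "p > 0" "v > 0" using Q(2)[OF p(1)] prime_gt_0_nat N1[OF v] by auto
    have "coprime p v" using p Q(2) prime_imp_coprime by blast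
    hence 1: "f (p * v) = f p * f v" using mult pos by (simp add: multiplicative_fun_def)
    have 2: "cm_ext h (p * v) = h p * cm_ext h v" using pos Q(2)[OF p(1)] by (simp add: cm_ext_mult cm_ext_prime)
    have 3: "add_ext (\<lambda>p. if p \<in> Q then 1 else 0) (p * v) = E v + 1" using Emult[OF pos] Ep[OF p(1)] by (simp add: E_def)
    have 4: "of_nat (p * v) powr (- of_real \<sigma>) = (of_nat p powr (- of_real \<sigma>) * of_nat v powr (- of_real \<sigma>) :: complex)"
      using powr_times_real[of "of_nat p" "of_nat v" "- of_real \<sigma>"] by simp
    \<comment> \<open>Since the primes of \<open>Q\<close> are congruent to \<open>m\<close>, the
      condition on \<open>p * v\<close> becomes one on \<open>v\<close> alone; the variables
      separate.\<close>
    have 5: "[p * v = m] (mod k) \<longleftrightarrow> [v = 1] (mod k)"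
    proof -
      have pm: "[p * v = m * v] (mod k)" using Q(3)[OF p(1)] by (intro cong_mult cong_refl)
      have "[p * v = m] (mod k) \<longleftrightarrow> [m * v = m * 1] (mod k)" using pm by (metis cong_sym cong_trans mult.right_neutral)
      also have "\<dots> \<longleftrightarrow> [v = 1] (mod k)" using mk by (rule cong_mult_lcancel_nat)
      finally show ?thesis .
    qed
    show ?thesis unfolding g_def 1 2 3 4 5 \<gamma>_def by (simp add: mult_ac)
  qed

  have norm_part: "norm (if [v = 1] (mod k) then f v * cm_ext h v * w ^ (E v + 1) * of_nat v powr (- of_real \<sigma>) else 0) \<le> F 1 v"
    if v: "v \<in> N" for v
  proof -
    have "norm (f v * cm_ext h v * w ^ (E v + 1) * of_nat v powr (- of_real \<sigma>)) = norm (f v) * norm (w ^ (E v + 1)) * real v powr (- \<sigma>)"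
      using norm_cm_ext_1[of h v, OF h] N1[OF v] by (simp add: norm_mult norm_nat_powr)
    also have "\<dots> \<le> norm (f v) * 1 * real v powr (- 1)"
      using w \<sigma> N1[OF v] by (intro mult_mono powr_mono mult_nonneg_nonneg) (auto simp: norm_power power_le_one simp del: power_Suc)
    finally show ?thesis using F.F_nonneg[of 1 v] by (simp add: F_def)
  qed
  have norm_div_le: "norm (z / of_nat (j + 1)) \<le> norm z" for z :: complex and j :: nat
  proof -
    have "norm (z / of_nat (j + 1)) = norm z / real (j + 1)" by (simp add: norm_divide del: of_nat_Suc of_nat_add)
    also have "\<dots> \<le> norm z / 1" by (intro divide_left_mono) auto
    finally show ?thesis by simp
  qed

  \<comment> \<open>Each \<open>n\<close> is written as \<open>p * v\<close> in exactly
    \<open>E n\<close> ways, one for each of its primes from \<open>Q\<close>. The weight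
    compensating this is \<open>1 / (E v + 1)\<close>, which depends on \<open>v\<close> only, so
    the sum over \<open>p\<close> stays free.\<close>
  have SQ_eq: "infsum g SQ = infsum (\<lambda>v. \<Sum>p\<in>Q. if p dvd v then 0 else g (p * v) / of_nat (E v + 1)) Vs"
  proof -
    have card_E: "(\<Sum>p\<in>Q. if p dvd n then 1 else 0) = E n" if n: "n \<in> N" "sqf n" for n
      unfolding Eeq[OF n(1)]
    proof (rule sum.cong[OF refl])
      fix p assume p: "p \<in> Q"
      have "\<not> p ^ 2 dvd n" using n(2) p by (auto simp: sqf_def)
      moreover have "n \<noteq> 0" "\<not> is_unit p" using N1[OF n(1)] Q(2)[OF p] by auto
      ultimately have "multiplicity p n < 2" using multiplicity_dvd'[of 2 p n] by (meson not_le)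
      moreover have "p dvd n \<longleftrightarrow> multiplicity p n \<ge> 1"
        using multiplicity_eq_zero_iff[OF \<open>n \<noteq> 0\<close> \<open>\<not> is_unit p\<close>] by linarith
      ultimately show "(if p dvd n then 1 else 0) = multiplicity p n" by auto
    qed
    have "infsum g SQ = infsum (\<lambda>n. \<Sum>p\<in>Q. if p dvd n then g n / of_nat (E n) else 0) SQ"
    proof (rule infsum_cong)
      fix n assume n: "n \<in> SQ"
      hence En: "E n \<noteq> 0" by (auto simp: SQ_def)
      have "(\<Sum>p\<in>Q. if p dvd n then g n / of_nat (E n) else 0) = (\<Sum>p\<in>Q. (g n / of_nat (E n)) * of_nat (if p dvd n then 1 else 0))"
        by (intro sum.cong) auto
      also have "\<dots> = (g n / of_nat (E n)) * of_nat (E n)"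
        using card_E[of n] n by (simp only: sum_distrib_left[symmetric] of_nat_sum[symmetric] SQ_def mem_Collect_eq)
      finally show "g n = (\<Sum>p\<in>Q. if p dvd n then g n / of_nat (E n) else 0)" using En by simp
    qed
    also have "\<dots> = (\<Sum>p\<in>Q. infsum (\<lambda>n. if p dvd n then g n / of_nat (E n) else 0) SQ)"
    proof (rule infsum_sum(2)[OF finQ])
      fix p
      show "(\<lambda>n. if p dvd n then g n / of_nat (E n) else 0) summable_on SQ"
      proof (rule abs_summable_summable, rule Infinite_Sum.abs_summable_on_comparison_test')
        show "F 1 summable_on SQ" by (rule summable_on_subset[OF Fsum]) (auto simp: SQ_def)
        fix n assume n: "n \<in> SQ"
        have "norm (g n / of_nat (E n)) \<le> norm (g n)"
          using n norm_div_le[of "g n" "E n - 1"] by (simp add: SQ_def)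
        also have "\<dots> \<le> F 1 n" using n by (intro gF N1) (auto simp: SQ_def)
        finally show "norm (if p dvd n then g n / of_nat (E n) else 0) \<le> F 1 n" by (simp add: F.F_nonneg)
      qed
    qed
    also have "\<dots> = (\<Sum>p\<in>Q. infsum (\<lambda>v. if p dvd v then 0 else g (p * v) / of_nat (E v + 1)) Vs)"
    proof (rule sum.cong[OF refl])
      fix p assume p: "p \<in> Q"
      have pp: "prime p" "p > 0" using Q(2)[OF p] prime_gt_0_nat by auto
      have "infsum (\<lambda>n. if p dvd n then g n / of_nat (E n) else 0) SQ = infsum (\<lambda>n. g n / of_nat (E n)) {n \<in> SQ. p dvd n}"
        by (rule infsum_cong_neutral) auto
      also have "\<dots> = infsum (\<lambda>v. g (p * v) / of_nat (E v + 1)) {v \<in> Vs. \<not> p dvd v}"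
      proof (rule infsum_reindex_bij_witness[of _ "\<lambda>v. p * v" "\<lambda>n. n div p"])
        fix n assume n: "n \<in> {n \<in> SQ. p dvd n}"
        then obtain v where v: "n = p * v" by (auto elim: dvdE)
        have nN: "n \<in> N" "E n \<ge> 2" "sqf n" using n by (auto simp: SQ_def)
        have v0: "v > 0" using N1[OF nN(1)] v by (cases v) auto
        have E: "E n = E v + 1" using Emult[OF pp(2) v0] Ep[OF p] v by simp
        have vN: "v \<in> N" unfolding N_def smooth_over_def
          using v0 nN(1) v by (auto simp: N_def smooth_over_def)
        have vs: "sqf v" using nN(3) unfolding sqf_def v by (meson dvd_mult)
        have vp: "\<not> p dvd v"
        proof
          assume "p dvd v"
          hence "p ^ 2 dvd n" unfolding v power2_eq_square by (intro mult_dvd_mono) auto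
          thus False using nN(3) p by (auto simp: sqf_def)
        qed
        have nv: "n div p = v" using v pp by simp
        show "p * (n div p) = n" using nv v by simp
        show "n div p \<in> {v \<in> Vs. \<not> p dvd v}" using nv vN vs vp nN(2) E by (simp add: Vs_def)
        show "g (p * (n div p)) / of_nat (E (n div p) + 1) = g n / of_nat (E n)" by (simp only: nv E v[symmetric])
      next
        fix v assume v: "v \<in> {v \<in> Vs. \<not> p dvd v}"
        have vN: "v \<in> N" "E v \<ge> 1" "sqf v" "\<not> p dvd v" using v by (auto simp: Vs_def)
        have v0: "v > 0" using N1[OF vN(1)] by simp
        show "p * v div p = v" using pp by simp
        have "p * v \<in> N" unfolding N_def smooth_over_def
        proof safe
          show "1 \<le> p * v" using v0 pp by (simp add: Suc_le_eq)
          fix r assume r: "prime r" "r dvd p * v" "r \<notin> Q"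
          hence "r dvd p \<or> r dvd v" by (simp add: prime_dvd_mult_iff)
          thus "r \<in> P"
          proof
            assume "r dvd p"
            hence "r = p" using r(1) pp(1) primes_dvd_imp_eq by blast
            thus ?thesis using r(3) p by simp
          next
            assume "r dvd v"
            thus ?thesis using smooth_over_dvdD[OF vN(1)[unfolded N_def] r(1)] r(3) by blast
          qed
        qed
        moreover have "E (p * v) \<ge> 2" using Emult[OF pp(2) v0] Ep[OF p] vN(2) by simp
        moreover have "sqf (p * v)" unfolding sqf_def
        proof safe
          fix r assume r: "r \<in> Q" "r ^ 2 dvd p * v"
          show False
          proof (cases "r = p")
            case True
            hence "p dvd v" using r(2) pp(2) by (simp add: power2_eq_square)
            thus False using vN(4) by simp
          next
            case False
            hence "coprime (r ^ 2) p" using primes_coprime[OF Q(2)[OF r(1)] pp(1)] by simp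
            hence "r ^ 2 dvd v" using r(2) by (simp add: coprime_dvd_mult_right_iff)
            thus False using vN(3) r(1) by (auto simp: sqf_def)
          qed
        qed
        ultimately show "p * v \<in> {n \<in> SQ. p dvd n}" by (simp add: SQ_def)
      qed
      also have "\<dots> = infsum (\<lambda>v. if p dvd v then 0 else g (p * v) / of_nat (E v + 1)) Vs"
        by (rule infsum_cong_neutral) auto
      finally show "infsum (\<lambda>n. if p dvd n then g n / of_nat (E n) else 0) SQ = infsum (\<lambda>v. if p dvd v then 0 else g (p * v) / of_nat (E v + 1)) Vs" .
    qed
    also have "\<dots> = infsum (\<lambda>v. \<Sum>p\<in>Q. if p dvd v then 0 else g (p * v) / of_nat (E v + 1)) Vs"
    proof (rule infsum_sum(2)[OF finQ, symmetric])
      fix p assume p: "p \<in> Q"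
      show "(\<lambda>v. if p dvd v then 0 else g (p * v) / of_nat (E v + 1)) summable_on Vs"
      proof (rule abs_summable_summable, rule Infinite_Sum.abs_summable_on_comparison_test')
        show "(\<lambda>v. F 1 v * norm (\<gamma> p)) summable_on Vs"
          by (rule summable_on_cmult_left, rule summable_on_subset[OF Fsum]) (auto simp: Vs_def)
        fix v assume v: "v \<in> Vs"
        hence vN: "v \<in> N" by (auto simp: Vs_def)
        show "norm (if p dvd v then 0 else g (p * v) / of_nat (E v + 1)) \<le> F 1 v * norm (\<gamma> p)"
        proof (cases "p dvd v")
          case False
          have "norm (g (p * v)) \<le> F 1 v * norm (\<gamma> p)"
            unfolding g_mult[OF p False vN] norm_mult
            by (rule mult_mono) (use norm_part[OF vN] F.F_nonneg in \<open>auto simp del: of_real_mult\<close>)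
          moreover have "norm (g (p * v) / of_nat (E v + 1)) \<le> norm (g (p * v))"
            by (rule norm_div_le)
          ultimately show ?thesis using False by simp
        qed (auto simp: F.F_nonneg)
      qed
    qed
    finally show ?thesis .
  qed

  \<comment> \<open>The part that needs oscillation, restricted to a finite range of
    \<open>v\<close>.\<close>
  define M where "M = (\<lambda>v. F 1 v * (if v \<in> {q..V} then norm (Xs v) else 0))"
  have SQ_le: "norm (infsum g SQ) \<le> infsum (\<lambda>v. (M v + d / real q * (2 * ln (real V)) * F 1 v) + B * real V powr (- (1 - \<theta>)) * F \<theta> v) N"
  proof -
    have Ms: "M summable_on N"
    proof (rule finite_nonzero_values_imp_summable_on)
      show "finite {x \<in> N. M x \<noteq> 0}" by (rule finite_subset[of _ "{q..V}"]) (auto simp: M_def split: if_splits)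
    qed
    have Us: "(\<lambda>v. (M v + d / real q * (2 * ln (real V)) * F 1 v) + B * real V powr (- (1 - \<theta>)) * F \<theta> v) summable_on N"
      by (intro summable_on_add summable_on_cmult_right Ms Fsum) (use \<theta> in auto)
    have U0: "0 \<le> (M v + d / real q * (2 * ln (real V)) * F 1 v) + B * real V powr (- (1 - \<theta>)) * F \<theta> v" for v
      using V q B0 d_nonneg by (intro add_nonneg_nonneg mult_nonneg_nonneg) (auto simp: M_def F.F_nonneg)
    have le: "norm (\<Sum>p\<in>Q. if p dvd v then 0 else g (p * v) / of_nat (E v + 1)) \<le>
      (M v + d / real q * (2 * ln (real V)) * F 1 v) + B * real V powr (- (1 - \<theta>)) * F \<theta> v" if v: "v \<in> Vs" for v
    proof -
      have vN: "v \<in> N" "E v \<ge> 1" using v by (auto simp: Vs_def)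
      have v1: "v \<ge> 1" using N1[OF vN(1)] .
      obtain c where c: "norm c \<le> F 1 v" "\<And>p. p \<in> Q \<Longrightarrow> \<not> p dvd v \<Longrightarrow> g (p * v) = c * (\<gamma> p * e2pi (of_real (lam * real (v * p))))"
        using norm_part[OF vN(1)] g_mult[OF _ _ vN(1)] by blast
      have "(\<Sum>p\<in>Q. if p dvd v then 0 else g (p * v) / of_nat (E v + 1)) = (\<Sum>p\<in>{p \<in> Q. \<not> p dvd v}. g (p * v) / of_nat (E v + 1))"
        using finQ by (intro sum.mono_neutral_cong_right) auto
      also have "\<dots> = (\<Sum>p\<in>{p \<in> Q. \<not> p dvd v}. c * (\<gamma> p * e2pi (of_real (lam * real (v * p)))) / of_nat (E v + 1))"
        by (intro sum.cong refl) (use c(2) in auto)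
      also have "\<dots> = c * Xr v / of_nat (E v + 1)" by (simp add: Xr_def sum_distrib_left sum_divide_distrib)
      also have "norm \<dots> \<le> norm (c * Xr v)" by (rule norm_div_le)
      also have "\<dots> \<le> F 1 v * norm (Xr v)" unfolding norm_mult by (intro mult_right_mono c) auto
      also have "\<dots> \<le> (M v + d / real q * (2 * ln (real V)) * F 1 v) + B * real V powr (- (1 - \<theta>)) * F \<theta> v"
      proof (cases "v \<le> V")
        case True
        \<comment> \<open>As \<open>n\<close> had at least two primes from \<open>Q\<close>,
          \<open>v\<close> still contains one, and all of them are at least
          \<open>q\<close>.\<close>
        have "q \<le> v"
        proof -
          have "add_ext (\<lambda>p. if p \<in> Q then 1 else 0) v \<noteq> 0" using vN(2) by (simp add: E_def)
          then obtain p where p: "prime p" "p dvd v" "p \<in> Q" using add_ext_eq_0_iff[of v] v1 by (auto split: if_splits)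
          have "q \<le> p" using p(3) Q(1) by auto
          also have "p \<le> v" using p(2) v1 by (intro dvd_imp_le) auto
          finally show ?thesis .
        qed
        have "F 1 v * norm (Xr v) \<le> F 1 v * (norm (Xs v) + d / real q * (2 * ln (real V)))"
          by (intro mult_left_mono Xr_Xs v1 True F.F_nonneg)
        also have "\<dots> = M v + d / real q * (2 * ln (real V)) * F 1 v"
          using True \<open>q \<le> v\<close> by (simp add: M_def algebra_simps)
        also have "\<dots> \<le> (M v + d / real q * (2 * ln (real V)) * F 1 v) + B * real V powr (- (1 - \<theta>)) * F \<theta> v"
          using B0 by (simp add: F.F_nonneg)
        finally show ?thesis .
      next
        case False
        \<comment> \<open>Rankin's device: for v > V the surplus exponent
          \<open>1 - \<theta>\<close> is traded for a power of \<open>V\<close>.\<close>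
        have "real v powr (- \<theta>) * real v powr (- (1 - \<theta>)) = real v powr (- 1)"
          unfolding powr_add[symmetric] by simp
        hence "F 1 v = F \<theta> v * real v powr (- (1 - \<theta>))" by (simp only: F_def mult.assoc)
        also have "\<dots> \<le> F \<theta> v * real V powr (- (1 - \<theta>))"
          using False V q \<theta> by (intro mult_left_mono powr_mono2' F.F_nonneg) auto
        finally have "F 1 v * norm (Xr v) \<le> F \<theta> v * real V powr (- (1 - \<theta>)) * B"
          by (intro mult_mono Xr_B) (auto simp: F.F_nonneg)
        moreover have "0 \<le> M v + d / real q * (2 * ln (real V)) * F 1 v"
          using V q d_nonneg by (intro add_nonneg_nonneg mult_nonneg_nonneg) (auto simp: M_def F.F_nonneg)
        ultimately show ?thesis by (simp add: mult_ac)
      qed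
      finally show ?thesis .
    qed
    have UVs: "(\<lambda>v. (M v + d / real q * (2 * ln (real V)) * F 1 v) + B * real V powr (- (1 - \<theta>)) * F \<theta> v) summable_on Vs"
      by (rule summable_on_subset[OF Us]) (auto simp: Vs_def)
    have "norm (infsum g SQ) \<le> infsum (\<lambda>v. (M v + d / real q * (2 * ln (real V)) * F 1 v) + B * real V powr (- (1 - \<theta>)) * F \<theta> v) Vs"
      unfolding SQ_eq by (rule norm_le[OF UVs le])
    also have "\<dots> \<le> infsum (\<lambda>v. (M v + d / real q * (2 * ln (real V)) * F 1 v) + B * real V powr (- (1 - \<theta>)) * F \<theta> v) N"
      by (rule infsum_mono2[OF UVs Us]) (use U0 in \<open>auto simp: Vs_def\<close>)
    finally show ?thesis .
  qed
  have M_le: "infsum M N \<le> sqrt (C * (1 + ln (real V))) * sqrt (20 * d * B * (1 + ln (real V)) * (1 + ln (real (X + 1))) / sqrt (real q))"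
  proof -
    have "infsum M N \<le> infsum (\<lambda>v. F 1 v * norm (Xs v)) {q..V}"
    proof (rule infsum_mono_neutral)
      show "M summable_on N"
      proof (rule finite_nonzero_values_imp_summable_on)
        show "finite {x \<in> N. M x \<noteq> 0}" by (rule finite_subset[of _ "{q..V}"]) (auto simp: M_def split: if_splits)
      qed
    qed (auto simp: M_def F.F_nonneg)
    also have "\<dots> = (\<Sum>v=q..V. F 1 v * norm (Xs v))" by simp
    \<comment> \<open>The weight 1/v is split evenly, so that both factors of Cauchy-Schwarz are
      logarithmic means.\<close>
    also have "\<dots> = (\<Sum>v=q..V. (norm (f v) / sqrt (real v)) * (norm (Xs v) / sqrt (real v)))"
      using q by (intro sum.cong refl) (auto simp: F_def powr_minus_divide)
    also have "\<dots> \<le> sqrt ((\<Sum>v=q..V. (norm (f v) / sqrt (real v))\<^sup>2) * (\<Sum>v=q..V. (norm (Xs v) / sqrt (real v))\<^sup>2))"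
      by (rule real_le_rsqrt) (rule Cauchy_Schwarz_ineq_sum)
    also have "\<dots> = sqrt (\<Sum>v=q..V. (norm (f v))\<^sup>2 / real v) * sqrt (\<Sum>v=q..V. (norm (Xs v))\<^sup>2 / real v)"
      by (simp add: real_sqrt_mult power_divide)
    also have "\<dots> \<le> sqrt (C * (1 + ln (real V))) * sqrt (20 * d * B * (1 + ln (real V)) * (1 + ln (real (X + 1))) / sqrt (real q))"
    proof (intro mult_mono real_sqrt_le_mono)
      have "(\<Sum>v=q..V. (norm (f v))\<^sup>2 / real v) \<le> (\<Sum>v=1..V. (norm (f v))\<^sup>2 / real v)"
        using q by (intro sum_mono2) auto
      also have "\<dots> \<le> C * (1 + ln (real V))" using q V by (intro sum_squares_over_n_le) auto
      finally show "(\<Sum>v=q..V. (norm (f v))\<^sup>2 / real v) \<le> C * (1 + ln (real V))" .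
      have "(\<Sum>v=q..V. (norm (Xs v))\<^sup>2 / real v) \<le> 20 * d * (\<Sum>p\<in>Q. norm (\<gamma> p)) * (1 + ln (real V)) * (1 + ln (real (X + 1))) / sqrt (real q)"
        unfolding Xs_def by (rule mean_square_exponential_sum_le[OF q Q(1) \<gamma>_d V d_nonneg])
      also have "\<dots> \<le> 20 * d * B * (1 + ln (real V)) * (1 + ln (real (X + 1))) / sqrt (real q)"
        using \<gamma>_sum d_nonneg q V by (intro divide_right_mono mult_right_mono mult_left_mono) auto
      finally show "(\<Sum>v=q..V. (norm (Xs v))\<^sup>2 / real v) \<le> 20 * d * B * (1 + ln (real V)) * (1 + ln (real (X + 1))) / sqrt (real q)" .
    qed (use q V C_nonneg in \<open>auto intro!: sum_nonneg\<close>)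
    finally show ?thesis .
  qed
  have "infsum (\<lambda>v. (M v + d / real q * (2 * ln (real V)) * F 1 v) + B * real V powr (- (1 - \<theta>)) * F \<theta> v) N
      = infsum M N + d / real q * (2 * ln (real V)) * infsum (F 1) N + B * real V powr (- (1 - \<theta>)) * infsum (F \<theta>) N"
  proof -
    have Ms: "M summable_on N"
    proof (rule finite_nonzero_values_imp_summable_on)
      show "finite {x \<in> N. M x \<noteq> 0}" by (rule finite_subset[of _ "{q..V}"]) (auto simp: M_def split: if_splits)
    qed
    have s1: "(\<lambda>v. d / real q * (2 * ln (real V)) * F 1 v) summable_on N" by (intro summable_on_cmult_right Fsum) auto
    have s2: "(\<lambda>v. B * real V powr (- (1 - \<theta>)) * F \<theta> v) summable_on N" by (intro summable_on_cmult_right Fsum) (use \<theta> in auto)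
    show ?thesis
      by (simp only: infsum_add[OF summable_on_add[OF Ms s1] s2] infsum_add[OF Ms s1] infsum_cmult_right')
  qed
  also have "\<dots> \<le> sqrt (C * (1 + ln (real V))) * sqrt (20 * d * B * (1 + ln (real V)) * (1 + ln (real (X + 1))) / sqrt (real q))
       + d / real q * (2 * ln (real V)) * K1 + B * real V powr (- (1 - \<theta>)) * K1"
    using Z[of 1] Z[of \<theta>] \<theta> M_le d_nonneg q V B0 by (intro add_mono mult_left_mono mult_nonneg_nonneg) auto
  finally have SQ_final: "norm (infsum g SQ) \<le> sqrt (C * (1 + ln (real V))) * sqrt (20 * d * B * (1 + ln (real V)) * (1 + ln (real (X + 1))) / sqrt (real q))
       + d / real q * (2 * ln (real V)) * K1 + B * real V powr (- (1 - \<theta>)) * K1"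
    using SQ_le by linarith
  have "{n \<in> smooth_over (P \<union> Q). E n \<ge> 2} = NS \<union> SQ" by (auto simp: NS_def SQ_def N_def)
  moreover have "infsum g (NS \<union> SQ) = infsum g NS + infsum g SQ"
    by (rule infsum_Un_disjoint) (auto simp: NS_def SQ_def intro!: g_sum)
  ultimately have "norm (infsum g {n \<in> smooth_over (P \<union> Q). E n \<ge> 2}) \<le> norm (infsum g NS) + norm (infsum g SQ)"
    by (simp add: norm_triangle_ineq)
  thus ?thesis using NS_le SQ_final by (simp add: mult_ac)
qed

end

section \<open>The contradiction\<close>

lemma infsum_tail_le:
  fixes M :: "nat \<Rightarrow> real"
  assumes M: "M summable_on {1..}" "\<And>n. M n \<ge> 0" and "\<epsilon> > 0"
  shows "\<exists>N. infsum M {N<..} \<le> \<epsilon>"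
proof -
  obtain B where B: "finite B" "B \<subseteq> {1..}" "dist (sum M B) (infsum M {1..}) \<le> \<epsilon>"
    using infsum_finite_approximation[OF M(1) assms(3)] by blast
  define N where "N = Max (insert 0 B)"
  have BN: "x \<le> N" if "x \<in> B" for x using that B by (simp add: N_def)
  have s: "M summable_on ({1..} - B)" "M summable_on {N<..}" by (rule summable_on_subset[OF M(1)]; auto)+
  have "infsum M {N<..} \<le> infsum M ({1..} - B)"
    by (rule infsum_mono2[OF s(2,1)]) (use BN M(2) in force)+
  also have "infsum M ({1..} - B) + sum M B = infsum M (({1..} - B) \<union> B)"
    using B s by (subst infsum_Un_disjoint) auto
  hence "infsum M ({1..} - B) = infsum M {1..} - sum M B"
    using B(2) by (simp add: Un_absorb2)
  finally show ?thesis using B(3) by (intro exI[of _ N]) (simp add: dist_real_def)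
qed

lemma exists_subset_sum_between:
  fixes r :: "'a \<Rightarrow> real"
  assumes "finite S" "\<And>x. x \<in> S \<Longrightarrow> 0 \<le> r x \<and> r x \<le> 1" "0 \<le> L" "L \<le> sum r S"
  shows "\<exists>Q\<subseteq>S. L \<le> sum r Q \<and> sum r Q \<le> L + 1"
  using assms
proof (induction S rule: finite_induct)
  case empty
  thus ?case by (intro exI[of _ "{}"]) auto
next
  case (insert x S)
  show ?case
  proof (cases "L \<le> sum r S")
    case True
    then obtain Q where "Q \<subseteq> S" "L \<le> sum r Q" "sum r Q \<le> L + 1" using insert by blast
    thus ?thesis by blast
  next
    case False
    have "r x \<le> 1" using insert.prems(1) by blast
    hence "sum r (insert x S) \<le> L + 1" using False insert.hyps by simp
    thus ?thesis using insert.prems(3) by blast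
  qed
qed

lemma irrational_approximation:
  assumes "lam \<notin> \<rat>"
  shows "\<exists>A :: int. \<exists>q > K. coprime A (int q) \<and> \<bar>lam - of_int A / real q\<bar> < 1 / (real q)\<^sup>2"
proof -
  have "infinite (approx_set lam)" using assms rational_iff_finite_approx_set by blast
  then obtain h j where hj: "(h, j) \<in> approx_set lam" "j > int K" using infinite_approx_set by blast
  hence j: "j > 0" "coprime h j" "\<bar>lam - of_int h / of_int j\<bar> < 1 / (of_int j)\<^sup>2"
    by (auto simp: approx_set_def)
  have "int (nat j) = j" "real (nat j) = of_int j" using j by auto
  thus ?thesis using hj j by (intro exI[of _ h] exI[of _ "nat j"]) auto
qed

text \<open>The second threshold is 1/16 because that quantity later stands under a square
  root.\<close>

lemma eventually_log_powers_small:
  fixes c1 c2 :: real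
  shows "\<exists>q0 :: nat. \<forall>q\<ge>q0. c1 * (ln (real q) / real q) \<le> 1 / 4 \<and> c2 * (ln (real q) ^ 3 / sqrt (real q)) \<le> 1 / 16"
proof -
  have "((\<lambda>q::nat. ln (real q) / real q) \<longlonglongrightarrow> 0)" by real_asymp
  hence "((\<lambda>q::nat. c1 * (ln (real q) / real q)) \<longlonglongrightarrow> c1 * 0)" by (intro tendsto_intros)
  hence 1: "eventually (\<lambda>q. c1 * (ln (real q) / real q) < 1 / 4) sequentially" by (intro order_tendstoD(2)) auto
  have "((\<lambda>q::nat. ln (real q) ^ 3 / sqrt (real q)) \<longlonglongrightarrow> 0)" by real_asymp
  hence "((\<lambda>q::nat. c2 * (ln (real q) ^ 3 / sqrt (real q))) \<longlonglongrightarrow> c2 * 0)" by (intro tendsto_intros)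
  hence 2: "eventually (\<lambda>q. c2 * (ln (real q) ^ 3 / sqrt (real q)) < 1 / 16) sequentially" by (intro order_tendstoD(2)) auto
  from eventually_conj[OF 1 2] show ?thesis by (auto simp: eventually_at_top_linorder intro: less_imp_le)
qed

context multiplicative_coeffs
begin

definition tcoeff :: "real \<Rightarrow> nat \<Rightarrow> nat \<Rightarrow> nat \<Rightarrow> complex" where
  "tcoeff lam m k n = (if [n = m] (mod k) then f n * e2pi (of_real (lam * real n)) else 0)"

lemma norm_tcoeff_le: "norm (tcoeff lam m k n) \<le> norm (f n)"
  by (auto simp: tcoeff_def norm_mult simp del: of_real_mult)

text \<open>The phases are chosen so that, at \<open>\<zeta> = 0\<close>, the coefficient of \<open>w\<close> is the sum of the
  \<open>\<bar>f p\<bar> p\<^sup>-\<^sup>\<sigma>\<close> without cancellation; the maximum principle then moves \<open>\<zeta>\<close> to the unit circle.\<close>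

lemma exists_large_linear_coeff:
  assumes P: "finite P" "\<And>p. p \<in> P \<Longrightarrow> prime p" and Q: "finite Q" "\<And>p. p \<in> Q \<Longrightarrow> prime p"
    "\<And>p. p \<in> Q \<Longrightarrow> [p = m] (mod k)" and \<sigma>: "\<sigma> \<ge> 1"
  shows "\<exists>h. (\<forall>p. norm (h p) = 1) \<and> (\<Sum>p\<in>Q. norm (f p) * real p powr (- \<sigma>)) \<le>
     norm (\<Sum>\<^sub>\<infinity>n\<in>{n \<in> smooth_over (P \<union> Q). add_ext (\<lambda>p. if p \<in> Q then 1 else 0) n = 1}. tcoeff lam m k n * cm_ext h n * of_nat n powr (- of_real \<sigma>))"
proof -
  define E where "E = add_ext (\<lambda>p. if p \<in> Q then 1 else 0)"
  define N1 where "N1 = {n \<in> smooth_over (P \<union> Q). E n = 1}"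
  \<comment> \<open>The power of \<open>\<zeta>\<close> counts the prime factors outside
    \<open>Q\<close>, so setting \<open>\<zeta> = 0\<close> leaves only integers built from
    \<open>Q\<close>.\<close>
  define e where "e = (\<lambda>p. if p \<in> Q then 0 else 1 :: nat)"
  define a where "a = (\<lambda>p. f p * e2pi (of_real (lam * real p)))"
  define h1 where "h1 = (\<lambda>p. if p \<in> Q \<and> f p \<noteq> 0 then cnj (sgn (a p)) else 1)"
  define W where "W = (\<Sum>p\<in>Q. norm (f p) * real p powr (- \<sigma>))"
  have na: "norm (a p) = norm (f p)" for p by (simp add: a_def norm_mult del: of_real_mult)
  have h1: "norm (h1 p) = 1" for p
  proof -
    have "f p \<noteq> 0 \<Longrightarrow> a p \<noteq> 0" using na[of p] by auto
    thus ?thesis by (auto simp: h1_def norm_sgn)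
  qed
  have ah: "a p * h1 p = of_real (norm (f p))" if "p \<in> Q" for p
  proof (cases "f p = 0")
    case False
    have "a p * cnj (sgn (a p)) = of_real (norm (a p))"
    proof -
      have nz: "norm (a p) \<noteq> 0" using False na[of p] by simp
      have "cnj (sgn (a p)) = cnj (a p) / of_real (norm (a p))" by (simp add: sgn_eq)
      hence "a p * cnj (sgn (a p)) = (a p * cnj (a p)) / of_real (norm (a p))" by simp
      also have "a p * cnj (a p) = of_real (norm (a p)) * of_real (norm (a p))"
        by (simp only: complex_norm_square[symmetric] power2_eq_square of_real_mult)
      finally show ?thesis using nz by simp
    qed
    thus ?thesis using False that na[of p] by (simp add: h1_def)
  qed (simp add: a_def)
  define T where "T = (\<lambda>\<zeta> n. tcoeff lam m k n * (cm_ext h1 n * \<zeta> ^ add_ext e n) * of_nat n powr (- of_real \<sigma>))"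
  define a1 where "a1 = (\<lambda>\<zeta>. infsum (T \<zeta>) N1)"
  have n1: "n \<ge> 1" if "n \<in> N1" for n using that by (auto simp: N1_def smooth_over_def)
  have T_le: "norm (T \<zeta> n) \<le> F 1 n" if "n \<in> N1" "norm \<zeta> \<le> 1" for \<zeta> n
  proof -
    have pw: "real n powr (- \<sigma>) \<le> real n powr (- 1)" using n1[OF that(1)] \<sigma> by (intro powr_mono) auto
    have "norm (T \<zeta> n) \<le> norm (f n) * (1 * 1) * real n powr (- 1)"
      unfolding T_def norm_mult norm_power
      using n1[OF that(1)] that(2) pw norm_cm_ext_1[of h1 n, OF h1]
      by (intro mult_mono norm_tcoeff_le power_le_one) (auto simp: norm_nat_powr power_le_one)
    thus ?thesis by (simp add: F_def)
  qed
  have Fs: "F 1 summable_on N1"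
    unfolding N1_def by (rule summable_on_subset[OF F_smooth_summable[of "P \<union> Q"]]) (use P Q in auto)
  have hol: "a1 holomorphic_on ball 0 1" unfolding a1_def
    by (rule holomorphic_on_infsum[OF _ _ _ Fs]) (use T_le in \<open>auto simp: T_def intro!: holomorphic_intros\<close>)
  have cont: "continuous_on (cball 0 1) a1" unfolding a1_def
    by (rule continuous_on_infsum[OF _ _ Fs]) (use T_le in \<open>auto simp: T_def intro!: continuous_intros\<close>)
  have a10: "a1 0 = of_real W"
  proof -
    have "a1 0 = infsum (T 0) Q"
      unfolding a1_def
    proof (rule infsum_cong_neutral)
      fix n assume n: "n \<in> Q - N1"
      have "n \<in> N1" unfolding N1_def smooth_over_def E_def
        using n Q(2)[of n] prime_gt_0_nat[of n] by (auto simp: add_ext_prime Suc_le_eq primes_dvd_imp_eq dest: primes_dvd_imp_eq)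
      thus "T 0 n = 0" using n by simp
    next
      fix n assume n: "n \<in> N1 - Q"
      \<comment> \<open>With exactly one factor from \<open>Q\<close> and none outside,
        \<open>n\<close> would be a prime of \<open>Q\<close>.\<close>
      have "add_ext e n \<noteq> 0"
      proof
        assume 0: "add_ext e n = 0"
        have nN: "n \<ge> 1" "E n = 1" using n by (auto simp: N1_def smooth_over_def)
        have allQ: "p \<in> Q" if "prime p" "p dvd n" for p
          using 0 add_ext_eq_0_iff[of n e] nN that by (auto simp: e_def split: if_splits)
        have "n \<noteq> 1" using nN by (auto simp: E_def)
        then obtain p where p: "prime p" "p dvd n" using prime_factor_nat by blast
        then obtain j where j: "n = p * j" by (auto elim: dvdE)
        have pj: "p > 0" "j > 0" using nN j by (auto intro!: gr0I)
        have "E j = 0" using nN(2) add_ext_mult[OF pj] add_ext_prime[OF p(1)] allQ[OF p] by (simp add: E_def j)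
        have "j = 1"
        proof (rule ccontr)
          assume "j \<noteq> 1"
          then obtain r where r: "prime r" "r dvd j" using prime_factor_nat by blast
          hence "r \<in> Q" using allQ j by auto
          thus False using \<open>E j = 0\<close> add_ext_eq_0_iff[of j] pj r by (auto simp: E_def)
        qed
        thus False using j n allQ[OF p] by simp
      qed
      thus "T 0 n = 0" by (simp add: T_def)
    qed auto
    also have "\<dots> = (\<Sum>p\<in>Q. T 0 p)" using Q(1) by simp
    also have "\<dots> = (\<Sum>p\<in>Q. of_real (norm (f p) * real p powr (- \<sigma>)))"
    proof (rule sum.cong[OF refl])
      fix p assume p: "p \<in> Q"
      have p0: "p > 0" using Q(2)[OF p] prime_gt_0_nat by blast
      have "T 0 p = (a p * h1 p) * of_nat p powr (- of_real \<sigma>)"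
        using p Q(2)[OF p] Q(3)[OF p] by (simp add: T_def tcoeff_def cm_ext_prime add_ext_prime e_def a_def)
      also have "of_nat p powr (- of_real \<sigma>) = complex_of_real (real p powr (- \<sigma>))"
        using p0 powr_of_real[of "real p" "- \<sigma>"] by simp
      finally show "T 0 p = of_real (norm (f p) * real p powr (- \<sigma>))" by (simp add: ah[OF p])
    qed
    finally show ?thesis by (simp add: W_def)
  qed
  have "continuous_on (sphere 0 1) (\<lambda>\<zeta>. norm (a1 \<zeta>))"
    by (intro continuous_on_norm continuous_on_subset[OF cont]) auto
  moreover have "compact (sphere (0 :: complex) 1)" "sphere (0 :: complex) 1 \<noteq> {}" by auto
  ultimately obtain \<zeta> where \<zeta>: "norm \<zeta> = 1" "\<And>z. norm z = 1 \<Longrightarrow> norm (a1 z) \<le> norm (a1 \<zeta>)"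
    using continuous_attains_sup[of "sphere (0 :: complex) 1" "\<lambda>\<zeta>. norm (a1 \<zeta>)"] by auto
  have "norm (a1 0) \<le> norm (a1 \<zeta>)"
    by (rule maximum_modulus_frontier[of a1 "cball 0 1"]) (use hol cont \<zeta> in \<open>auto simp: frontier_cball\<close>)
  moreover have "W \<ge> 0" unfolding W_def by (intro sum_nonneg) auto
  ultimately have W: "W \<le> norm (a1 \<zeta>)" by (simp add: a10)
  \<comment> \<open>The maximizing \<open>\<zeta>\<close> is unimodular and is absorbed into the
    phases at primes outside \<open>Q\<close>.\<close>
  define h where "h = (\<lambda>p. h1 p * \<zeta> ^ e p)"
  have h: "norm (h p) = 1" for p by (simp add: h_def norm_mult norm_power h1 \<zeta>)
  have "a1 \<zeta> = infsum (\<lambda>n. tcoeff lam m k n * cm_ext h n * of_nat n powr (- of_real \<sigma>)) N1"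
    unfolding a1_def T_def h_def cm_ext_distrib cm_ext_power ..
  with W have "W \<le> norm (infsum (\<lambda>n. tcoeff lam m k n * cm_ext h n * of_nat n powr (- of_real \<sigma>)) N1)" by simp
  from this[unfolded W_def N1_def E_def] show ?thesis by (intro exI[of _ h] conjI allI h)
qed

text \<open>The order of choices matters. First \<open>N0\<close> and the bound \<open>K2\<close>
  for the constant term, then the required size \<open>ll\<close> of the prime sum, then
  \<open>t\<close>, \<open>s\<close> and \<open>\<delta>\<close>, and only then \<open>q\<close>,
  which can pass every threshold because an irrational number has infinitely many good
  approximations. \<open>X\<close>, \<open>V\<close>, \<open>Q\<close>, \<open>\<sigma>\<close> and
  the phases depend on \<open>q\<close>.\<close>

lemma not_finitely_many_zeros:
  fixes lam \<eta> c1 :: real and m k :: nat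
  assumes lam: "lam \<notin> \<rat>" and k: "k > 0" and mk: "coprime m k" and \<eta>: "\<eta> > 0" and d: "d \<ge> 1"
    and summ: "\<And>\<sigma>. \<sigma> > 1 \<Longrightarrow> (\<lambda>n. norm (f n) * real n powr (- \<sigma>)) summable_on {1..}"
    and c1: "c1 > 0" and lower: "\<And>x. x \<ge> x1 \<Longrightarrow> (\<Sum>p | prime p \<and> real p \<le> x \<and> [p = m] (mod k). (norm (f p))\<^sup>2) \<ge> c1 * (x / ln x)"
    and fin: "finite {s. 1 < Re s \<and> Re s < 1 + \<eta> \<and> twist_sum (tcoeff lam m k) (\<lambda>_. 1) s = 0}"
  shows False
proof -
  define b where "b = tcoeff lam m k"
  interpret dirichlet_coeffs b
  proof
    show "(\<lambda>n. norm (b n) * real n powr (- \<sigma>)) summable_on {1..}" if "\<sigma> > 1" for \<sigma>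
      by (rule summable_on_comparison_test[OF summ[OF that]]) (auto simp: b_def intro!: mult_right_mono norm_tcoeff_le)
  qed
  have torus: "twist_sum b \<psi> s \<noteq> 0" if "\<And>p. prime p \<Longrightarrow> norm (\<psi> p) = 1" "1 < Re s" "Re s < 1 + \<eta>" for \<psi> s
    using twist_zero_free[OF \<eta> fin[folded b_def] that] .
  define \<sigma>0 where "\<sigma>0 = 1 + \<eta> / 2"
  have \<sigma>0: "1 < \<sigma>0" "\<sigma>0 < 1 + \<eta>" using \<eta> by (auto simp: \<sigma>0_def)
  have D0: "norm (twist_sum b (\<lambda>_. 1) (of_real \<sigma>0)) / 4 > 0" using torus[of "\<lambda>_. 1" "of_real \<sigma>0"] \<sigma>0 by simp
  obtain N0 where N0: "(\<Sum>\<^sub>\<infinity>n\<in>{N0<..}. norm (b n) * real n powr (- \<sigma>0)) \<le> norm (twist_sum b (\<lambda>_. 1) (of_real \<sigma>0)) / 4"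
    using infsum_tail_le[OF dirichlet_coeffs.summ[OF dirichlet_coeffs_axioms \<sigma>0(1)] _ D0] by auto
  define P where "P = {p. prime p \<and> p \<le> N0}"
  have P: "finite P" "\<And>p. p \<in> P \<Longrightarrow> prime p" by (auto simp: P_def)
  define K2 where "K2 = K0 P * exp T0"
  have K0: "K0 P \<ge> 0" by (auto simp: K0_def F.F_nonneg intro!: prod_nonneg infsum_nonneg)
  have K2: "K2 \<ge> 0" using K0 by (simp add: K2_def)
  \<comment> \<open>The last step combines \<open>norm a1 / 2 \<le> norm a0 + 4\<close>,
    \<open>norm a0 \<le> K2\<close> and \<open>norm a1 \<ge> ll / 2\<close>; these are incompatible
    once \<open>ll > 4 * K2 + 16\<close>.\<close>
  define ll where "ll = 4 * K2 + 20"
  define B where "B = ll + 1"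
  define K1 where "K1 = K0 P * exp (exp 1 * B + T0)"
  have K1: "K1 \<ge> 0" using K0 by (simp add: K1_def)
  have B: "B \<ge> 1" using K2 by (simp add: B_def ll_def)
  define u where "u = (\<lambda>n. if prime n \<and> [n = m] (mod k) then (norm (f n))\<^sup>2 else 0)"
  \<comment> \<open>The hypothesis concerns squares; the factor \<open>d\<close> pays for
    \<open>(norm (f p))\<^sup>2 \<le> d * norm (f p)\<close>.\<close>
  obtain t q1 where t: "t \<ge> 1" "\<And>q. q \<ge> q1 \<Longrightarrow> (\<Sum>n=q..q ^ t. u n / real n) \<ge> d * ll"
  proof -
    have "\<exists>t\<ge>1. \<exists>q1. \<forall>q\<ge>q1. (\<Sum>n=q..q ^ t. u n / real n) \<ge> d * ll"
    proof (rule log_weight_lower_bound[OF _ _ c1])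
      show "u n \<le> d\<^sup>2" for n using prime_le[of n] d by (auto simp: u_def intro!: power_mono)
      show "(\<Sum>n=1..x. u n) \<ge> c1 * (real x / ln (real x))" if "real x \<ge> x1" for x
      proof -
        have "(\<Sum>n=1..x. u n) = (\<Sum>p | prime p \<and> real p \<le> real x \<and> [p = m] (mod k). (norm (f p))\<^sup>2)"
          by (rule sum.mono_neutral_cong_right) (auto simp: u_def Suc_le_eq prime_gt_0_nat)
        thus ?thesis using lower[OF that] by simp
      qed
    qed (auto simp: u_def)
    thus ?thesis using that by blast
  qed
  \<comment> \<open>With \<open>V = X ^ s\<close> and \<open>\<theta> = 1 - 1 / ln X\<close> the
    tail factor \<open>V powr (- (1 - \<theta>))\<close> is exactly
    \<open>exp (- s)\<close>.\<close>
  obtain s :: nat where s: "s \<ge> 1" "B * K1 * exp (- real s) \<le> 1 / 4"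
  proof -
    have "((\<lambda>s::nat. exp (- real s)) \<longlonglongrightarrow> 0)" by real_asymp
    hence "((\<lambda>s::nat. B * K1 * exp (- real s)) \<longlonglongrightarrow> B * K1 * 0)" by (intro tendsto_intros)
    hence "eventually (\<lambda>s::nat. B * K1 * exp (- real s) < 1 / 4) sequentially" by (intro order_tendstoD(2)) auto
    hence "eventually (\<lambda>s::nat. B * K1 * exp (- real s) < 1 / 4 \<and> s \<ge> 1) sequentially"
      using eventually_ge_at_top[of 1] by eventually_elim auto
    then obtain s :: nat where "B * K1 * exp (- real s) < 1 / 4 \<and> s \<ge> 1" by (auto simp: eventually_at_top_linorder)
    thus ?thesis by (intro that[of s]) auto
  qed
  define \<delta> where "\<delta> = 1 / (4 * (K1 + 1))"
  have \<delta>: "\<delta> > 0" "\<delta> * K1 \<le> 1 / 4" using K1 by (auto simp: \<delta>_def field_simps)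
  obtain q2 where q2: "\<And>Q. finite Q \<Longrightarrow> (\<forall>p\<in>Q. prime p \<and> p \<ge> q2) \<Longrightarrow> (\<Sum>p\<in>Q. G p) \<le> \<delta>"
    using G_tail[OF \<delta>(1)] by blast
  define a where "a = real (t * s)"
  have "1 \<le> t * s" using t(1) s(1) by simp
  hence "real 1 \<le> real (t * s)" by (simp only: of_nat_le_iff)
  hence a: "a \<ge> 1" by (simp add: a_def)
  \<comment> \<open>\<open>cc1\<close> and \<open>cc2\<close> collect the constants left after
    expressing \<open>ln V\<close> and \<open>ln (X + 1)\<close> through \<open>ln q\<close>; the
    three logarithms in the bilinear bound give the cube.\<close>
  define cc1 where "cc1 = K1 * d * 2 * a"
  define cc2 where "cc2 = C * (20 * d * B) * (1 + a)\<^sup>2 * (2 + real t)"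
  obtain q3 where q3: "\<And>q. q \<ge> q3 \<Longrightarrow> cc1 * (ln (real q) / real q) \<le> 1 / 4 \<and> cc2 * (ln (real q) ^ 3 / sqrt (real q)) \<le> 1 / 16"
    using eventually_log_powers_small[of cc1 cc2] by blast
  \<comment> \<open>\<open>exp 16\<close> forces \<open>ln X \<ge> 16\<close>, hence
    \<open>\<theta> \<ge> 15 / 16\<close>; \<open>q \<ge> d\<close> makes every
    \<open>norm (f p) / p\<close> at most 1.\<close>
  obtain q4 :: nat where q4: "real q4 \<ge> exp 16 + d" using real_arch_simple by blast
  obtain A q where Aq: "q > max (max q1 q2) (max (max q3 q4) (max N0 2))" "coprime A (int q)" "\<bar>lam - of_int A / real q\<bar> < 1 / (real q)\<^sup>2"
    using irrational_approximation[OF lam] by blast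
  have q: "q \<ge> q1" "q \<ge> q2" "q \<ge> q3" "q \<ge> q4" "q > N0" "q \<ge> 2" using Aq(1) by auto
  have qr: "real q \<ge> exp 16" "real q \<ge> d"
    using q(4) q4 d_nonneg exp_gt_zero[of "16::real"] by (smt (verit) of_nat_le_iff)+
  define lq where "lq = ln (real q)"
  have lq: "lq \<ge> 16" unfolding lq_def using qr q(6) by (subst ln_ge_iff) auto
  define X where "X = q ^ t"
  define V where "V = X ^ s"
  have lnX: "ln (real X) = real t * lq" using q(6) by (simp add: X_def lq_def ln_realpow)
  have lnV: "ln (real V) = a * lq" using q(6) by (simp add: V_def X_def lq_def a_def ln_realpow)
  have X2: "X \<ge> q" using t(1) q(6) by (simp add: X_def self_le_power)
  have VX: "V \<ge> X" using s(1) X2 q(6) by (simp add: V_def self_le_power)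
  have lnX16: "ln (real X) \<ge> 16" unfolding lnX using t(1) lq mult_mono[of 1 "real t" 16 lq] by simp
  define r where "r = (\<lambda>p. norm (f p) / real p)"
  define S where "S = {p \<in> {q..X}. prime p \<and> [p = m] (mod k)}"
  have rS: "0 \<le> r p \<and> r p \<le> 1" if "p \<in> S" for p
  proof -
    have "norm (f p) \<le> real p" using that prime_le[of p] qr(2) by (auto simp: S_def)
    thus ?thesis using that q(6) by (auto simp: r_def S_def divide_le_eq)
  qed
  have sumS: "ll \<le> sum r S"
  proof -
    have "d * ll \<le> (\<Sum>n=q..X. u n / real n)" using t(2)[OF q(1)] by (simp add: X_def)
    also have "\<dots> = (\<Sum>n\<in>S. (norm (f n))\<^sup>2 / real n)"
      by (rule sum.mono_neutral_cong_right) (auto simp: S_def u_def)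
    also have "\<dots> \<le> (\<Sum>n\<in>S. d * r n)"
    proof (rule sum_mono)
      fix n assume "n \<in> S"
      hence "norm (f n) * norm (f n) \<le> d * norm (f n)" using prime_le[of n] by (intro mult_right_mono) (auto simp: S_def)
      thus "(norm (f n))\<^sup>2 / real n \<le> d * r n" by (simp add: r_def power2_eq_square divide_right_mono)
    qed
    also have "\<dots> = d * sum r S" by (simp add: sum_distrib_left)
    finally show ?thesis using d by simp
  qed
  \<comment> \<open>Terms of size at most 1 allow the sum to be cut between \<open>ll\<close> and
    \<open>ll + 1\<close>; the upper bound keeps \<open>K1\<close> fixed while \<open>q\<close>
    grows.\<close>
  obtain Q where Q: "Q \<subseteq> S" "ll \<le> sum r Q" "sum r Q \<le> B"
    using exists_subset_sum_between[of S r ll, OF _ rS _ sumS] K2 by (auto simp: S_def ll_def B_def)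
  have Qp: "prime p" "[p = m] (mod k)" "q \<le> p" "p \<le> X" if "p \<in> Q" for p using that Q(1) by (auto simp: S_def)
  have finQ: "finite Q" using Q(1) finite_subset[of Q S] by (auto simp: S_def)
  have PQ: "P \<inter> Q = {}" using Qp q(5) by (force simp: P_def)
  \<comment> \<open>For \<open>p \<le> X\<close> this gives
    \<open>p powr (\<sigma> - 1) \<le> 2\<close>, so the prime sum at \<open>\<sigma>\<close> is at
    least half of that at 1.\<close>
  define \<sigma> where "\<sigma> = 1 + min (\<eta> / 2) (ln 2 / ln (real X))"
  have \<sigma>: "1 < \<sigma>" "\<sigma> < 1 + \<eta>"
  proof -
    have "ln 2 / ln (real X) > 0" using lnX16 by simp
    thus "1 < \<sigma>" using \<eta> by (simp add: \<sigma>_def)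
    have "min (\<eta> / 2) (ln 2 / ln (real X)) \<le> \<eta> / 2" by (rule min.cobounded1)
    thus "\<sigma> < 1 + \<eta>" unfolding \<sigma>_def using \<eta> by linarith
  qed
  have p\<sigma>: "real p powr (- \<sigma>) \<ge> 1 / (2 * real p)" if "p \<in> Q" for p
  proof -
    have p0: "p > 0" using Qp(1)[OF that] prime_gt_0_nat by blast
    have "real p powr (\<sigma> - 1) \<le> real X powr (ln 2 / ln (real X))"
    proof -
      have "real p powr (\<sigma> - 1) \<le> real X powr (\<sigma> - 1)" using Qp(4)[OF that] \<sigma> by (intro powr_mono2) auto
      also have "\<dots> \<le> real X powr (ln 2 / ln (real X))" using X2 q(6) by (intro powr_mono) (auto simp: \<sigma>_def)
      finally show ?thesis .
    qed
    also have "\<dots> = 2" using lnX16 X2 q(6) by (simp add: powr_def)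
    finally have le: "real p powr (\<sigma> - 1) \<le> 2" .
    have "real p powr (- \<sigma>) = 1 / (real p powr (\<sigma> - 1) * real p)"
      using p0 by (simp add: powr_minus_divide powr_diff)
    moreover have "real p powr (\<sigma> - 1) * real p \<le> 2 * real p" using le by (intro mult_right_mono) auto
    ultimately show ?thesis using p0 by (auto intro!: divide_left_mono)
  qed
  obtain h where h: "\<And>p. norm (h p) = 1" "(\<Sum>p\<in>Q. norm (f p) * real p powr (- \<sigma>)) \<le>
     norm (\<Sum>\<^sub>\<infinity>n\<in>{n \<in> smooth_over (P \<union> Q). add_ext (\<lambda>p. if p \<in> Q then 1 else 0) n = 1}. b n * cm_ext h n * of_nat n powr (- of_real \<sigma>))"
    using exists_large_linear_coeff[OF P finQ Qp(1,2), of \<sigma> lam] \<sigma>(1) unfolding b_def by auto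
  define E where "E = add_ext (\<lambda>p. if p \<in> Q then 1 else 0)"
  define N where "N = smooth_over (P \<union> Q)"
  define g where "g = (\<lambda>w n. b n * (cm_ext h n * w ^ E n) * of_nat n powr (- of_real \<sigma>))"
  define g1 where "g1 = (\<lambda>n. b n * cm_ext h n * of_nat n powr (- of_real \<sigma>))"
  define a0 where "a0 = infsum g1 {n \<in> N. E n = 0}"
  define a1 where "a1 = infsum g1 {n \<in> N. E n = 1}"
  have N1: "n \<ge> 1" if "n \<in> N" for n using that by (auto simp: N_def smooth_over_def)
  have g_le: "norm (g w n) \<le> F 1 n" if n: "n \<in> N" and w: "norm w \<le> 1" for w n
  proof -
    have pw: "real n powr (- \<sigma>) \<le> real n powr (- 1)" using N1[OF n] \<sigma> by (intro powr_mono) auto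
    have "norm (g w n) \<le> norm (f n) * (1 * 1) * real n powr (- 1)"
      unfolding g_def norm_mult norm_power b_def
      using N1[OF n] w pw norm_cm_ext_1[of h n, OF h(1)]
      by (intro mult_mono norm_tcoeff_le power_le_one) (auto simp: norm_nat_powr power_le_one)
    thus ?thesis by (simp add: F_def)
  qed
  have Fs: "F 1 summable_on N" unfolding N_def by (rule F_smooth_summable) (use P finQ Qp in auto)
  have gs: "g w summable_on S'" if "S' \<subseteq> N" "norm w \<le> 1" for w S'
  proof (rule abs_summable_summable, rule Infinite_Sum.abs_summable_on_comparison_test')
    show "F 1 summable_on S'" using that by (intro summable_on_subset[OF Fs]) auto
    show "norm (g w n) \<le> F 1 n" if "n \<in> S'" for n using that \<open>S' \<subseteq> N\<close> \<open>norm w \<le> 1\<close> by (intro g_le) auto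
  qed
  \<comment> \<open>The lowest abscissa, up to constants, at which primes up to \<open>X\<close> are
    still under control: \<open>X powr (1 - \<theta>) = exp 1\<close>.\<close>
  define \<theta> where "\<theta> = 1 - 1 / ln (real X)"
  have \<theta>: "15 / 16 \<le> \<theta>" "\<theta> \<le> 1"
  proof -
    have "1 / ln (real X) \<le> 1 / 16" using lnX16 by (intro divide_left_mono) auto
    thus "15 / 16 \<le> \<theta>" by (simp add: \<theta>_def)
    show "\<theta> \<le> 1" using lnX16 by (simp add: \<theta>_def)
  qed
  have Xe: "real X powr (1 - \<theta>) = exp 1" using lnX16 X2 q(6) by (simp add: \<theta>_def powr_def)
  have p\<theta>: "real p powr (1 - \<theta>) \<le> exp 1" if "p \<in> Q" for p
    using Qp(4)[OF that] \<theta>(2) powr_mono2[of "1 - \<theta>" "real p" "real X"] Xe by simp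
  have V\<theta>: "real V powr (- (1 - \<theta>)) = exp (- real s)"
  proof -
    have "ln (real V) = real s * ln (real X)" unfolding lnV lnX by (simp add: a_def)
    hence "- (1 - \<theta>) * ln (real V) = - real s" using lnX16 by (simp add: \<theta>_def)
    moreover have "real V \<noteq> 0" using VX X2 q(6) by simp
    ultimately show ?thesis by (simp add: powr_def)
  qed
  have GQ: "(\<Sum>p\<in>Q. G p) \<le> \<delta>" by (rule q2[OF finQ]) (use Qp q(2) in force)
  have small: "norm (infsum (g w) {n \<in> N. E n \<ge> 2}) \<le> 1" if w: "norm w \<le> 1" for w
  proof -
    have "norm (infsum (g w) {n \<in> N. E n \<ge> 2}) \<le> \<delta> * K1 + (B * K1 * real V powr (- (1 - \<theta>)) + K1 * (d / real q * (2 * ln (real V)))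
     + sqrt (C * (1 + ln (real V))) * sqrt (20 * d * B * (1 + ln (real V)) * (1 + ln (real (X + 1))) / sqrt (real q)))"
      unfolding g_def b_def tcoeff_def N_def E_def K1_def
      by (rule multiple_prime_part_le[OF P mk _ Qp(1,2) PQ q(6) Aq(2,3) _ h(1) w _ _ \<theta> p\<theta>])
         (use Qp Q \<sigma> X2 VX GQ in \<open>auto simp: r_def intro: order_trans\<close>)
    \<comment> \<open>One quarter for each source of error: squares by \<open>\<delta>\<close>,
      large \<open>v\<close> by \<open>s\<close>, and the other two by the size of
      \<open>q\<close>.\<close>
    also have "\<dots> \<le> 1 / 4 + (1 / 4 + 1 / 4 + 1 / 4)"
    proof (intro add_mono)
      show "\<delta> * K1 \<le> 1 / 4" by (rule \<delta>(2))
      show "B * K1 * real V powr (- (1 - \<theta>)) \<le> 1 / 4" unfolding V\<theta> by (rule s(2))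
      have e1: "K1 * (d / real q * (2 * ln (real V))) = cc1 * (ln (real q) / real q)"
        unfolding lnV by (simp add: cc1_def lq_def)
      show "K1 * (d / real q * (2 * ln (real V))) \<le> 1 / 4" unfolding e1 using q3[OF q(3)] by (rule conjunct1)
      have v1: "1 + ln (real V) \<le> (1 + a) * lq" unfolding lnV using lq by (simp add: algebra_simps)
      have x1: "1 + ln (real (X + 1)) \<le> (2 + real t) * lq"
      proof -
        have "ln (real (X + 1)) \<le> ln (2 * real X)" using X2 q(6) by (intro ln_mono) auto
        also have "\<dots> = ln 2 + real t * lq" using X2 q(6) by (simp add: ln_mult lnX)
        also have "ln 2 \<le> (1 :: real)" using ln_le_minus_one[of 2] by simp
        finally show ?thesis using lq by (simp add: algebra_simps)
      qed
      have v0: "0 \<le> 1 + ln (real V)" using lnV a lq by simp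
      have x0: "0 \<le> 1 + ln (real (X + 1))" by simp
      have "sqrt (C * (1 + ln (real V))) * sqrt (20 * d * B * (1 + ln (real V)) * (1 + ln (real (X + 1))) / sqrt (real q))
         = sqrt (C * (20 * d * B) * ((1 + ln (real V)) * (1 + ln (real V)) * (1 + ln (real (X + 1)))) / sqrt (real q))"
        unfolding real_sqrt_mult[symmetric] by (simp add: algebra_simps)
      also have "\<dots> \<le> sqrt (C * (20 * d * B) * (((1 + a) * lq) * ((1 + a) * lq) * ((2 + real t) * lq)) / sqrt (real q))"
        using C_nonneg d B v1 x1 v0 x0 a lq
        by (intro real_sqrt_le_mono divide_right_mono mult_left_mono mult_mono mult_nonneg_nonneg) auto
      also have "C * (20 * d * B) * (((1 + a) * lq) * ((1 + a) * lq) * ((2 + real t) * lq)) / sqrt (real q) = cc2 * (ln (real q) ^ 3 / sqrt (real q))"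
        unfolding cc2_def lq_def[symmetric] power2_eq_square power3_eq_cube times_divide_eq_right by (simp only: mult_ac)
      also have "sqrt (cc2 * (ln (real q) ^ 3 / sqrt (real q))) \<le> sqrt (1 / 16)"
        by (rule real_sqrt_le_mono) (rule conjunct2[OF q3[OF q(3)]])
      also have "sqrt (1 / 16) = sqrt ((1 / 4 :: real)\<^sup>2)" by (simp add: power2_eq_square)
      also have "\<dots> = 1 / 4" by simp
      finally show "sqrt (C * (1 + ln (real V))) * sqrt (20 * d * B * (1 + ln (real V)) * (1 + ln (real (X + 1))) / sqrt (real q)) \<le> 1 / 4" .
    qed
    finally show ?thesis by simp
  qed
  have near: "norm (infsum (g w) N - (a0 + a1 * w)) \<le> 1" if w: "norm w \<le> 1" for w
  proof -
    have sets: "N = ({n \<in> N. E n = 0} \<union> {n \<in> N. E n = 1}) \<union> {n \<in> N. E n \<ge> 2}" by auto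
    have "infsum (g w) N = infsum (g w) ({n \<in> N. E n = 0} \<union> {n \<in> N. E n = 1}) + infsum (g w) {n \<in> N. E n \<ge> 2}"
      by (subst sets, rule infsum_Un_disjoint) (auto intro!: gs[OF _ w])
    also have "infsum (g w) ({n \<in> N. E n = 0} \<union> {n \<in> N. E n = 1}) = infsum (g w) {n \<in> N. E n = 0} + infsum (g w) {n \<in> N. E n = 1}"
      by (rule infsum_Un_disjoint) (auto intro!: gs[OF _ w])
    also have "infsum (g w) {n \<in> N. E n = 0} = a0"
      unfolding a0_def by (rule infsum_cong) (auto simp: g_def g1_def)
    also have "infsum (g w) {n \<in> N. E n = 1} = infsum (\<lambda>n. g1 n * w) {n \<in> N. E n = 1}"
      by (rule infsum_cong) (auto simp: g_def g1_def mult_ac)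
    also have "\<dots> = a1 * w" unfolding a1_def by (rule infsum_cmult_left')
    finally have "infsum (g w) N - (a0 + a1 * w) = infsum (g w) {n \<in> N. E n \<ge> 2}" by simp
    thus ?thesis using small[OF w] by simp
  qed
  have "norm a1 / 2 \<le> norm a0 + 4"
  proof (rule linear_part_bound[OF torus \<sigma>0 \<sigma> N0 h(1)])
    show "N0 < p" if "p \<in> Q" for p using Qp(3)[OF that] q(5) by simp
    fix w :: complex assume w: "norm w \<le> 1 / 2"
    have "smooth_over ({..N0} \<union> Q) = smooth_over {p \<in> {..N0} \<union> Q. prime p}" by (rule smooth_over_primes)
    also have "{p \<in> {..N0} \<union> Q. prime p} = P \<union> Q" using Qp(1) by (auto simp: P_def)
    finally have NN: "smooth_over ({..N0} \<union> Q) = N" by (simp add: N_def)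
    show "norm ((\<Sum>\<^sub>\<infinity>n\<in>smooth_over ({..N0} \<union> Q). b n * (cm_ext h n * w ^ add_ext (\<lambda>p. if p \<in> Q then 1 else 0) n) * of_nat n powr (- of_real \<sigma>)) - (a0 + a1 * w)) \<le> 1"
      unfolding NN using near[of w] w by (simp add: g_def E_def)
  qed
  moreover have "norm a0 \<le> K2"
  proof -
    have s0: "{n \<in> N. E n = 0} \<subseteq> smooth_over P"
    proof safe
      fix n assume n: "n \<in> N" "E n = 0"
      show "n \<in> smooth_over P" unfolding smooth_over_def
      proof safe
        show "1 \<le> n" by (rule N1[OF n(1)])
        fix p assume p: "prime p" "p dvd n"
        have "p \<in> P \<union> Q" using smooth_over_dvdD[OF n(1)[unfolded N_def] p] .
        moreover have "p \<notin> Q" using n(2) add_ext_eq_0_iff[of n "\<lambda>p. if p \<in> Q then 1 else 0"] N1[OF n(1)] p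
          by (auto simp: E_def split: if_splits)
        ultimately show "p \<in> P" by blast
      qed
    qed
    have "norm (infsum (g 1) {n \<in> N. E n = 0}) \<le> infsum (F 1) {n \<in> N. E n = 0}"
    proof -
      have F0: "F 1 summable_on {n \<in> N. E n = 0}" by (rule summable_on_subset[OF Fs]) auto
      have abs: "(\<lambda>n. norm (g 1 n)) summable_on {n \<in> N. E n = 0}"
        by (rule Infinite_Sum.abs_summable_on_comparison_test'[OF F0]) (auto intro!: g_le)
      show ?thesis
        using norm_infsum_bound[OF abs] infsum_mono[OF abs F0] g_le[of _ 1] by force
    qed
    also have "\<dots> \<le> infsum (F 1) (smooth_over P)"
      by (rule infsum_mono2) (use s0 F_smooth_summable[OF P] in \<open>auto simp: F.F_nonneg intro: summable_on_subset[OF Fs]\<close>)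
    also have "\<dots> \<le> K2" using F_smooth_le[OF P, of "{}" 1] by (simp add: K2_def)
    finally show ?thesis by (simp add: a0_def g_def g1_def)
  qed
  moreover have "norm a1 \<ge> ll / 2"
  proof -
    have "ll / 2 \<le> sum r Q / 2" using Q(2) by simp
    also have "\<dots> = (\<Sum>p\<in>Q. norm (f p) * (1 / (2 * real p)))" by (simp add: r_def sum_divide_distrib mult.commute)
    also have "\<dots> \<le> (\<Sum>p\<in>Q. norm (f p) * real p powr (- \<sigma>))" by (intro sum_mono mult_left_mono p\<sigma>) auto
    also have "\<dots> \<le> norm a1" using h(2) by (simp add: a1_def g1_def N_def E_def)
    finally show ?thesis .
  qed
  ultimately show False by (simp add: ll_def)
qed

end

theorem theorem2:
  fixes lam :: real and m k :: nat and f :: "nat \<Rightarrow> complex" and \<eta> :: real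
  assumes lam: "0 < lam" "lam < 1" "lam \<notin> \<rat>"
    and mk: "1 \<le> m" "m \<le> k" "coprime m k"
    and mult: "multiplicative_fun f"
    and abs_conv: "\<And>s. Re s > 1 \<Longrightarrow> (\<lambda>n. norm (f n / of_nat n powr s)) summable_on {1..}"
    and euler: "\<exists>d\<ge>1. \<exists>fj. log_euler_product f d fj"
    and mean_square:
      "\<exists>C>0. \<forall>x::real. x \<ge> 1 \<longrightarrow> (\<Sum>n | 1 \<le> n \<and> real n \<le> x. (norm (f n))\<^sup>2) \<le> C * x"
    and primes:
      "\<exists>x0>0. \<exists>A>6. \<exists>c>0. \<exists>C>0. \<forall>x::real. x \<ge> x0 \<longrightarrow>
         (\<Sum>p | prime p \<and> real p \<le> x. (norm (f p))\<^sup>2) \<ge> c * (x / ln x) \<and>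
         (\<forall>q \<psi>. dirichlet_character q \<psi> \<longrightarrow> \<psi> \<noteq> principal_character q \<longrightarrow>
            real q \<le> ln x powr A \<longrightarrow>
            norm (\<Sum>p | prime p \<and> real p \<le> x. of_real ((norm (f p))\<^sup>2) * \<psi> p)
              \<le> C * (1 / real (totient q) * (x / (ln x)\<^sup>2)))"
    and eta: "\<eta> > 0"
  shows "infinite {s. 1 < Re s \<and> Re s < 1 + \<eta> \<and> twisted_series f lam m k s = 0}"
proof
  assume fin: "finite {s. 1 < Re s \<and> Re s < 1 + \<eta> \<and> twisted_series f lam m k s = 0}"
  have k: "k > 0" using mk by simp
  have summ: "(\<lambda>n. norm (f n) * real n powr (- \<sigma>)) summable_on {1..}" if "\<sigma> > 1" for \<sigma>
  proof -
    have "(\<lambda>n. norm (f n / of_nat n powr (of_real \<sigma>))) summable_on {1..}" by (rule abs_conv) (use that in simp)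
    also have "?this \<longleftrightarrow> ?thesis"
      by (rule summable_on_cong) (simp add: norm_divide norm_nat_powr powr_minus_divide)
    finally show ?thesis .
  qed
  obtain d fj where d: "d \<ge> (1 :: nat)" "log_euler_product f d fj" using euler by blast
  obtain C where C: "C > 0" "\<And>x::real. x \<ge> 1 \<Longrightarrow> (\<Sum>n | 1 \<le> n \<and> real n \<le> x. (norm (f n))\<^sup>2) \<le> C * x"
    using mean_square by blast
  interpret multiplicative_coeffs f C "real d"
  proof
    show "(\<Sum>v=1..V. (norm (f v))\<^sup>2) \<le> C * real V" for V
    proof (cases "V = 0")
      case False
      have "{n. 1 \<le> n \<and> real n \<le> real V} = {1..V}" by auto
      thus ?thesis using C(2)[of "real V"] False by simp
    qed auto
    show "norm (f p) \<le> real d" if "prime p" for p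
      by (rule norm_prime_coeff_le_degree[OF mult summ d(2) that])
  qed (use mult C in auto)
  obtain x0 A c C' where pr: "A > 6" "c > 0" "C' > 0"
    "\<And>x::real. x \<ge> x0 \<Longrightarrow> (\<Sum>p | prime p \<and> real p \<le> x. (norm (f p))\<^sup>2) \<ge> c * (x / ln x)"
    "\<And>x::real. \<And>q \<psi>. x \<ge> x0 \<Longrightarrow> dirichlet_character q \<psi> \<Longrightarrow> \<psi> \<noteq> principal_character q \<Longrightarrow>
            real q \<le> ln x powr A \<Longrightarrow> norm (\<Sum>p | prime p \<and> real p \<le> x. of_real ((norm (f p))\<^sup>2) * \<psi> p)
              \<le> C' * (1 / real (totient q) * (x / (ln x)\<^sup>2))"
    using primes by blast
  \<comment> \<open>Beyond \<open>exp k\<close> the modulus satisfies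
    \<open>k \<le> ln x \<le> ln x powr A\<close>, so the character estimate is available for
    \<open>q = k\<close>.\<close>
  define x1 where "x1 = max x0 (exp (real k))"
  have x1: "x \<ge> x0" "ln x \<ge> real k" "x > 0" if "x \<ge> x1" for x
  proof -
    show "x \<ge> x0" using that by (simp add: x1_def)
    have "x \<ge> exp (real k)" using that by (simp add: x1_def)
    moreover have "exp (real k) > 0" by simp
    ultimately show "x > 0" by linarith
    thus "ln x \<ge> real k" using \<open>x \<ge> exp (real k)\<close> by (subst ln_ge_iff) auto
  qed
  have "\<exists>c'>0. \<exists>x1. \<forall>x\<ge>x1. (\<Sum>p | prime p \<and> real p \<le> x \<and> [p = m] (mod k). (norm (f p))\<^sup>2) \<ge> c' * (x / ln x)"
  proof (rule primes_in_class_lower_bound[OF _ k mk(3) pr(2)])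
    show "c * (x / ln x) \<le> (\<Sum>p | prime p \<and> real p \<le> x. (norm (f p))\<^sup>2)" if "x \<ge> x1" for x
      by (rule pr(4)[OF x1(1)[OF that]])
    show "norm (\<Sum>p | prime p \<and> real p \<le> x. of_real ((norm (f p))\<^sup>2) * \<psi> p) \<le> C' * (x / (ln x)\<^sup>2)"
      if x: "x \<ge> x1" and \<psi>: "dirichlet_character k \<psi>" "\<psi> \<noteq> principal_character k" for x \<psi>
    proof -
      have ln1: "1 \<le> ln x" using x1(2)[OF x] k by simp
      have "real k \<le> ln x powr 1" using x1(2)[OF x] ln1 by simp
      also have "\<dots> \<le> ln x powr A" using pr(1) ln1 by (intro powr_mono) auto
      finally have "norm (\<Sum>p | prime p \<and> real p \<le> x. of_real ((norm (f p))\<^sup>2) * \<psi> p) \<le> C' * (1 / real (totient k) * (x / (ln x)\<^sup>2))"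
        by (rule pr(5)[OF x1(1)[OF x] \<psi>])
      also have "\<dots> \<le> C' * (1 * (x / (ln x)\<^sup>2))"
        using k pr(3) x1(3)[OF x] by (intro mult_left_mono mult_right_mono) (auto simp: Suc_le_eq)
      finally show ?thesis by simp
    qed
  qed auto
  then obtain c' x2 where c': "c' > 0" "\<And>x. x \<ge> x2 \<Longrightarrow> (\<Sum>p | prime p \<and> real p \<le> x \<and> [p = m] (mod k). (norm (f p))\<^sup>2) \<ge> c' * (x / ln x)"
    by blast
  have "twisted_series f lam m k s = twist_sum (tcoeff lam m k) (\<lambda>_. 1) s" for s
    unfolding twisted_series_def twist_sum_def cm_ext_const_1
    by (rule infsum_cong_neutral) (auto simp: tcoeff_def powr_minus_divide)
  hence fin': "finite {s. 1 < Re s \<and> Re s < 1 + \<eta> \<and> twist_sum (tcoeff lam m k) (\<lambda>_. 1) s = 0}" using fin by simp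
  have "real d \<ge> 1" using d(1) by simp
  show False
    by (rule not_finitely_many_zeros[OF lam(3) k mk(3) eta \<open>real d \<ge> 1\<close> summ c' fin'])
qed

end
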